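(* Let $P$ be a polynomial of degree $\lambda\ge 1$ with $\mathrm{Re}\,P(ix)=0$ for all $x\in\mathbb{R}$, and let $0<\varepsilon\le 1$. Fix $0\le\sigma\le 1$ and $r\ge 0$ such that $r+1+4\lambda-2\sigma>1/2$, and assume that the exact solution $u$ of the equation $$\partial_t u+\mathcal{L}_{\varepsilon,\lambda}u+\varepsilon\mathcal{L}_\varepsilon(u^2)=0\quad\text{on }\mathbb{T}$$ satisfies $u\in\mathcal{C}([0,T],H^{r+1+4\lambda-2\sigma}(\mathbb{T}))$. Then there exists $\tau_0>0$ such that for $\tau\le\tau_0$ and $t_n=n\tau\le T$, the fourth order splitting approximation $u^{n+1}=\check\Psi^\tau(u^n)$, $u^0=u(0)$, with $$\check\Psi^\tau=\Psi_2^{d_4\tau}\circ\check\Psi_1^{c_4\tau}\circ\Psi_2^{d_3\tau}\circ\check\Psi_1^{c_3\tau}\circ\Psi_2^{d_2\tau}\circ\check\Psi_1^{c_2\tau}\circ\Psi_2^{d_1\tau}\circ\check\Psi_1^{c_1\tau}$$ (the flows $\Psi_2^t,\check\Psi_1^t$ and the weights $c_i,d_i$ being given in the context), satisfies the global error estimate $$\|u(t_n)-u^n\|_r\le \varepsilon^{1-\sigma}\tau^4 K,$$ for a constant $K=K\big(\sup_{t\in[0,T]}\|u(t)\|_{r+1+4\lambda-2\sigma}\big)>0$ (uniform in $\varepsilon$).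
   Context: $\mathbb{T}=[-\pi,\pi]$ with periodic boundary conditions. For $s\in\mathbb{R}$, $\|\cdot\|_s$ is the standard $H^s(\mathbb{T})$ norm, $\|f\|_s^2=\sum_{k\in\mathbb{Z}}(1+|k|)^{2s}|\hat f_k|^2$. The operators are the Fourier multipliers $\mathcal{L}_\varepsilon=\frac{\partial_x}{1-\varepsilon\partial_x^2}$ with symbol $\frac{ik}{1+\varepsilon k^2}$, $\mathcal{L}_{\varepsilon,\lambda}=\frac{P(\partial_x)}{1-\varepsilon\partial_x^2}$ with symbol $\frac{P(ik)}{1+\varepsilon k^2}$, and $e^{t\mathcal{L}_{\varepsilon,\lambda}}$ with symbol $e^{tP(ik)/(1+\varepsilon k^2)}$, $k\in\mathbb{Z}$. The equation is the (generalised) Benjamin--Bona--Mahony equation; its exact solution satisfies $u(t_n+\tau)=e^{-\tau\mathcal{L}_{\varepsilon,\lambda}}u(t_n)-\varepsilon\mathcal{L}_\varepsilon\int_0^\tau e^{-(\tau-s)\mathcal{L}_{\varepsilon,\lambda}}u^2(t_n+s)\,ds$. Weights: with $\sigma_1=\frac{1}{2-\sqrt[3]{2}}$ and $\sigma_2=\frac{-\sqrt[3]{2}}{2-\sqrt[3]{2}}$ (unrelated to the parameter $\sigma$), set $c_1=0$, $c_2=c_4=\sigma_1$, $c_3=\sigma_2$, $d_1=d_4=\frac12\sigma_1$, $d_2=d_3=\frac12(\sigma_1+\sigma_2)$. Flows, for $t\in\mathbb{R}$: $\Psi_2^t(v)=e^{-t\mathcal{L}_{\varepsilon,\lambda}}v$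 (exact flow of the linear subproblem $\partial_t v=-\mathcal{L}_{\varepsilon,\lambda}v$), and the numerical flow for the nonlinear subproblem $\partial_t w=-\varepsilon\mathcal{L}_\varepsilon w^2$ is defined as $$\begin{aligned}\check\Psi_1^t(w)=\;&w-t\varepsilon\mathcal{L}_\varepsilon w+t^2\varepsilon^2\mathcal{L}_\varepsilon\big(w\,\mathcal{L}_\varepsilon(w^2)\big)-\tfrac{1}{6}t^3\varepsilon^3\mathcal{L}_\varepsilon\big((\mathcal{L}_\varepsilon(w^2))^2\big)-\tfrac23t^3\varepsilon^3\mathcal{L}_\varepsilon\Big(w\,\mathcal{L}_\varepsilon\big(w\,\mathcal{L}_\varepsilon(w^2)\big)\Big)\\&+\tfrac12t^4\varepsilon^4\mathcal{L}_\varepsilon\Big(\mathcal{L}_\varepsilon(w^2)\cdot\mathcal{L}_\varepsilon\big(w\,\mathcal{L}_\varepsilon(w^2)\big)\Big)+\tfrac16t^4\varepsilon^4\mathcal{L}_\varepsilon\Big(w\,\mathcal{L}_\varepsilon\big((\mathcal{L}_\varepsilon(w^2))^2\big)\Big)\\&+\tfrac13t^4\varepsilon^4\mathcal{L}_\varepsilon\bigg(w\,\mathcal{L}_\varepsilon\Big(w\,\mathcal{L}_\varepsilon\big(w\,\mathcal{L}_\varepsilon(w^2)\big)\Big)\bigg).\end{aligned}$$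
   Formalization: Two misprints in the numerical nonlinear flow are corrected, as the estimate fails for the printed formula: the linear term is -tεL_ε(w²) instead of -tεL_ε w, and the coefficient of t³ε³L_ε((L_ε(w²))²) is -1/3 instead of -1/6. *)

theory Defs
  imports "HOL-Analysis.Analysis" "HOL-Computational_Algebra.Polynomial"
begin

text \<open>Functions on the torus are represented by functions \<^typ>\<open>real \<Rightarrow> complex\<close>, of which only the
  restriction to \<open>[-\<pi>, \<pi>]\<close> (up to null sets) is relevant.  Periodicity is not a separate
  requirement: it is encoded, as usual, in the decay of the Fourier coefficients.\<close>

definition fcoeff :: "(real \<Rightarrow> complex) \<Rightarrow> int \<Rightarrow> complex" where
  "fcoeff f k = (1 / (2 * complex_of_real pi)) *
     (LINT x|lebesgue_on {-pi..pi}. f x * exp (- (\<i> * of_int k * of_real x)))"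

definition L2_torus :: "(real \<Rightarrow> complex) set" where
  "L2_torus = {f. f \<in> borel_measurable (lebesgue_on {-pi..pi}) \<and>
                  integrable (lebesgue_on {-pi..pi}) (\<lambda>x. (cmod (f x))\<^sup>2)}"

text \<open>The Sobolev spaces \<open>H\<^sup>s\<close> are only needed for \<open>s \<ge> 0\<close>, so that all elements are functions.
  For functions outside \<open>Hs s\<close> the number \<open>Hs_norm s f\<close> is meaningless.\<close>

definition Hs :: "real \<Rightarrow> (real \<Rightarrow> complex) set" where
  "Hs s = {f \<in> L2_torus.
     (\<lambda>k::int. (1 + \<bar>of_int k\<bar>) powr (2 * s) * (cmod (fcoeff f k))\<^sup>2) summable_on UNIV}"

definition Hs_norm :: "real \<Rightarrow> (real \<Rightarrow> complex) \<Rightarrow> real" where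
  "Hs_norm s f = sqrt (\<Sum>\<^sub>\<infinity>k::int. (1 + \<bar>of_int k\<bar>) powr (2 * s) * (cmod (fcoeff f k))\<^sup>2)"

text \<open>Fourier multipliers are evaluated through the Fourier series itself.  They are only applied
  where that series converges absolutely, e.g. for bounded symbols on \<open>H\<^sup>s\<close> with \<open>s > 1/2\<close>.\<close>

definition fmult :: "(int \<Rightarrow> complex) \<Rightarrow> (real \<Rightarrow> complex) \<Rightarrow> (real \<Rightarrow> complex)" where
  "fmult m f = (\<lambda>x. \<Sum>\<^sub>\<infinity>k::int. m k * fcoeff f k * exp (\<i> * of_int k * of_real x))"

definition L_eps :: "real \<Rightarrow> (real \<Rightarrow> complex) \<Rightarrow> (real \<Rightarrow> complex)" where
  "L_eps \<epsilon> = fmult (\<lambda>k. \<i> * of_int k / (1 + of_real \<epsilon> * (of_int k)\<^sup>2))"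

definition L_eps_P :: "complex poly \<Rightarrow> real \<Rightarrow> (real \<Rightarrow> complex) \<Rightarrow> (real \<Rightarrow> complex)" where
  "L_eps_P P \<epsilon> = fmult (\<lambda>k. poly P (\<i> * of_int k) / (1 + of_real \<epsilon> * (of_int k)\<^sup>2))"

definition exp_L_eps_P ::
    "complex poly \<Rightarrow> real \<Rightarrow> real \<Rightarrow> (real \<Rightarrow> complex) \<Rightarrow> (real \<Rightarrow> complex)" where
  "exp_L_eps_P P \<epsilon> t =
     fmult (\<lambda>k. exp (of_real t * poly P (\<i> * of_int k) / (1 + of_real \<epsilon> * (of_int k)\<^sup>2)))"

definition in_C_Hs :: "real \<Rightarrow> real \<Rightarrow> (real \<Rightarrow> real \<Rightarrow> complex) \<Rightarrow> bool" where
  "in_C_Hs T s u \<longleftrightarrow>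
     (\<forall>t\<in>{0..T}. u t \<in> Hs s) \<and>
     (\<forall>t\<in>{0..T}. ((\<lambda>t'. Hs_norm s (\<lambda>x. u t' x - u t x)) \<longlongrightarrow> 0) (at t within {0..T}))"

text \<open>The equation \<open>\<partial>\<^sub>t u = - L\<^sub>\<epsilon>\<^sub>,\<^sub>\<lambda> u - \<epsilon> L\<^sub>\<epsilon> (u\<^sup>2)\<close> holds on \<open>[0, T]\<close> with the time derivative
  (one-sided at the end points) taken in \<open>L\<^sup>2\<close>, i.e. in \<open>Hs_norm 0\<close>.\<close>

definition gBBM_solution ::
    "complex poly \<Rightarrow> real \<Rightarrow> real \<Rightarrow> (real \<Rightarrow> real \<Rightarrow> complex) \<Rightarrow> bool" where
  "gBBM_solution P \<epsilon> T u \<longleftrightarrow>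
     (\<forall>t\<in>{0..T}.
        ((\<lambda>t'. Hs_norm 0 (\<lambda>x. (u t' x - u t x) / of_real (t' - t)
                 + L_eps_P P \<epsilon> (u t) x + of_real \<epsilon> * L_eps \<epsilon> (\<lambda>y. (u t y)\<^sup>2) x)) \<longlongrightarrow> 0)
        (at t within {0..T}))"

definition \<sigma>1 :: real where "\<sigma>1 = 1 / (2 - root 3 2)"
definition \<sigma>2 :: real where "\<sigma>2 = - root 3 2 / (2 - root 3 2)"

definition c1 :: real where "c1 = 0"
definition c2 :: real where "c2 = \<sigma>1"
definition c3 :: real where "c3 = \<sigma>2"
definition c4 :: real where "c4 = \<sigma>1"

definition d1 :: real where "d1 = \<sigma>1 / 2"
definition d2 :: real where "d2 = (\<sigma>1 + \<sigma>2) / 2"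
definition d3 :: real where "d3 = (\<sigma>1 + \<sigma>2) / 2"
definition d4 :: real where "d4 = \<sigma>1 / 2"

definition Psi2 :: "complex poly \<Rightarrow> real \<Rightarrow> real \<Rightarrow> (real \<Rightarrow> complex) \<Rightarrow> (real \<Rightarrow> complex)" where
  "Psi2 P \<epsilon> t v = exp_L_eps_P P \<epsilon> (- t) v"

text \<open>The numerical flow for \<open>\<partial>\<^sub>t w = - \<epsilon> L\<^sub>\<epsilon> (w\<^sup>2)\<close> is the Taylor polynomial of degree four in \<open>t\<close> of
  its exact flow: with \<open>w(t) = \<Sum>\<^sub>n t\<^sup>n w\<^sub>n\<close> one has
  \<open>(n + 1) w\<^sub>n\<^sub>+\<^sub>1 = - \<epsilon> L\<^sub>\<epsilon> (\<Sum>\<^sub>i\<^sub>\<le>\<^sub>n w\<^sub>i w\<^sub>n\<^sub>-\<^sub>i)\<close>.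
  The linear term is therefore \<open>- t \<epsilon> L\<^sub>\<epsilon> (w\<^sup>2)\<close>, and \<open>L\<^sub>\<epsilon> ((L\<^sub>\<epsilon> (w\<^sup>2))\<^sup>2)\<close> has the coefficient
  \<open>- t\<^sup>3 \<epsilon>\<^sup>3 / 3\<close>.\<close>

definition Psi1 :: "real \<Rightarrow> real \<Rightarrow> (real \<Rightarrow> complex) \<Rightarrow> (real \<Rightarrow> complex)" where
  "Psi1 \<epsilon> t w =
    (let L = L_eps \<epsilon>;
         mul = (\<lambda>f g x. f x * g x :: complex);
         sq = (\<lambda>f x. (f x)\<^sup>2 :: complex);
         h = complex_of_real (t * \<epsilon>)
     in (\<lambda>x. w x
          - h * L (sq w) x
          + h^2 * L (mul w (L (sq w))) x
          - (1/3) * h^3 * L (sq (L (sq w))) x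
          - (2/3) * h^3 * L (mul w (L (mul w (L (sq w))))) x
          + (1/2) * h^4 * L (mul (L (sq w)) (L (mul w (L (sq w))))) x
          + (1/6) * h^4 * L (mul w (L (sq (L (sq w))))) x
          + (1/3) * h^4 * L (mul w (L (mul w (L (mul w (L (sq w))))))) x))"

definition Psi :: "complex poly \<Rightarrow> real \<Rightarrow> real \<Rightarrow> (real \<Rightarrow> complex) \<Rightarrow> (real \<Rightarrow> complex)" where
  "Psi P \<epsilon> \<tau> =
     Psi2 P \<epsilon> (d4 * \<tau>) \<circ> Psi1 \<epsilon> (c4 * \<tau>) \<circ> Psi2 P \<epsilon> (d3 * \<tau>) \<circ> Psi1 \<epsilon> (c3 * \<tau>) \<circ>
     Psi2 P \<epsilon> (d2 * \<tau>) \<circ> Psi1 \<epsilon> (c2 * \<tau>) \<circ> Psi2 P \<epsilon> (d1 * \<tau>) \<circ> Psi1 \<epsilon> (c1 * \<tau>)"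

end

theory Submission imports Defs begin

text \<open>On the level of Fourier coefficients and in the interaction picture \<open>v(t) = e\<^sup>t\<^sup>A u(t)\<close> the equation
  becomes \<open>v' = - E C\<^sub>t(v, v)\<close>, where \<open>C\<^sub>t\<close> is a convolution with the unimodular symbol
  \<open>exp (t \<phi>)\<close> and \<open>E\<close> is the bounded multiplier \<open>\<epsilon> L\<^sub>\<epsilon>\<close>.  A splitting step is a composition of three Taylor
  polynomials of flows with the time in \<open>C\<^sub>t\<close> frozen.  Both the exact and the numerical solution are
  expanded in powers of the step size, with coefficients indexed by binary trees; expanding \<open>C\<^sub>t\<close> to
  order \<open>n\<close> costs \<open>n\<close> powers of the phase \<open>\<phi>\<close>, that is \<open>n \<lambda>\<close> derivatives, while an iteration of \<open>E C\<^sub>t\<close>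
  costs none.  Hence the remainder of order five costs \<open>4 \<lambda>\<close> derivatives, and the outermost \<open>E\<close> yields
  the factor \<open>\<epsilon>\<^sup>1\<^sup>-\<^sup>\<sigma>\<close> for another \<open>1 - 2 \<sigma>\<close>.  The coefficients agree up to order four because \<open>\<sigma>1\<close> and
  \<open>\<sigma>2\<close> are the triple jump weights.  The same expansion truncated at order two controls the numerical
  solution in a stronger norm, and the global estimate follows from stability.\<close>

subsection \<open>Weighted sequence spaces\<close>

text \<open>Little regularity is left at the end: \<open>zz 4\<close> equals
  \<open>r + 1 - 2 * \<sigma>\<close>, which is negative for small \<open>r\<close> and large
  \<open>\<sigma>\<close>. Products must therefore be estimated in negative spaces as well. This
  works because the losses add up: \<open>zz a + zz b - n * lam\<close> exceeds
  \<open>zz (a + b + n)\<close> by exactly \<open>zz 0\<close>, which is at least 1, however the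
  loss is distributed. The second obstacle is uniformity in \<open>\<epsilon>\<close>. The smoothing
  by the denominator is exploited in \<open>E\<close> only, never in \<open>A\<close>. Instead the
  phase is imaginary, so that the Taylor remainders of \<open>exp (t * \<phi>)\<close> are bounded
  by powers of \<open>t * \<phi>\<close> for arbitrarily large phases, and the step size need not be
  related to the frequencies. Order two is the natural truncation for the auxiliary bound: a local
  error of order two is the lowest one that still tends to zero after summation over all steps, and
  \<open>zz 2 \<ge> 1\<close> still gives an algebra, whereas \<open>zz 3\<close> can be 0.\<close>

type_synonym seq = "int \<Rightarrow> complex"

definition jb :: "int \<Rightarrow> real" where "jb k = 1 + \<bar>of_int k\<bar>"

lemma jb_ge1: "1 \<le> jb k" by (simp add: jb_def)
lemma jb_pos [simp]: "0 < jb k" using jb_ge1[of k] by linarith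
lemma jb_neq0 [simp]: "jb k \<noteq> 0" using jb_pos[of k] by linarith
lemma jb_nonneg [simp]: "0 \<le> jb k" using jb_pos[of k] by linarith
lemma jb_triangle: "jb k \<le> jb j + jb (k - j)"
  by (simp add: jb_def)
text \<open>Peetre's inequality. It takes the place of \<open>jb_triangle\<close> when a negative
  power of \<open>jb k\<close> has to be bounded.\<close>

lemma jb_product: "jb j \<le> jb k * jb (k - j)"
proof -
  have "jb j \<le> jb k + jb (k - j) - 1" by (simp add: jb_def)
  moreover have "0 \<le> (jb k - 1) * (jb (k - j) - 1)"
    using jb_ge1[of k] jb_ge1[of "k-j"] by simp
  ultimately show ?thesis by (simp add: algebra_simps)
qed

lemma jb_powr_mono: "a \<le> b \<Longrightarrow> jb k powr a \<le> jb k powr b"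
  by (rule powr_mono) (auto simp: jb_ge1)

text \<open>Bounding all finite sections expresses that the weighted l2 norm is finite and that it
  is at most \<open>C\<close> in one predicate, without the default value which an infinite sum has
  in the divergent case.\<close>

definition hbd :: "real \<Rightarrow> seq \<Rightarrow> real \<Rightarrow> bool" where
  "hbd a f C \<longleftrightarrow> (\<forall>K. finite K \<longrightarrow> L2_set (\<lambda>k. jb k powr a * cmod (f k)) K \<le> C)"

lemma hbdD: "hbd a f C \<Longrightarrow> finite K \<Longrightarrow> L2_set (\<lambda>k. jb k powr a * cmod (f k)) K \<le> C"
  by (simp add: hbd_def)

lemma hbd_nonneg: "hbd a f C \<Longrightarrow> 0 \<le> C"
  using hbdD[of a f C "{}"] by simp

lemma hbd_mono: "hbd a f C \<Longrightarrow> C \<le> D \<Longrightarrow> hbd a f D"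
  unfolding hbd_def by (meson order_trans)

lemma hbd_dom:
  assumes "hbd a f C" and "0 \<le> c"
    and "\<And>k. jb k powr b * cmod (g k) \<le> c * (jb k powr a * cmod (f k))"
  shows "hbd b g (c * C)"
  unfolding hbd_def
proof (intro allI impI)
  fix K :: "int set" assume K: "finite K"
  have "L2_set (\<lambda>k. jb k powr b * cmod (g k)) K \<le> L2_set (\<lambda>k. c * (jb k powr a * cmod (f k))) K"
    by (rule L2_set_mono) (use assms(3) in auto)
  also have "\<dots> = c * L2_set (\<lambda>k. jb k powr a * cmod (f k)) K"
    by (rule L2_set_right_distrib[symmetric]) fact
  also have "\<dots> \<le> c * C" using hbdD[OF assms(1) K] assms(2) by (rule mult_left_mono)
  finally show "L2_set (\<lambda>k. jb k powr b * cmod (g k)) K \<le> c * C" .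
qed

lemma hbd_weaken: "hbd a f C \<Longrightarrow> b \<le> a \<Longrightarrow> hbd b f C"
  using hbd_dom[of a f C 1 b f] by (simp add: jb_powr_mono mult_right_mono)

lemma hbd_scale: "hbd a f C \<Longrightarrow> hbd a (\<lambda>k. c * f k) (cmod c * C)"
  by (rule hbd_dom) (auto simp: norm_mult)

lemma hbd_mult_le1:
  assumes "hbd a f C" "\<And>k. cmod (m k) \<le> 1" shows "hbd a (\<lambda>k. m k * f k) C"
  using hbd_dom[OF assms(1), of 1 a "\<lambda>k. m k * f k"] assms(2)
  by (simp add: norm_mult mult_left_mono mult_left_le_one_le)

lemma hbd_zero [simp]: "0 \<le> C \<Longrightarrow> hbd a (\<lambda>k. 0) C"
  by (simp add: hbd_def L2_set_def)

lemma hbd_add: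
  assumes "hbd a f C" "hbd a g D" shows "hbd a (\<lambda>k. f k + g k) (C + D)"
  unfolding hbd_def
proof (intro allI impI)
  fix K :: "int set" assume K: "finite K"
  have "L2_set (\<lambda>k. jb k powr a * cmod (f k + g k)) K
     \<le> L2_set (\<lambda>k. jb k powr a * cmod (f k) + jb k powr a * cmod (g k)) K"
    by (rule L2_set_mono) (auto simp: distrib_left[symmetric] norm_triangle_ineq mult_left_mono)
  also have "\<dots> \<le> L2_set (\<lambda>k. jb k powr a * cmod (f k)) K + L2_set (\<lambda>k. jb k powr a * cmod (g k)) K"
    by (rule L2_set_triangle_ineq)
  also have "\<dots> \<le> C + D" using hbdD[OF assms(1) K] hbdD[OF assms(2) K] by simp
  finally show "L2_set (\<lambda>k. jb k powr a * cmod (f k + g k)) K \<le> C + D" .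
qed

lemma hbd_diff:
  assumes "hbd a f C" "hbd a g D" shows "hbd a (\<lambda>k. f k - g k) (C + D)"
  using hbd_add[OF assms(1) hbd_scale[OF assms(2), of "-1"]] by simp

text \<open>A mean value theorem that replaces Minkowski's integral inequality: it is applied to the scalar
  product of \<open>g\<close> with its own increment over a finite set of frequencies.\<close>

lemma hbd_mvt:
  fixes g g' :: "real \<Rightarrow> seq"
  assumes S: "0 < S"
    and d: "\<And>s k. 0 \<le> s \<Longrightarrow> s \<le> S \<Longrightarrow> ((\<lambda>s. g s k) has_vector_derivative g' s k) (at s within {0..S})"
    and b: "\<And>s. 0 < s \<Longrightarrow> s \<le> S \<Longrightarrow> hbd a (g' s) C"
  shows "hbd a (\<lambda>k. g S k - g 0 k) (S * C)"
  unfolding hbd_def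
proof (intro allI impI)
  fix K :: "int set" assume K: "finite K"
  define w where "w k = (jb k powr a)" for k
  have w: "w k \<ge> 0" for k by (simp add: w_def)
  define e where "e k = g S k - g 0 k" for k
  define H where "H s = (\<Sum>k\<in>K. (w k)\<^sup>2 * (e k \<bullet> g s k))" for s
  define H' where "H' s = (\<lambda>h. h * (\<Sum>k\<in>K. (w k)\<^sup>2 * (e k \<bullet> g' s k)))" for s
  let ?D = "L2_set (\<lambda>k. w k * cmod (e k)) K"
  have "(H has_derivative H' s) (at s within {0..S})" if "0 \<le> s" "s \<le> S" for s
  proof -
    have "((\<lambda>s. \<Sum>k\<in>K. (w k)\<^sup>2 * (e k \<bullet> g s k)) has_derivative
          (\<lambda>h. \<Sum>k\<in>K. (w k)\<^sup>2 * (e k \<bullet> (h *\<^sub>R g' s k)))) (at s within {0..S})"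
      by (intro derivative_intros d[OF that, unfolded has_vector_derivative_def])
    then show ?thesis unfolding H_def[abs_def] H'_def
      by (simp add: sum_distrib_left mult_ac)
  qed
  then obtain x where x: "x \<in> {0<..<S}" "H S - H 0 = H' x (S - 0)"
    using mvt_simple[OF S, of H H'] by auto
  have 1: "H S - H 0 = ?D\<^sup>2"
    unfolding H_def L2_set_def
    by (simp add: sum_nonneg sum_subtractf[symmetric] right_diff_distrib[symmetric]
        inner_diff_right[symmetric] e_def[symmetric] power_mult_distrib power2_norm_eq_inner)
  have 2: "H S - H 0 \<le> S * (?D * C)"
  proof -
    have "(\<Sum>k\<in>K. (w k)\<^sup>2 * (e k \<bullet> g' x k)) \<le> (\<Sum>k\<in>K. \<bar>w k * cmod (e k)\<bar> * \<bar>w k * cmod (g' x k)\<bar>)"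
    proof (rule sum_mono)
      fix k
      have "e k \<bullet> g' x k \<le> cmod (e k) * cmod (g' x k)" by (rule norm_cauchy_schwarz)
      then have "(w k)\<^sup>2 * (e k \<bullet> g' x k) \<le> (w k)\<^sup>2 * (cmod (e k) * cmod (g' x k))"
        by (rule mult_left_mono) simp
      then show "(w k)\<^sup>2 * (e k \<bullet> g' x k) \<le> \<bar>w k * cmod (e k)\<bar> * \<bar>w k * cmod (g' x k)\<bar>"
        using w by (simp add: abs_mult power2_eq_square mult_ac)
    qed
    also have "\<dots> \<le> ?D * L2_set (\<lambda>k. w k * cmod (g' x k)) K" by (rule L2_set_mult_ineq)
    also have "\<dots> \<le> ?D * C"
      using hbdD[OF b K, of x] x by (intro mult_left_mono) (auto simp: w_def)
    finally show ?thesis using x S by (simp add: H'_def mult_left_mono)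
  qed
  \<comment> \<open>The increment occurs on both sides, and one factor \<open>?D\<close> is
    cancelled.\<close>
  have *: "?D * ?D \<le> (S * C) * ?D" using 1 2 by (simp add: power2_eq_square mult_ac)
  have "0 \<le> C" using hbd_nonneg[OF b, of S] S by simp
  then have "?D \<le> S * C"
  proof (cases "?D = 0")
    case False
    then have "?D > 0" using L2_set_nonneg[of "\<lambda>k. w k * cmod (e k)" K] by linarith
    with * show ?thesis by simp
  qed (use S in simp)
  then show "L2_set (\<lambda>k. jb k powr a * cmod (g S k - g 0 k)) K \<le> S * C"
    by (simp add: w_def e_def)
qed

definition zeta2 :: real where "zeta2 = (\<Sum>\<^sub>\<infinity>k::int. inverse ((jb k)\<^sup>2))"

lemma jb_inv_sq_summable: "(\<lambda>k. inverse ((jb k)\<^sup>2)) summable_on UNIV"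
proof -
  have n: "(\<lambda>n::nat. inverse ((1 + real n)\<^sup>2)) summable_on UNIV"
  proof (rule summable_nonneg_imp_summable_on)
    show "summable (\<lambda>n::nat. inverse ((1 + real n)\<^sup>2))"
      using inverse_power_summable[of 2, where 'a=real] summable_Suc_iff[of "\<lambda>n. inverse ((real n)\<^sup>2)"] by simp
  qed auto
  have "bij_betw int UNIV {0..}" by (rule bij_betwI[of _ _ _ nat]) auto
  from summable_on_reindex_bij_betw[OF this, of "\<lambda>k. inverse ((jb k)\<^sup>2)"] n
  have a: "(\<lambda>k. inverse ((jb k)\<^sup>2)) summable_on {0..}" by (simp add: jb_def)
  have "bij_betw uminus {0::int..} {..0}" by (rule bij_betwI[of _ _ _ uminus]) auto
  from summable_on_reindex_bij_betw[OF this, of "\<lambda>k. inverse ((jb k)\<^sup>2)"] a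
  have b: "(\<lambda>k. inverse ((jb k)\<^sup>2)) summable_on {..0}" by (simp add: jb_def)
  then have "(\<lambda>k. inverse ((jb k)\<^sup>2)) summable_on {..<0}"
    by (rule summable_on_subset_banach) auto
  then have "(\<lambda>k. inverse ((jb k)\<^sup>2)) summable_on {0..} \<union> {..<0}"
    by (intro summable_on_Un_disjoint a) auto
  also have "{0..} \<union> {..<0} = (UNIV :: int set)" by auto
  finally show ?thesis .
qed

lemma weighted_l1_bound:
  fixes F :: "int \<Rightarrow> real"
  assumes F: "\<And>j. 0 \<le> F j" "\<And>K. finite K \<Longrightarrow> L2_set F K \<le> A" and J: "finite J"
  shows "(\<Sum>j\<in>J. F j / jb j) \<le> sqrt zeta2 * A"
proof -
  have "(\<Sum>j\<in>J. F j / jb j) = (\<Sum>j\<in>J. \<bar>inverse (jb j)\<bar> * \<bar>F j\<bar>)"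
    using F by (intro sum.cong) (auto simp: field_simps)
  also have "\<dots> \<le> L2_set (\<lambda>j. inverse (jb j)) J * L2_set F J" by (rule L2_set_mult_ineq)
  also have "\<dots> \<le> sqrt zeta2 * A"
  proof (intro mult_mono F J)
    show "L2_set (\<lambda>j. inverse (jb j)) J \<le> sqrt zeta2"
      unfolding L2_set_def zeta2_def power_inverse
      by (intro real_sqrt_le_mono finite_sum_le_infsum jb_inv_sq_summable J) auto
    show "0 \<le> sqrt zeta2" unfolding zeta2_def by (intro real_sqrt_ge_zero infsum_nonneg) auto
  qed auto
  finally show ?thesis .
qed

text \<open>Young's inequality: division by \<open>jb\<close> makes \<open>F\<close> summable, and
  the convolution of a summable with a square summable sequence is square summable. Minkowski's
  inequality is applied to finite sums of shifts of \<open>G\<close>, followed by a limit.\<close>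

lemma conv_l2_bound:
  fixes F G :: "int \<Rightarrow> real"
  assumes F: "\<And>j. 0 \<le> F j" "\<And>K. finite K \<Longrightarrow> L2_set F K \<le> A"
    and G: "\<And>j. 0 \<le> G j" "\<And>K. finite K \<Longrightarrow> L2_set G K \<le> B"
  shows "(\<lambda>j. F j / jb j * G (k - j)) summable_on UNIV"
    and "finite K \<Longrightarrow> L2_set (\<lambda>k. \<Sum>\<^sub>\<infinity>j. F j / jb j * G (k - j)) K \<le> sqrt zeta2 * A * B"
proof -
  have B: "0 \<le> B" using G(2)[of "{}"] by simp
  have Gk: "G j \<le> B" for j using G(1)[of j] G(2)[of "{j}"] by (simp add: L2_set_def)
  have sm: "(\<lambda>j. F j / jb j * G (k - j)) summable_on UNIV" for k
  proof (rule nonneg_bdd_above_summable_on)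
    show "bdd_above (sum (\<lambda>j. F j / jb j * G (k - j)) ` {J. J \<subseteq> UNIV \<and> finite J})"
    proof (rule bdd_aboveI2)
      fix J assume "J \<in> {J. J \<subseteq> (UNIV::int set) \<and> finite J}"
      then have J: "finite J" by simp
      have "(\<Sum>j\<in>J. F j / jb j * G (k - j)) \<le> (\<Sum>j\<in>J. F j / jb j * B)"
        by (intro sum_mono mult_left_mono Gk) (use F in auto)
      also have "\<dots> \<le> sqrt zeta2 * A * B"
        unfolding sum_distrib_right[symmetric]
        by (intro mult_right_mono weighted_l1_bound F J B)
      finally show "(\<Sum>j\<in>J. F j / jb j * G (k - j)) \<le> sqrt zeta2 * A * B" .
    qed
  qed (use F G in auto)
  then show "(\<lambda>j. F j / jb j * G (k - j)) summable_on UNIV" .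
  assume K: "finite K"
  let ?h = "\<lambda>k. \<Sum>\<^sub>\<infinity>j. F j / jb j * G (k - j)"
  have lim: "((\<lambda>J. L2_set (\<lambda>k. \<Sum>j\<in>J. F j / jb j * G (k - j)) K) \<longlongrightarrow> L2_set ?h K)
     (finite_subsets_at_top UNIV)"
    unfolding L2_set_def by (intro tendsto_intros infsum_tendsto sm)
  have "L2_set (\<lambda>k. \<Sum>j\<in>J. F j / jb j * G (k - j)) K \<le> sqrt zeta2 * A * B" if J: "finite J" for J
  proof -
    have "L2_set (\<lambda>k. \<Sum>j\<in>J. F j / jb j * G (k - j)) K \<le> (\<Sum>j\<in>J. F j / jb j * B)"
      using J
    proof (induction J)
      case (insert j J)
      have "L2_set (\<lambda>k. G (k - j)) K = L2_set G ((\<lambda>k. k - j) ` K)"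
        unfolding L2_set_def by (simp add: sum.reindex inj_on_def)
      also have "\<dots> \<le> B" using K by (intro G) auto
      finally have "F j / jb j * L2_set (\<lambda>k. G (k - j)) K \<le> F j / jb j * B"
        using F by (intro mult_left_mono) auto
      then have 1: "L2_set (\<lambda>k. F j / jb j * G (k - j)) K \<le> F j / jb j * B"
        using F L2_set_right_distrib[of "F j / jb j" "\<lambda>k. G (k - j)" K] by simp
      show ?case
        using L2_set_triangle_ineq[of "\<lambda>k. F j / jb j * G (k - j)" "\<lambda>k. \<Sum>j\<in>J. F j / jb j * G (k - j)" K]
          1 insert by simp
    qed (simp add: L2_set_def)
    also have "\<dots> \<le> sqrt zeta2 * A * B"
      unfolding sum_distrib_right[symmetric]
      by (intro mult_right_mono weighted_l1_bound F J B)
    finally show ?thesis .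
  qed
  then show "L2_set ?h K \<le> sqrt zeta2 * A * B"
    by (intro tendsto_upperbound[OF lim]) (auto intro: eventually_finite_subsets_at_top_weakI)
qed

text \<open>Here \<open>x\<close> is the larger and \<open>y\<close> the smaller input weight, and
  \<open>z\<close> is the output weight. For \<open>c \<ge> 0\<close> the output is at most
  \<open>2 * x\<close>, for \<open>c < 0\<close> it is at least \<open>x / y\<close>. In both cases
  surplus powers of \<open>x\<close> are traded for powers of \<open>y\<close>, and a factor
  \<open>1 / y\<close> is kept for the summation.\<close>

lemma weight_real:
  fixes x y z :: real
  assumes x: "y \<le> x" "1 \<le> y" "1 \<le> z" "z \<le> x + y" "x \<le> z * y"
    and c: "c \<le> a" "c \<le> b" "1 \<le> a + b" "1 \<le> a + b - c"
  shows "z powr c \<le> 2 powr \<bar>c\<bar> * (x powr a * y powr b / y)"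
proof (cases "0 \<le> c")
  case True
  have "z powr c \<le> (2 * x) powr c" using x True by (intro powr_mono2) auto
  also have "\<dots> = 2 powr \<bar>c\<bar> * (x powr a * x powr (c - a))"
    using x True by (simp add: powr_mult powr_add[symmetric])
  also have "\<dots> \<le> 2 powr \<bar>c\<bar> * (x powr a * y powr (c - a))"
    using x c by (intro mult_left_mono powr_mono2') auto
  also have "\<dots> \<le> 2 powr \<bar>c\<bar> * (x powr a * y powr (b - 1))"
    using x c by (intro mult_left_mono powr_mono) auto
  finally show ?thesis using x by (simp add: powr_diff)
next
  case False
  have "z powr c \<le> (x / y) powr c"
    using x False by (intro powr_mono2') (auto simp: field_simps)
  also have "\<dots> = x powr c * y powr (- c)"
    using x powr_divide[of x y c] by (simp add: powr_minus divide_inverse)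
  also have "\<dots> = x powr a * (x powr (c - a) * y powr (- c))"
    using x by (simp add: powr_add[symmetric])
  also have "\<dots> \<le> x powr a * (y powr (c - a) * y powr (- c))"
    using x c by (intro mult_left_mono mult_right_mono powr_mono2') auto
  also have "\<dots> = x powr a * y powr (- a)" using x by (simp add: powr_add[symmetric])
  also have "\<dots> \<le> x powr a * y powr (b - 1)"
    using x c by (intro mult_left_mono powr_mono) auto
  also have "\<dots> \<le> 2 powr \<bar>c\<bar> * (x powr a * y powr (b - 1))"
    using mult_right_mono[OF ge_one_powr_ge_zero[of 2 "\<bar>c\<bar>"], of "x powr a * y powr (b - 1)"] by simp
  finally show ?thesis using x by (simp add: powr_diff)
qed

lemma weight_jb:
  assumes c: "c \<le> a" "c \<le> b" "1 \<le> a + b" "1 \<le> a + b - c"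
  shows "jb k powr c \<le> 2 powr \<bar>c\<bar> * (jb j powr a * jb (k - j) powr b * (1 / jb j + 1 / jb (k - j)))"
proof (cases "jb (k - j) \<le> jb j")
  case True
  have "jb k powr c \<le> 2 powr \<bar>c\<bar> * (jb j powr a * jb (k - j) powr b / jb (k - j))"
    using True jb_product[of j k] jb_triangle[of k j] by (intro weight_real c jb_ge1)
  also have "\<dots> \<le> 2 powr \<bar>c\<bar> * (jb j powr a * jb (k - j) powr b * (1 / jb j + 1 / jb (k - j)))"
    by (simp add: distrib_left)
  finally show ?thesis .
next
  case False
  have "jb k powr c \<le> 2 powr \<bar>c\<bar> * (jb (k - j) powr b * jb j powr a / jb j)"
    using False jb_product[of "k - j" k] jb_triangle[of k "k - j"] c by (intro weight_real jb_ge1) auto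
  also have "\<dots> \<le> 2 powr \<bar>c\<bar> * (jb j powr a * jb (k - j) powr b * (1 / jb j + 1 / jb (k - j)))"
    by (simp add: distrib_left mult_ac)
  finally show ?thesis .
qed

text \<open>The loss sits on one input at a time and is charged to the exponent of that input, so
  that \<open>weight_jb\<close> applies with \<open>a - e\<close> or with
  \<open>b - e\<close>.\<close>

lemma weight_jb_loss:
  assumes c: "c + e \<le> a" "c + e \<le> b" "0 \<le> e" "1 \<le> a + b - e" "1 \<le> a + b - e - c"
  shows "jb k powr c * (jb j powr e + jb (k - j) powr e)
    \<le> 2 * 2 powr \<bar>c\<bar> * (jb j powr a * jb (k - j) powr b * (1 / jb j + 1 / jb (k - j)))"
proof -
  define W where "W = 1 / jb j + 1 / jb (k - j)"
  define X where "X = 2 powr \<bar>c\<bar> * (jb j powr a * jb (k - j) powr b * W)"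
  have "jb k powr c * jb j powr e \<le> 2 powr \<bar>c\<bar> * (jb j powr (a - e) * jb (k - j) powr b * W) * jb j powr e"
    unfolding W_def using c by (intro mult_right_mono weight_jb) auto
  also have "\<dots> = 2 powr \<bar>c\<bar> * ((jb j powr (a - e) * jb j powr e) * jb (k - j) powr b * W)"
    by (simp only: mult_ac)
  also have "\<dots> = X" by (simp add: X_def powr_add[symmetric])
  finally have 1: "jb k powr c * jb j powr e \<le> X" .
  have "jb k powr c * jb (k - j) powr e \<le> 2 powr \<bar>c\<bar> * (jb j powr a * jb (k - j) powr (b - e) * W) * jb (k - j) powr e"
    unfolding W_def using c by (intro mult_right_mono weight_jb) auto
  also have "\<dots> = 2 powr \<bar>c\<bar> * (jb j powr a * (jb (k - j) powr (b - e) * jb (k - j) powr e) * W)"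
    by (simp only: mult_ac)
  also have "\<dots> = X" by (simp add: X_def powr_add[symmetric])
  finally have "jb k powr c * (jb j powr e + jb (k - j) powr e) \<le> 2 * X"
    using 1 by (simp add: distrib_left)
  then show ?thesis by (simp add: X_def W_def)
qed

section \<open>Bilinear Fourier multipliers on weighted sequences\<close>

definition Bil :: "(int \<Rightarrow> seq) \<Rightarrow> seq \<Rightarrow> seq \<Rightarrow> seq" where
  "Bil m f g k = (\<Sum>\<^sub>\<infinity>j. m k j * f j * g (k - j))"

text \<open>\<open>infsum\<close> is 0 for families that are not summable. Additivity of
  \<open>Bil\<close> therefore has to carry this predicate along, while homogeneity holds
  unconditionally.\<close>

definition bsum :: "(int \<Rightarrow> seq) \<Rightarrow> seq \<Rightarrow> seq \<Rightarrow> bool" where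
  "bsum m f g \<longleftrightarrow> (\<forall>k. (\<lambda>j. m k j * f j * g (k - j)) summable_on UNIV)"

text \<open>One factor 2 comes from the two positions of the derivative loss, the other from the two
  choices of the frequency that is summed by Cauchy-Schwarz.\<close>

definition bilc :: "real \<Rightarrow> real" where "bilc c = 4 * 2 powr \<bar>c\<bar> * sqrt zeta2"

lemma zeta2_nonneg: "0 \<le> zeta2" unfolding zeta2_def by (intro infsum_nonneg) auto
lemma bilc_nonneg [simp]: "0 \<le> bilc c" by (simp add: bilc_def zeta2_nonneg)

text \<open>The lower of the two frequencies is summed by Cauchy-Schwarz, which accounts for the margins
  \<open>1\<close>.\<close>

lemma bil_bound:
  assumes f: "hbd a f A" and g: "hbd b g B"
    and m: "\<And>k j. cmod (m k j) \<le> C * (jb j powr e + jb (k - j) powr e)" and C: "0 \<le> C"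
    and c: "c + e \<le> a" "c + e \<le> b" "0 \<le> e" "1 \<le> a + b - e" "1 \<le> a + b - e - c"
  shows "bsum m f g" and "hbd c (Bil m f g) (bilc c * C * A * B)"
proof -
  define F where "F j = jb j powr a * cmod (f j)" for j
  define G where "G j = jb j powr b * cmod (g j)" for j
  have F: "\<And>j. 0 \<le> F j" "\<And>K. finite K \<Longrightarrow> L2_set F K \<le> A"
    using f by (auto simp: F_def[abs_def] hbd_def)
  have G: "\<And>j. 0 \<le> G j" "\<And>K. finite K \<Longrightarrow> L2_set G K \<le> B"
    using g by (auto simp: G_def[abs_def] hbd_def)
  define D where "D = C * (2 * 2 powr \<bar>c\<bar>)"
  have D: "0 \<le> D" using C by (simp add: D_def)
  have bij: "bij_betw (\<lambda>j. k - j) UNIV (UNIV :: int set)" for k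
    by (rule bij_betwI[of _ _ _ "\<lambda>j. k - j"]) auto
  \<comment> \<open>In \<open>h1\<close> the first factor is made summable, in \<open>h2\<close> the
    second one. The reflection \<open>j \<mapsto> k - j\<close> exchanges the two cases.\<close>
  define h1 where "h1 k = (\<Sum>\<^sub>\<infinity>j. F j / jb j * G (k - j))" for k
  define h2 where "h2 k = (\<Sum>\<^sub>\<infinity>j. G j / jb j * F (k - j))" for k
  have s1: "(\<lambda>j. F j / jb j * G (k - j)) summable_on UNIV" for k
    by (rule conv_l2_bound[OF F G])
  have s2: "(\<lambda>j. F j * (G (k - j) / jb (k - j))) summable_on UNIV" for k
    using summable_on_reindex_bij_betw[OF bij[of k], of "\<lambda>j. G j / jb j * F (k - j)"]
      conv_l2_bound(1)[OF G F, of k] by (simp add: mult.commute)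
  have i2: "(\<Sum>\<^sub>\<infinity>j. F j * (G (k - j) / jb (k - j))) = h2 k" for k
    using infsum_reindex_bij_betw[OF bij[of k], of "\<lambda>j. G j / jb j * F (k - j)"]
    by (simp add: h2_def mult.commute)
  have s3: "(\<lambda>j. D * (F j / jb j * G (k - j) + F j * (G (k - j) / jb (k - j)))) summable_on UNIV" for k
    by (intro summable_on_cmult_right summable_on_add s1 s2)
  have dom: "jb k powr c * cmod (m k j * f j * g (k - j))
      \<le> D * (F j / jb j * G (k - j) + F j * (G (k - j) / jb (k - j)))" for k j
  proof -
    have "jb k powr c * cmod (m k j * f j * g (k - j))
       = (jb k powr c * cmod (m k j)) * (cmod (f j) * cmod (g (k - j)))" by (simp add: norm_mult)
    also have "\<dots> \<le> (jb k powr c * (C * (jb j powr e + jb (k - j) powr e))) * (cmod (f j) * cmod (g (k - j)))"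
      by (intro mult_right_mono mult_left_mono m) auto
    also have "\<dots> = C * (jb k powr c * (jb j powr e + jb (k - j) powr e)) * (cmod (f j) * cmod (g (k - j)))"
      by simp
    also have "\<dots> \<le> C * (2 * 2 powr \<bar>c\<bar> * (jb j powr a * jb (k - j) powr b * (1 / jb j + 1 / jb (k - j))))
        * (cmod (f j) * cmod (g (k - j)))"
      by (intro mult_right_mono mult_left_mono weight_jb_loss c C) auto
    also have "\<dots> = D * (F j / jb j * G (k - j) + F j * (G (k - j) / jb (k - j)))"
      by (simp add: D_def F_def G_def field_simps)
    finally show ?thesis .
  qed
  have sm: "(\<lambda>j. cmod (m k j * f j * g (k - j))) summable_on UNIV" for k
  proof -
    have "(\<lambda>j. jb k powr c * cmod (m k j * f j * g (k - j))) summable_on UNIV"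
      by (rule summable_on_comparison_test[OF s3[of k]]) (use dom in auto)
    from summable_on_cmult_right[OF this, of "inverse (jb k powr c)"] show ?thesis
      by (simp add: mult.assoc[symmetric])
  qed
  then show "bsum m f g" unfolding bsum_def by (auto intro: abs_summable_summable)
  have pw: "jb k powr c * cmod (Bil m f g k) \<le> D * (h1 k + h2 k)" for k
  proof -
    have "jb k powr c * cmod (Bil m f g k) \<le> jb k powr c * (\<Sum>\<^sub>\<infinity>j. cmod (m k j * f j * g (k - j)))"
      unfolding Bil_def by (intro mult_left_mono norm_infsum_bound sm) auto
    also have "\<dots> = (\<Sum>\<^sub>\<infinity>j. jb k powr c * cmod (m k j * f j * g (k - j)))"
      by (rule infsum_cmult_right'[symmetric])
    also have "\<dots> \<le> (\<Sum>\<^sub>\<infinity>j. D * (F j / jb j * G (k - j) + F j * (G (k - j) / jb (k - j))))"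
      by (intro infsum_mono summable_on_cmult_right sm s3 dom)
    also have "\<dots> = D * (h1 k + h2 k)"
      by (simp only: infsum_cmult_right' infsum_add[OF s1 s2] h1_def i2)
    finally show ?thesis .
  qed
  show "hbd c (Bil m f g) (bilc c * C * A * B)"
    unfolding hbd_def
  proof (intro allI impI)
    fix K :: "int set" assume K: "finite K"
    have "L2_set (\<lambda>k. jb k powr c * cmod (Bil m f g k)) K \<le> L2_set (\<lambda>k. D * (h1 k + h2 k)) K"
      by (intro L2_set_mono pw) auto
    also have "\<dots> = D * L2_set (\<lambda>k. h1 k + h2 k) K"
      by (rule L2_set_right_distrib[symmetric]) fact
    also have "\<dots> \<le> D * (L2_set h1 K + L2_set h2 K)"
      by (intro mult_left_mono L2_set_triangle_ineq D)
    also have "\<dots> \<le> D * (sqrt zeta2 * A * B + sqrt zeta2 * B * A)"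
      unfolding h1_def[abs_def] h2_def[abs_def]
      by (intro mult_left_mono add_mono conv_l2_bound(2)[OF F G K] conv_l2_bound(2)[OF G F K] D)
    also have "\<dots> = bilc c * C * A * B" by (simp add: D_def bilc_def)
    finally show "L2_set (\<lambda>k. jb k powr c * cmod (Bil m f g k)) K \<le> bilc c * C * A * B" .
  qed
qed

lemma Bil_add_left: "bsum m f g \<Longrightarrow> bsum m f' g \<Longrightarrow> Bil m (\<lambda>k. f k + f' k) g k = Bil m f g k + Bil m f' g k"
  unfolding Bil_def bsum_def by (subst infsum_add[symmetric]) (auto simp: algebra_simps)

lemma Bil_add_right: "bsum m f g \<Longrightarrow> bsum m f g' \<Longrightarrow> Bil m f (\<lambda>k. g k + g' k) k = Bil m f g k + Bil m f g' k"
  unfolding Bil_def bsum_def by (subst infsum_add[symmetric]) (auto simp: algebra_simps)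

lemma Bil_add_sym: "bsum m f g \<Longrightarrow> bsum m' f g \<Longrightarrow> Bil (\<lambda>k j. m k j + m' k j) f g k = Bil m f g k + Bil m' f g k"
  unfolding Bil_def bsum_def by (subst infsum_add[symmetric]) (auto simp: algebra_simps)

lemma Bil_scale_left: "Bil m (\<lambda>k. c * f k) g k = c * Bil m f g k"
  unfolding Bil_def by (simp add: infsum_cmult_right'[symmetric] mult_ac)

lemma Bil_scale_right: "Bil m f (\<lambda>k. c * g k) k = c * Bil m f g k"
  unfolding Bil_def by (simp add: infsum_cmult_right'[symmetric] mult_ac)

lemma Bil_scale_sym: "Bil (\<lambda>k j. c k * m k j) f g k = c k * Bil m f g k"
  unfolding Bil_def by (simp add: infsum_cmult_right'[symmetric] mult_ac)

lemma Bil_commute: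
  assumes "\<And>k j. m k (k - j) = m k j"
  shows "Bil m f g = Bil m g f"
proof
  fix k
  have "bij_betw (\<lambda>j. k - j) UNIV (UNIV :: int set)"
    by (rule bij_betwI[of _ _ _ "\<lambda>j. k - j"]) auto
  from infsum_reindex_bij_betw[OF this, of "\<lambda>j. m k j * f j * g (k - j)"]
  show "Bil m f g k = Bil m g f k" by (simp add: Bil_def assms mult_ac)
qed

lemma bsum_cmult_left: "bsum m f g \<Longrightarrow> bsum m (\<lambda>k. c * f k) g"
  unfolding bsum_def using summable_on_cmult_right[of _ UNIV c] by (fastforce simp: mult_ac)

lemma bsum_cmult_right: "bsum m f g \<Longrightarrow> bsum m f (\<lambda>k. c * g k)"
  unfolding bsum_def using summable_on_cmult_right[of _ UNIV c] by (fastforce simp: mult_ac)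

lemma bsum_cmult_sym: "bsum m f g \<Longrightarrow> bsum (\<lambda>k j. c * m k j) f g"
  unfolding bsum_def using summable_on_cmult_right[of _ UNIV c] by (fastforce simp: mult_ac)

lemma bsum_add_left: "bsum m f g \<Longrightarrow> bsum m f' g \<Longrightarrow> bsum m (\<lambda>k. f k + f' k) g"
  unfolding bsum_def by (auto simp: algebra_simps intro: summable_on_add)

lemma bsum_add_right: "bsum m f g \<Longrightarrow> bsum m f g' \<Longrightarrow> bsum m f (\<lambda>k. g k + g' k)"
  unfolding bsum_def by (auto simp: algebra_simps intro: summable_on_add)

lemma bsum_add_sym: "bsum m f g \<Longrightarrow> bsum m' f g \<Longrightarrow> bsum (\<lambda>k j. m k j + m' k j) f g"
  unfolding bsum_def by (auto simp: algebra_simps intro: summable_on_add)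

lemma bsum_zero [simp]: "bsum m (\<lambda>k. 0) g" "bsum m f (\<lambda>k. 0)" "bsum (\<lambda>k j. 0) f g"
  by (auto simp: bsum_def)

lemma Bil_zero [simp]: "Bil m (\<lambda>k. 0) g = (\<lambda>k. 0)" "Bil m f (\<lambda>k. 0) = (\<lambda>k. 0)" "Bil (\<lambda>k j. 0) f g = (\<lambda>k. 0)"
  by (auto simp: Bil_def)

lemma bsum_sum_left: "finite S \<Longrightarrow> (\<And>s. s \<in> S \<Longrightarrow> bsum m (f s) g) \<Longrightarrow> bsum m (\<lambda>k. \<Sum>s\<in>S. c s * f s k) g"
  by (induction S rule: finite_induct) (simp_all add: bsum_add_left bsum_cmult_left)

lemma Bil_sum_left: "finite S \<Longrightarrow> (\<And>s. s \<in> S \<Longrightarrow> bsum m (f s) g) \<Longrightarrow>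
    Bil m (\<lambda>k. \<Sum>s\<in>S. c s * f s k) g k = (\<Sum>s\<in>S. c s * Bil m (f s) g k)"
  by (induction S rule: finite_induct)
     (simp_all add: bsum_sum_left bsum_cmult_left Bil_add_left Bil_scale_left)

lemma bsum_sum_right: "finite S \<Longrightarrow> (\<And>s. s \<in> S \<Longrightarrow> bsum m f (g s)) \<Longrightarrow> bsum m f (\<lambda>k. \<Sum>s\<in>S. c s * g s k)"
  by (induction S rule: finite_induct) (simp_all add: bsum_add_right bsum_cmult_right)

lemma Bil_sum_right: "finite S \<Longrightarrow> (\<And>s. s \<in> S \<Longrightarrow> bsum m f (g s)) \<Longrightarrow>
    Bil m f (\<lambda>k. \<Sum>s\<in>S. c s * g s k) k = (\<Sum>s\<in>S. c s * Bil m f (g s) k)"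
  by (induction S rule: finite_induct)
     (simp_all add: bsum_sum_right bsum_cmult_right Bil_add_right Bil_scale_right)

lemma bsum_sum_sym: "finite S \<Longrightarrow> (\<And>s. s \<in> S \<Longrightarrow> bsum (m s) f g) \<Longrightarrow> bsum (\<lambda>k j. \<Sum>s\<in>S. c s * m s k j) f g"
  by (induction S rule: finite_induct) (simp_all add: bsum_add_sym bsum_cmult_sym)

lemma Bil_sum_sym: "finite S \<Longrightarrow> (\<And>s. s \<in> S \<Longrightarrow> bsum (m s) f g) \<Longrightarrow>
    Bil (\<lambda>k j. \<Sum>s\<in>S. c s * m s k j) f g k = (\<Sum>s\<in>S. c s * Bil (m s) f g k)"
  by (induction S rule: finite_induct)
     (simp_all add: bsum_sum_sym bsum_cmult_sym Bil_add_sym Bil_scale_sym)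

section \<open>The symbols of the equation and their bounds, uniformly in
  \<open>\<epsilon>\<close>\<close>

locale gbbm =
  fixes P :: "complex poly" and lam :: nat and \<sigma> r :: real
  assumes degP: "degree P = lam" and lam: "1 \<le> lam"
    and ReP: "Re (poly P (\<i> * of_real x)) = 0"
    and \<sigma>: "0 \<le> \<sigma>" "\<sigma> \<le> 1" and r: "0 \<le> r"
begin

definition A :: "real \<Rightarrow> seq" where
  "A \<epsilon> k = poly P (\<i> * of_int k) / (1 + of_real \<epsilon> * (of_int k)\<^sup>2)"

definition E :: "real \<Rightarrow> seq" where
  "E \<epsilon> k = of_real \<epsilon> * (\<i> * of_int k / (1 + of_real \<epsilon> * (of_int k)\<^sup>2))"

text \<open>The resonance function. In the interaction picture the input modes \<open>j\<close> and
  \<open>k - j\<close> carry \<open>exp (- t * A)\<close> and the output mode \<open>k\<close>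
  carries \<open>exp (t * A)\<close>; the product of the three factors is
  \<open>exp (t * phase)\<close>.\<close>

definition phase :: "real \<Rightarrow> int \<Rightarrow> seq" where
  "phase \<epsilon> k j = A \<epsilon> k - A \<epsilon> j - A \<epsilon> (k - j)"

text \<open>\<open>zz 0\<close> is the regularity of the solution, and every power of the time step costs another
  \<open>lam\<close> derivatives.  From \<open>zz 4\<close> the multiplier \<open>E\<close> leads back to \<open>r\<close>, gaining \<open>\<epsilon>\<^sup>1\<^sup>-\<^sup>\<sigma>\<close>.\<close>

definition zz :: "nat \<Rightarrow> real" where
  "zz m = r + 1 - 2 * \<sigma> + (4 - real m) * real lam"

lemma denominator: "1 + of_real \<epsilon> * (of_int k)\<^sup>2 = complex_of_real (1 + \<epsilon> * (real_of_int k)\<^sup>2)"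
  by simp

lemma denominator_ge1: "0 < \<epsilon> \<Longrightarrow> 1 \<le> 1 + \<epsilon> * (real_of_int k)\<^sup>2"
  by simp

lemma abs_denominator: "0 < \<epsilon> \<Longrightarrow> \<bar>1 + \<epsilon> * (real_of_int k)\<^sup>2\<bar> = 1 + \<epsilon> * (real_of_int k)\<^sup>2"
  using denominator_ge1[of \<epsilon> k] by linarith

lemma Re_A [simp]: "Re (A \<epsilon> k) = 0"
  using ReP[of "of_int k"] unfolding A_def denominator by (simp add: Re_divide_of_real)

lemma Re_phase [simp]: "Re (phase \<epsilon> k j) = 0"
  by (simp add: phase_def)

lemma phase_commute: "phase \<epsilon> k (k - j) = phase \<epsilon> k j"
  by (simp add: phase_def)

lemma norm_exp_A [simp]: "cmod (exp (of_real t * A \<epsilon> k)) = 1"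
  by (simp add: norm_exp_eq_Re)

text \<open>The denominator is only used as a contraction, since its smoothing effect degenerates as
  \<open>\<epsilon>\<close> tends to 0.\<close>

lemma A_bound: "\<exists>C\<ge>0. \<forall>\<epsilon> k. 0 < \<epsilon> \<longrightarrow> cmod (A \<epsilon> k) \<le> C * jb k ^ lam"
proof (intro exI conjI allI impI)
  let ?C = "\<Sum>i\<le>lam. cmod (coeff P i)"
  show "0 \<le> ?C" by (rule sum_nonneg) auto
  fix \<epsilon> :: real and k :: int assume e: "0 < \<epsilon>"
  have "cmod (A \<epsilon> k) \<le> cmod (poly P (\<i> * of_int k))"
    unfolding A_def denominator norm_divide norm_of_real abs_denominator[OF e]
    using denominator_ge1[OF e, of k]
      mult_left_mono[OF denominator_ge1[OF e, of k], of "cmod (poly P (\<i> * of_int k))"]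
    by (simp add: divide_le_eq)
  also have "\<dots> \<le> (\<Sum>i\<le>lam. cmod (coeff P i * (\<i> * of_int k) ^ i))"
    unfolding poly_altdef degP by (rule norm_sum)
  also have "\<dots> \<le> (\<Sum>i\<le>lam. cmod (coeff P i) * jb k ^ lam)"
  proof (rule sum_mono)
    fix i assume "i \<in> {..lam}"
    have "\<bar>real_of_int k\<bar> ^ i \<le> jb k ^ i" by (intro power_mono) (auto simp: jb_def)
    also have "\<dots> \<le> jb k ^ lam" using \<open>i \<in> {..lam}\<close> by (intro power_increasing) (auto simp: jb_ge1)
    finally show "cmod (coeff P i * (\<i> * of_int k) ^ i) \<le> cmod (coeff P i) * jb k ^ lam"
      by (simp add: norm_mult norm_power mult_left_mono)
  qed
  also have "\<dots> = ?C * jb k ^ lam" by (rule sum_distrib_right[symmetric])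
  finally show "cmod (A \<epsilon> k) \<le> ?C * jb k ^ lam" .
qed

definition weight :: "nat \<Rightarrow> int \<Rightarrow> int \<Rightarrow> real" where
  "weight n k j = jb j powr (real n * real lam) + jb (k - j) powr (real n * real lam)"

text \<open>The output frequency is at most twice the larger input frequency, so the whole loss can
  be placed on the inputs, as \<open>weight_jb_loss\<close> requires.\<close>

lemma phase_bound:
  obtains Cp where "0 \<le> Cp" and "\<And>\<epsilon> k j n. 0 < \<epsilon> \<Longrightarrow>
    cmod (phase \<epsilon> k j) ^ n \<le> Cp ^ n * weight n k j"
proof -
  from A_bound obtain C where C: "C \<ge> 0" "\<And>\<epsilon> k. 0 < \<epsilon> \<Longrightarrow> cmod (A \<epsilon> k) \<le> C * jb k ^ lam" by blast
  \<comment> \<open>The output contributes \<open>(2 * m) ^ lam\<close>, each of the two inputs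
    \<open>m ^ lam\<close>.\<close>
  define D where "D = C * (2 ^ lam + 2)"
  have "cmod (phase \<epsilon> k j) ^ n \<le> D ^ n * weight n k j"
    if e: "0 < \<epsilon>" for \<epsilon> k j n
  proof -
    define m where "m = max (jb j) (jb (k - j))"
    have m: "m > 0" "jb j \<le> m" "jb (k - j) \<le> m" "jb k \<le> 2 * m"
      using jb_triangle[of k j] jb_pos[of j] by (auto simp: m_def max_def)
    have "cmod (phase \<epsilon> k j) \<le> cmod (A \<epsilon> k) + cmod (A \<epsilon> j) + cmod (A \<epsilon> (k - j))"
      unfolding phase_def by (intro order_trans[OF norm_triangle_ineq4] add_mono) auto
    also have "\<dots> \<le> C * jb k ^ lam + C * jb j ^ lam + C * jb (k - j) ^ lam"
      by (intro add_mono C e)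
    also have "\<dots> \<le> C * (2 * m) ^ lam + C * m ^ lam + C * m ^ lam"
      using m by (intro add_mono mult_left_mono power_mono C) auto
    also have "\<dots> = D * m ^ lam" by (simp add: D_def power_mult_distrib algebra_simps)
    finally have "cmod (phase \<epsilon> k j) ^ n \<le> (D * m ^ lam) ^ n" by (intro power_mono) auto
    also have "\<dots> = D ^ n * m powr (real n * real lam)"
      using m by (simp add: power_mult_distrib powr_powr[symmetric] powr_realpow power_mult[symmetric] mult.commute flip: of_nat_mult)
    also have "\<dots> \<le> D ^ n * weight n k j"
      using C by (intro mult_left_mono) (auto simp: m_def max_def D_def weight_def)
    finally show ?thesis .
  qed
  moreover have "0 \<le> D" using C by (simp add: D_def)
  ultimately show ?thesis using that by blast
qed

text \<open>Interpolation between the bounds \<open>\<epsilon> * \<bar>k\<bar>\<close> at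
  \<open>t = 0\<close> and \<open>1 / \<bar>k\<bar>\<close> at \<open>t = 1\<close>: the denominator
  dominates every power of \<open>\<epsilon> * k^2\<close> with exponent in \<open>{0..1}\<close>.
  The factor 2 pays for replacing \<open>\<bar>k\<bar>\<close> by \<open>jb k\<close> under a
  negative exponent. It will be used with \<open>t = \<sigma>\<close>.\<close>

lemma E_real_bound:
  assumes e: "0 < \<epsilon>" and t: "0 \<le> t" "t \<le> 1"
  shows "cmod (E \<epsilon> k) \<le> 2 * \<epsilon> powr (1 - t) * jb k powr (1 - 2 * t)"
proof (cases "k = 0")
  case False
  define x where "x = \<bar>real_of_int k\<bar>"
  have x: "1 \<le> x" using False by (simp add: x_def)
  have "(\<epsilon> * x\<^sup>2) powr t \<le> 1 + \<epsilon> * x\<^sup>2"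
  proof (cases "\<epsilon> * x\<^sup>2 \<le> 1")
    case True
    then have "(\<epsilon> * x\<^sup>2) powr t \<le> 1" using t e by (intro powr_le1) auto
    then show ?thesis using e by (simp add: add_increasing2)
  next
    case False
    then have "(\<epsilon> * x\<^sup>2) powr t \<le> (\<epsilon> * x\<^sup>2) powr 1" using t by (intro powr_mono) auto
    then show ?thesis using e by simp
  qed
  moreover have "0 < (\<epsilon> * x\<^sup>2) powr t" using e x by simp
  moreover have "cmod (E \<epsilon> k) = \<epsilon> * x / (1 + \<epsilon> * x\<^sup>2)"
    unfolding E_def denominator norm_mult norm_divide norm_of_real x_def abs_denominator[OF e] using e
    by simp
  ultimately have "cmod (E \<epsilon> k) \<le> \<epsilon> * x / (\<epsilon> * x\<^sup>2) powr t"
    using e x by (simp add: frac_le)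
  also have "\<dots> = \<epsilon> powr (1 - t) * x powr (1 - 2 * t)"
    using e x by (simp add: powr_mult powr_diff powr_powr[symmetric])
  also have "x powr (1 - 2 * t) \<le> 2 * jb k powr (1 - 2 * t)"
  proof (cases "0 \<le> 1 - 2 * t")
    case True
    then have "x powr (1 - 2 * t) \<le> jb k powr (1 - 2 * t)" by (intro powr_mono2) (auto simp: x_def jb_def)
    then show ?thesis using powr_ge_zero[of "jb k" "1 - 2 * t"] by linarith
  next
    case False
    have "x powr (1 - 2 * t) \<le> (jb k / 2) powr (1 - 2 * t)"
      using x False by (intro powr_mono2') (auto simp: x_def jb_def)
    also have "\<dots> = 2 powr (2 * t - 1) * jb k powr (1 - 2 * t)"
      using powr_minus_divide[of 2 "2 * t - 1"] by (simp add: powr_divide)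
    also have "\<dots> \<le> 2 powr 1 * jb k powr (1 - 2 * t)"
      using t by (intro mult_right_mono powr_mono) auto
    finally show ?thesis by simp
  qed
  finally show ?thesis using e by (simp add: mult_left_mono mult_ac)
qed (simp add: E_def)

lemma E_le1: assumes e: "0 < \<epsilon>" "\<epsilon> \<le> 1" shows "cmod (E \<epsilon> k) \<le> 1"
proof -
  define x where "x = \<bar>real_of_int k\<bar>"
  have "\<epsilon> * x \<le> 1 + \<epsilon> * x\<^sup>2"
  proof (cases "x \<le> 1")
    case True
    have "\<epsilon> * x \<le> 1 * 1" using e True by (intro mult_mono) (auto simp: x_def)
    then show ?thesis using e by (simp add: add_increasing2)
  next
    case False
    then have "\<epsilon> * x * 1 \<le> \<epsilon> * x * x" using e by (intro mult_left_mono) auto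
    then show ?thesis by (simp add: power2_eq_square)
  qed
  moreover have "cmod (E \<epsilon> k) = \<epsilon> * x / (1 + \<epsilon> * x\<^sup>2)"
    unfolding E_def denominator norm_mult norm_divide norm_of_real x_def abs_denominator[OF e(1)] using e
    by simp
  moreover have "0 < 1 + \<epsilon> * x\<^sup>2" using e by (intro add_pos_nonneg) auto
  ultimately show ?thesis by simp
qed

text \<open>On the imaginary axis the exponential is unimodular, so the bound holds for large
  \<open>z\<close> too. The case \<open>n = 0\<close> is the bound of the exponential
  itself.\<close>

lemma exp_phase_taylor:
  fixes z :: complex
  assumes "Re z = 0"
  shows "cmod (exp z - (\<Sum>l<n. z ^ l / fact l)) \<le> cmod z ^ n"
proof (cases n)
  case 0
  then show ?thesis using assms by (simp add: norm_exp_eq_Re)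
next
  case (Suc m)
  have "cmod (exp z - (\<Sum>l\<le>m. z ^ l / fact l)) \<le> exp \<bar>Re z\<bar> * cmod z ^ Suc m / fact m"
    by (rule Taylor_exp)
  also have "\<dots> \<le> cmod z ^ n"
    using assms Suc mult_left_mono[OF fact_ge_1[of m], of "cmod z ^ Suc m"] by (simp add: divide_le_eq)
  finally show ?thesis using Suc by (simp add: lessThan_Suc_atMost)
qed

definition CC :: "real \<Rightarrow> real \<Rightarrow> seq \<Rightarrow> seq \<Rightarrow> seq" where
  "CC \<epsilon> t = Bil (\<lambda>k j. exp (of_real t * phase \<epsilon> k j))"

text \<open>The \<open>n\<close>-th derivative of \<open>CC \<epsilon> t\<close> with respect to
  \<open>t\<close> at 0.\<close>

definition DD :: "nat \<Rightarrow> real \<Rightarrow> seq \<Rightarrow> seq \<Rightarrow> seq" where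
  "DD n \<epsilon> = Bil (\<lambda>k j. phase \<epsilon> k j ^ n)"

lemma zz_mono: "m \<le> n \<Longrightarrow> zz n \<le> zz m"
  unfolding zz_def by (intro add_left_mono mult_right_mono) auto

end

text \<open>Constants that are uniform in the data are handled by families: the index set \<open>I\<close> collects all
  admissible parameters and data, and an estimate quantifies its constant outside of \<open>I\<close>.\<close>

locale gbbm_family = gbbm +
  fixes I :: "'i set" and eps tau :: "'i \<Rightarrow> real"
  assumes eps: "\<And>i. i \<in> I \<Longrightarrow> 0 < eps i" "\<And>i. i \<in> I \<Longrightarrow> eps i \<le> 1"
    and tau: "\<And>i. i \<in> I \<Longrightarrow> 0 < tau i" "\<And>i. i \<in> I \<Longrightarrow> tau i \<le> 1"
begin

definition bigO :: "real \<Rightarrow> (real \<Rightarrow> real) \<Rightarrow> nat \<Rightarrow> ('i \<Rightarrow> seq) \<Rightarrow> bool" where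
  "bigO a h p F \<longleftrightarrow> (\<exists>C. \<forall>i\<in>I. hbd a (F i) (C * h (eps i) * tau i ^ p))"

abbreviation OZ :: "nat \<Rightarrow> nat \<Rightarrow> ('i \<Rightarrow> seq) \<Rightarrow> bool" where
  "OZ m \<equiv> bigO (zz m) (\<lambda>_. 1)"

abbreviation OR :: "nat \<Rightarrow> ('i \<Rightarrow> seq) \<Rightarrow> bool" where
  "OR \<equiv> bigO r (\<lambda>\<epsilon>. \<epsilon> powr (1 - \<sigma>))"

lemma OZ_iff: "OZ m p F \<longleftrightarrow> (\<exists>C. \<forall>i\<in>I. hbd (zz m) (F i) (C * tau i ^ p))"
  by (simp add: bigO_def)

lemma OZ_obtain:
  assumes "OZ m p F"
  obtains C where "0 \<le> C" "\<And>i. i \<in> I \<Longrightarrow> hbd (zz m) (F i) (C * tau i ^ p)"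
proof -
  from assms obtain C where C: "\<And>i. i \<in> I \<Longrightarrow> hbd (zz m) (F i) (C * tau i ^ p)" by (auto simp: OZ_iff)
  have "hbd (zz m) (F i) (\<bar>C\<bar> * tau i ^ p)" if "i \<in> I" for i
    using tau(1)[OF that] by (intro hbd_mono[OF C[OF that]] mult_right_mono) auto
  then show ?thesis using that[of "\<bar>C\<bar>"] by auto
qed

lemma OZ_weaken:
  assumes "OZ m p F" "m \<le> m'" "p' \<le> p" shows "OZ m' p' F"
proof -
  obtain C where C: "0 \<le> C" "\<And>i. i \<in> I \<Longrightarrow> hbd (zz m) (F i) (C * tau i ^ p)" by (rule OZ_obtain[OF assms(1)]) auto
  have "hbd (zz m') (F i) (C * tau i ^ p')" if i: "i \<in> I" for i
    by (rule hbd_weaken[OF hbd_mono[OF C(2)[OF i]]])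
       (use C tau[OF i] assms in \<open>auto intro!: mult_left_mono power_decreasing zz_mono\<close>)
  then show ?thesis by (auto simp: OZ_iff)
qed

lemma bigO_cong: "(\<And>i. i \<in> I \<Longrightarrow> F i = G i) \<Longrightarrow> bigO a h p F = bigO a h p G"
  by (simp add: bigO_def)

lemma bigO_zero [simp]: "bigO a h p (\<lambda>i k. 0)"
  unfolding bigO_def by (rule exI[of _ 0]) simp

lemma bigO_add: assumes "bigO a h p F" "bigO a h p G" shows "bigO a h p (\<lambda>i k. F i k + G i k)"
proof -
  from assms obtain C D where "\<And>i. i \<in> I \<Longrightarrow> hbd a (F i) (C * h (eps i) * tau i ^ p)"
    "\<And>i. i \<in> I \<Longrightarrow> hbd a (G i) (D * h (eps i) * tau i ^ p)" by (auto simp: bigO_def)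
  from hbd_add[OF this] show ?thesis
    unfolding bigO_def by (intro exI[of _ "C + D"]) (simp add: distrib_right)
qed

lemma bigO_scale: assumes "bigO a h p F" shows "bigO a h p (\<lambda>i k. c * F i k)"
proof -
  from assms obtain C where "\<And>i. i \<in> I \<Longrightarrow> hbd a (F i) (C * h (eps i) * tau i ^ p)" by (auto simp: bigO_def)
  from hbd_scale[OF this, of _ c] show ?thesis
    unfolding bigO_def by (intro exI[of _ "cmod c * C"]) (simp add: mult_ac)
qed

lemma bigO_diff: "bigO a h p F \<Longrightarrow> bigO a h p G \<Longrightarrow> bigO a h p (\<lambda>i k. F i k - G i k)"
  using bigO_add[of a h p F "\<lambda>i k. (-1) * G i k"] bigO_scale[of a h p G "-1"] by simp

lemma bigO_sum: "finite S \<Longrightarrow> (\<And>s. s \<in> S \<Longrightarrow> bigO a h p (F s)) \<Longrightarrow> bigO a h p (\<lambda>i k. \<Sum>s\<in>S. F s i k)"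
  by (induction S rule: finite_induct) (auto intro: bigO_add)

lemma bigO_tau: assumes "bigO a h p F" shows "bigO a h (n + p) (\<lambda>i k. of_real (tau i) ^ n * F i k)"
proof -
  from assms obtain C where C: "\<And>i. i \<in> I \<Longrightarrow> hbd a (F i) (C * h (eps i) * tau i ^ p)" by (auto simp: bigO_def)
  have "hbd a (\<lambda>k. of_real (tau i) ^ n * F i k) (C * h (eps i) * tau i ^ (n + p))" if i: "i \<in> I" for i
    using hbd_scale[OF C[OF i], of "of_real (tau i) ^ n"] tau(1)[OF i]
    by (simp add: norm_power power_add mult_ac)
  then show ?thesis unfolding bigO_def by blast
qed

lemma OZ_E: assumes "OZ m p F" shows "OZ m p (\<lambda>i k. E (eps i) k * F i k)"
proof -
  from assms obtain C where C: "\<And>i. i \<in> I \<Longrightarrow> hbd (zz m) (F i) (C * tau i ^ p)" by (auto simp: OZ_iff)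
  have "hbd (zz m) (\<lambda>k. E (eps i) k * F i k) (C * tau i ^ p)" if "i \<in> I" for i
    by (intro hbd_mult_le1 C E_le1 eps that)
  then show ?thesis unfolding OZ_iff by blast
qed

lemma OR_E: assumes "OZ 4 p F" shows "OR p (\<lambda>i k. E (eps i) k * F i k)"
proof -
  obtain C where C: "0 \<le> C" "\<And>i. i \<in> I \<Longrightarrow> hbd (zz 4) (F i) (C * tau i ^ p)" by (rule OZ_obtain[OF assms]) auto
  have "hbd r (\<lambda>k. E (eps i) k * F i k) (2 * C * eps i powr (1 - \<sigma>) * tau i ^ p)" if i: "i \<in> I" for i
  proof -
    have "hbd r (\<lambda>k. E (eps i) k * F i k) ((2 * eps i powr (1 - \<sigma>)) * (C * tau i ^ p))"
    proof (rule hbd_dom[OF C(2)[OF i]])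
      fix k
      have "jb k powr r * cmod (E (eps i) k * F i k) = jb k powr r * cmod (E (eps i) k) * cmod (F i k)"
        by (simp add: norm_mult)
      also have "\<dots> \<le> jb k powr r * (2 * eps i powr (1 - \<sigma>) * jb k powr (1 - 2 * \<sigma>)) * cmod (F i k)"
        by (intro mult_right_mono mult_left_mono E_real_bound \<sigma> eps i) auto
      also have "\<dots> = 2 * eps i powr (1 - \<sigma>) * (jb k powr zz 4 * cmod (F i k))"
        using powr_add[of "jb k" r "1 - 2 * \<sigma>"] by (simp add: zz_def add_diff_eq)
      finally show "jb k powr r * cmod (E (eps i) k * F i k) \<le> 2 * eps i powr (1 - \<sigma>) * (jb k powr zz 4 * cmod (F i k))" .
    qed simp
    then show ?thesis by (simp add: mult_ac)
  qed
  then show ?thesis unfolding bigO_def by blast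
qed

text \<open>The exponents of the inputs, reduced by the loss, exceed the output exponent by
  \<open>zz 0\<close> whatever \<open>a\<close>, \<open>b\<close> and \<open>n\<close> are. This is
  the margin that \<open>bil_bound\<close> asks for. The restriction to a sum of at most 4 secures
  the remaining margin, in which the output exponent is not subtracted.\<close>

lemma OZ_bil:
  assumes F: "OZ a p F" and G: "OZ b p' G" and n: "a + b + n \<le> 4"
    and m: "\<And>i k j. i \<in> I \<Longrightarrow> cmod (m i k j) \<le> C * tau i ^ l * weight n k j"
    and C: "0 \<le> C"
  shows "OZ (a + b + n) (l + p + p') (\<lambda>i. Bil (m i) (F i) (G i))"
    and "i \<in> I \<Longrightarrow> bsum (m i) (F i) (G i)"
proof -
  obtain A where A: "0 \<le> A" "\<And>i. i \<in> I \<Longrightarrow> hbd (zz a) (F i) (A * tau i ^ p)" by (rule OZ_obtain[OF F]) auto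
  obtain B where B: "0 \<le> B" "\<And>i. i \<in> I \<Longrightarrow> hbd (zz b) (G i) (B * tau i ^ p')" by (rule OZ_obtain[OF G]) auto
  have l1: "real lam \<ge> 1" using lam by simp
  have *: "x \<le> x * real lam" if "0 \<le> x" for x using mult_left_mono[OF l1 that] by simp
  have ab: "real a + real b + real n \<le> 4" using n by linarith
  have w: "zz (a + b + n) + real n * real lam \<le> zz a" "zz (a + b + n) + real n * real lam \<le> zz b"
    "0 \<le> real n * real lam" by (auto simp: zz_def algebra_simps)
  have "1 \<le> zz a + zz b - real n * real lam" "1 \<le> zz a + zz b - real n * real lam - zz (a + b + n)"
    using *[of "4 - real a - real b - real n"] *[of 4] ab r \<sigma> by (auto simp: zz_def algebra_simps)
  note w = w this
  note bb = bil_bound[OF A(2) B(2) m[unfolded weight_def] _ w]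
  { fix i assume i: "i \<in> I"
    have t: "0 \<le> C * tau i ^ l" using tau(1)[OF i] C by simp
    from bb(1)[OF i i i t] show "bsum (m i) (F i) (G i)" . }
  have "hbd (zz (a + b + n)) (Bil (m i) (F i) (G i)) ((bilc (zz (a + b + n)) * C * A * B) * tau i ^ (l + p + p'))"
    if i: "i \<in> I" for i
  proof -
    have t: "0 \<le> C * tau i ^ l" using tau(1)[OF i] C by simp
    from bb(2)[OF i i i t] show ?thesis by (simp add: power_add mult_ac)
  qed
  then show "OZ (a + b + n) (l + p + p') (\<lambda>i. Bil (m i) (F i) (G i))" unfolding OZ_iff by blast
qed

text \<open>For \<open>n = 0\<close> this is the full symbol, so that one estimate covers both
  \<open>CC\<close> and its Taylor remainders. Every power of the step size is paid for by one power
  of the phase.\<close>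

definition remsym :: "real \<Rightarrow> nat \<Rightarrow> 'i \<Rightarrow> int \<Rightarrow> seq" where
  "remsym \<theta> n i k j = exp (of_real (\<theta> * tau i) * phase (eps i) k j)
     - (\<Sum>l<n. of_real ((\<theta> * tau i) ^ l / fact l) * phase (eps i) k j ^ l)"

lemma OZ_rem:
  assumes F: "OZ a p F" and G: "OZ b p' G" and n: "a + b + n \<le> 4"
  shows "OZ (a + b + n) (n + p + p') (\<lambda>i. Bil (remsym \<theta> n i) (F i) (G i))"
    and "i \<in> I \<Longrightarrow> bsum (remsym \<theta> n i) (F i) (G i)"
proof -
  from phase_bound obtain Cp where Cp: "0 \<le> Cp" "\<And>\<epsilon> k j n. 0 < \<epsilon> \<Longrightarrow>
    cmod (phase \<epsilon> k j) ^ n \<le> Cp ^ n * weight n k j" by blast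
  have b: "cmod (remsym \<theta> n i k j) \<le> (\<bar>\<theta>\<bar> * Cp) ^ n * tau i ^ n * weight n k j"
    if i: "i \<in> I" for i k j
  proof -
    let ?z = "of_real (\<theta> * tau i) * phase (eps i) k j"
    have "cmod (remsym \<theta> n i k j) \<le> cmod ?z ^ n"
      using exp_phase_taylor[of ?z n] by (simp add: remsym_def power_mult_distrib field_simps)
    also have "\<dots> = (\<bar>\<theta>\<bar> * tau i) ^ n * cmod (phase (eps i) k j) ^ n"
      using tau(1)[OF i] by (simp add: norm_mult abs_mult power_mult_distrib)
    also have "\<dots> \<le> (\<bar>\<theta>\<bar> * tau i) ^ n * (Cp ^ n * weight n k j)"
      using tau(1)[OF i] by (intro mult_left_mono Cp eps i) auto
    finally show ?thesis by (simp add: power_mult_distrib mult_ac)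
  qed
  have C: "0 \<le> (\<bar>\<theta>\<bar> * Cp) ^ n" using Cp by simp
  show "OZ (a + b + n) (n + p + p') (\<lambda>i. Bil (remsym \<theta> n i) (F i) (G i))"
    and "i \<in> I \<Longrightarrow> bsum (remsym \<theta> n i) (F i) (G i)"
    using OZ_bil[OF F G n b C] by auto
qed

lemma OZ_DD:
  assumes F: "OZ a p F" and G: "OZ b p' G" and n: "a + b + n \<le> 4"
  shows "OZ (a + b + n) (p + p') (\<lambda>i. DD n (eps i) (F i) (G i))"
    and "i \<in> I \<Longrightarrow> bsum (\<lambda>k j. phase (eps i) k j ^ n) (F i) (G i)"
proof -
  from phase_bound obtain Cp where Cp: "0 \<le> Cp" "\<And>\<epsilon> k j n. 0 < \<epsilon> \<Longrightarrow>
    cmod (phase \<epsilon> k j) ^ n \<le> Cp ^ n * weight n k j" by blast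
  have b: "cmod (phase (eps i) k j ^ n) \<le> Cp ^ n * tau i ^ 0 * weight n k j"
    if i: "i \<in> I" for i k j using Cp(2)[OF eps(1)[OF i]] by (simp add: norm_power)
  have C: "0 \<le> Cp ^ n" using Cp by simp
  show "OZ (a + b + n) (p + p') (\<lambda>i. DD n (eps i) (F i) (G i))"
    and "i \<in> I \<Longrightarrow> bsum (\<lambda>k j. phase (eps i) k j ^ n) (F i) (G i)"
    using OZ_bil[OF F G n b C] by (auto simp: DD_def)
qed

lemma CC_remsym: "CC (eps i) (\<theta> * tau i) = Bil (remsym \<theta> 0 i)"
  by (simp add: CC_def remsym_def[abs_def])

end

subsection \<open>Expansions indexed by trees\<close>

text \<open>\<open>V\<close> stands for the initial value and \<open>N n s t\<close> for the \<open>n\<close>-th time derivative at \<open>0\<close> of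
  \<open>E C\<^sub>t\<close>, applied to \<open>s\<close> and \<open>t\<close>.\<close>

datatype tree = V | N nat tree tree

text \<open>The power of the step size that comes with the term: one for the factor in front of
  \<open>E\<close> at each node, and \<open>n\<close> more from the expansion of the symbol
  there.\<close>

primrec ord :: "tree \<Rightarrow> nat" where
  "ord V = 0"
| "ord (N n s t) = Suc (n + ord s + ord t)"

definition Tr :: "nat \<Rightarrow> tree set" where "Tr m = {t. ord t < m}"

lemma Tr_0 [simp]: "Tr 0 = {}" by (simp add: Tr_def)

lemma finite_Tr [simp]: "finite (Tr m)"
proof (induction m)
  case (Suc m)
  have "Tr (Suc m) \<subseteq> insert V ((\<lambda>(n, s, t). N n s t) ` ({..<m} \<times> Tr m \<times> Tr m))"
  proof
    fix t assume "t \<in> Tr (Suc m)"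
    then show "t \<in> insert V ((\<lambda>(n, s, t). N n s t) ` ({..<m} \<times> Tr m \<times> Tr m))"
      by (cases t) (auto simp: Tr_def image_iff)
  qed
  then show ?case by (rule finite_subset) (use Suc in auto)
qed simp

text \<open>A tree is cut at its root. The ranges are nested in the order in which a product is
  expanded: left factor, right factor, symbol.\<close>

lemma sum_Tr_Suc:
  fixes h :: "tree \<Rightarrow> 'b::comm_monoid_add"
  assumes "h V = 0"
  shows "(\<Sum>t\<in>Tr (Suc m). h t) = (\<Sum>s\<in>Tr m. \<Sum>u\<in>Tr (m - ord s). \<Sum>n<m - ord s - ord u. h (N n s u))"
proof -
  let ?S = "SIGMA s:Tr m. SIGMA u:Tr (m - ord s). {..<m - ord s - ord u}"
  have "(\<Sum>t\<in>Tr (Suc m). h t) = (\<Sum>t\<in>Tr (Suc m) - {V}. h t)"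
    using assms by (intro sum.mono_neutral_right) auto
  also have "\<dots> = (\<Sum>(s, u, n)\<in>?S. h (N n s u))"
    by (rule sum.reindex_bij_witness[where i="\<lambda>(s, u, n). N n s u" and
          j="\<lambda>t. case t of V \<Rightarrow> undefined | N n s u \<Rightarrow> (s, u, n)"])
       (auto simp: Tr_def split: tree.splits)
  also have "\<dots> = (\<Sum>s\<in>Tr m. \<Sum>u\<in>Tr (m - ord s). \<Sum>n<m - ord s - ord u. h (N n s u))"
    by (simp add: sum.Sigma split_def)
  finally show ?thesis .
qed

text \<open>The tree coefficients of \<open>Mop \<theta> F G\<close> if \<open>F\<close> and
  \<open>G\<close> have the coefficients \<open>\<alpha>\<close> and \<open>\<beta>\<close>. The
  factor \<open>\<theta> ^ n / fact n\<close> is the Taylor coefficient of the symbol frozen at time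
  \<open>\<theta> * tau\<close>, and \<open>V\<close> gets 0 because a product has order at least
  one.\<close>

primrec tree_mul :: "real \<Rightarrow> (tree \<Rightarrow> real) \<Rightarrow> (tree \<Rightarrow> real) \<Rightarrow> tree \<Rightarrow> real" where
  "tree_mul \<theta> \<alpha> \<beta> V = 0"
| "tree_mul \<theta> \<alpha> \<beta> (N n s t) = \<theta> ^ n / fact n * \<alpha> s * \<beta> t"

context gbbm_family begin

definition Mop :: "real \<Rightarrow> ('i \<Rightarrow> seq) \<Rightarrow> ('i \<Rightarrow> seq) \<Rightarrow> 'i \<Rightarrow> seq" where
  "Mop \<theta> F G i k = of_real (tau i) * (E (eps i) k * CC (eps i) (\<theta> * tau i) (F i) (G i) k)"

end

locale gbbm_expansion = gbbm_family +
  fixes v0 :: "'a \<Rightarrow> seq"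
  assumes v0: "OZ 0 0 v0"
begin

primrec elt :: "tree \<Rightarrow> 'a \<Rightarrow> seq" where
  "elt V = v0"
| "elt (N n s t) = (\<lambda>i k. E (eps i) k * DD n (eps i) (elt s i) (elt t i) k)"

text \<open>Only the powers of the phase cost derivatives. Charging \<open>lam\<close> for every
  node as well is wasteful, but it lets a single index measure both order and regularity.\<close>

lemma OZ_elt: "ord t \<le> 4 \<Longrightarrow> OZ (ord t) 0 (elt t)"
proof (induction t)
  case (N n s u)
  then have "OZ (ord s + ord u + n) (0 + 0) (\<lambda>i. DD n (eps i) (elt s i) (elt u i))"
    by (intro OZ_DD) auto
  from OZ_E[OF this] have "OZ (ord s + ord u + n) 0 (elt (N n s u))" by simp
  then show ?case by (rule OZ_weaken) auto
qed (use v0 in auto)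

definition rem :: "nat \<Rightarrow> (tree \<Rightarrow> real) \<Rightarrow> ('a \<Rightarrow> seq) \<Rightarrow> 'a \<Rightarrow> seq" where
  "rem m \<alpha> F i k = F i k - (\<Sum>t\<in>Tr m. of_real (\<alpha> t * tau i ^ ord t) * elt t i k)"

text \<open>All lower orders are included, because the remainder of a product at order
  \<open>m\<close> contains remainders of its factors of smaller order.\<close>

definition jet :: "nat \<Rightarrow> (tree \<Rightarrow> real) \<Rightarrow> ('a \<Rightarrow> seq) \<Rightarrow> bool" where
  "jet m \<alpha> F \<longleftrightarrow> (\<forall>m'\<le>m. OZ m' m' (rem m' \<alpha> F))"

text \<open>Order five is measured in another norm and gains a power of \<open>\<epsilon>\<close>.
  It is an end product: \<open>good_Mop\<close> builds on \<open>jet 4\<close> alone, so that stages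
  can be iterated.\<close>

definition good :: "(tree \<Rightarrow> real) \<Rightarrow> ('a \<Rightarrow> seq) \<Rightarrow> bool" where
  "good \<alpha> F \<longleftrightarrow> jet 4 \<alpha> F \<and> OR 5 (rem 5 \<alpha> F)"

definition prem :: "nat \<Rightarrow> real \<Rightarrow> (tree \<Rightarrow> real) \<Rightarrow> (tree \<Rightarrow> real) \<Rightarrow> ('a \<Rightarrow> seq) \<Rightarrow> ('a \<Rightarrow> seq) \<Rightarrow> 'a \<Rightarrow> seq" where
  "prem m \<theta> \<alpha> \<beta> F G i k = CC (eps i) (\<theta> * tau i) (F i) (G i) k -
     (\<Sum>s\<in>Tr m. \<Sum>u\<in>Tr (m - ord s). \<Sum>n<m - ord s - ord u.
        of_real (\<theta> ^ n / fact n * \<alpha> s * \<beta> u * tau i ^ (n + ord s + ord u)) * DD n (eps i) (elt s i) (elt u i) k)"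

lemma rem_0 [simp]: "rem 0 \<alpha> F = F"
  by (simp add: rem_def fun_eq_iff)

lemma rem_add: "rem m (\<lambda>t. \<alpha> t + \<beta> t) (\<lambda>i k. F i k + G i k) = (\<lambda>i k. rem m \<alpha> F i k + rem m \<beta> G i k)"
  by (simp add: rem_def fun_eq_iff sum.distrib algebra_simps)

lemma rem_scale: "rem m (\<lambda>t. c * \<alpha> t) (\<lambda>i k. of_real c * F i k) = (\<lambda>i k. of_real c * rem m \<alpha> F i k)"
  by (simp add: rem_def fun_eq_iff sum_distrib_left algebra_simps)

lemma good_add: "good \<alpha> F \<Longrightarrow> good \<beta> G \<Longrightarrow> good (\<lambda>t. \<alpha> t + \<beta> t) (\<lambda>i k. F i k + G i k)"
  by (simp add: good_def jet_def rem_add bigO_add)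

lemma good_scale: "good \<alpha> F \<Longrightarrow> good (\<lambda>t. c * \<alpha> t) (\<lambda>i k. of_real c * F i k)"
  by (simp add: good_def jet_def rem_scale bigO_scale)

lemma good_diff:
  assumes "good \<alpha> F" "good \<beta> G" shows "good (\<lambda>t. \<alpha> t - \<beta> t) (\<lambda>i k. F i k - G i k)"
  using good_add[OF assms(1) good_scale[OF assms(2), of "-1"]] by simp

lemma good_v0: "good (\<lambda>t. if t = V then 1 else 0) v0"
proof -
  have "rem (Suc m) (\<lambda>t. if t = V then 1 else 0) v0 = (\<lambda>i k. 0)" for m
  proof (intro ext)
    fix i k
    have "(\<Sum>t\<in>Tr (Suc m). of_real ((if t = V then 1 else 0) * tau i ^ ord t) * elt t i k)
       = (\<Sum>t\<in>{V}. of_real ((if t = V then 1 else 0) * tau i ^ ord t) * elt t i k)"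
      by (rule sum.mono_neutral_right[OF finite_Tr]) (auto simp: Tr_def)
    then show "rem (Suc m) (\<lambda>t. if t = V then 1 else 0) v0 i k = 0" by (simp add: rem_def)
  qed
  from this[of 4] this show ?thesis
    unfolding good_def jet_def by (metis bigO_zero rem_0 v0 eval_nat_numeral(3) not0_implies_Suc)
qed

text \<open>First \<open>F\<close> is expanded, then \<open>G\<close> next to each tree
  \<open>s\<close>, then the symbol next to each pair of trees. A tree of order \<open>ord s\<close>
  leaves only the order \<open>m - ord s\<close> to the other factors, so each of the three
  remainders \<open>R\<close>, \<open>Q\<close> and \<open>Z\<close> ends up with order and loss
  index equal to \<open>m\<close>.\<close>

lemma prem_OZ:
  assumes m: "m \<le> 4" and F: "jet m \<alpha> F" and G: "jet m \<beta> G"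
  shows "OZ m m (prem m \<theta> \<alpha> \<beta> F G)"
proof -
  have F0: "OZ 0 0 F" and G0: "OZ 0 0 G" using F G unfolding jet_def by (metis le0 rem_0)+
  have Fm: "OZ m m (rem m \<alpha> F)" using F by (simp add: jet_def)
  have Gm: "OZ (m - l) (m - l) (rem (m - l) \<beta> G)" for l using G by (simp add: jet_def)
  have el: "OZ (ord t) 0 (elt t)" if "t \<in> Tr (m - l)" for t l
    using that m by (intro OZ_elt) (auto simp: Tr_def)
  note el0 = el[of _ 0, simplified]
  define R where "R i = Bil (remsym \<theta> 0 i) (rem m \<alpha> F i) (G i)" for i
  define Q where "Q s i = Bil (remsym \<theta> 0 i) (elt s i) (rem (m - ord s) \<beta> G i)" for s i
  define Z where "Z s u i = Bil (remsym \<theta> (m - ord s - ord u) i) (elt s i) (elt u i)" for s u i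
  define SQ where "SQ i k = (\<Sum>s\<in>Tr m. of_real (\<alpha> s) * (of_real (tau i) ^ ord s * Q s i k))" for i k
  define SZ where "SZ i k = (\<Sum>s\<in>Tr m. \<Sum>u\<in>Tr (m - ord s). of_real (\<alpha> s * \<beta> u) * (of_real (tau i) ^ (ord s + ord u) * Z s u i k))" for i k
  have dec: "prem m \<theta> \<alpha> \<beta> F G i k = R i k + SQ i k + SZ i k"
    if i: "i \<in> I" for i k
  proof -
    have sF: "bsum (remsym \<theta> 0 i) (rem m \<alpha> F i) (G i)"
      using OZ_rem(2)[OF Fm G0 _ i] m by simp
    have sG: "bsum (remsym \<theta> 0 i) (elt s i) (G i)" if "s \<in> Tr m" for s
      using OZ_rem(2)[OF el0[OF that] G0 _ i] that m by (auto simp: Tr_def)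
    have sQ: "bsum (remsym \<theta> 0 i) (elt s i) (rem (m - ord s) \<beta> G i)" if "s \<in> Tr m" for s
      using OZ_rem(2)[OF el0[OF that] Gm[of "ord s"] _ i] that m by (auto simp: Tr_def)
    have sU: "bsum (remsym \<theta> n i) (elt s i) (elt u i)" if "s \<in> Tr m" "u \<in> Tr (m - ord s)" "n \<le> m - ord s - ord u" for s u n
      using OZ_rem(2)[OF el0[OF that(1)] el[OF that(2)] _ i] that m by (auto simp: Tr_def)
    have sD: "bsum (\<lambda>k j. phase (eps i) k j ^ n) (elt s i) (elt u i)" if "s \<in> Tr m" "u \<in> Tr (m - ord s)" "n < m - ord s - ord u" for s u n
      using OZ_DD(2)[OF el0[OF that(1)] el[OF that(2)] _ i] that m by (auto simp: Tr_def)
    have "F i = (\<lambda>k. rem m \<alpha> F i k + (\<Sum>s\<in>Tr m. of_real (\<alpha> s * tau i ^ ord s) * elt s i k))"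
      by (simp add: rem_def)
    then have "CC (eps i) (\<theta> * tau i) (F i) (G i) k =
      Bil (remsym \<theta> 0 i) (\<lambda>k. rem m \<alpha> F i k + (\<Sum>s\<in>Tr m. of_real (\<alpha> s * tau i ^ ord s) * elt s i k)) (G i) k"
      by (simp add: CC_remsym)
    also have "\<dots> = R i k + (\<Sum>s\<in>Tr m. of_real (\<alpha> s * tau i ^ ord s) * Bil (remsym \<theta> 0 i) (elt s i) (G i) k)"
      unfolding R_def using sF sG by (subst Bil_add_left) (auto simp: Bil_sum_left bsum_sum_left)
    also have "(\<Sum>s\<in>Tr m. of_real (\<alpha> s * tau i ^ ord s) * Bil (remsym \<theta> 0 i) (elt s i) (G i) k)
       = (\<Sum>s\<in>Tr m. of_real (\<alpha> s * tau i ^ ord s) * (Q s i k +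
           (\<Sum>u\<in>Tr (m - ord s). of_real (\<beta> u * tau i ^ ord u) * Bil (remsym \<theta> 0 i) (elt s i) (elt u i) k)))"
    proof (intro sum.cong refl)
      fix s assume s: "s \<in> Tr m"
      have "G i = (\<lambda>k. rem (m - ord s) \<beta> G i k + (\<Sum>u\<in>Tr (m - ord s). of_real (\<beta> u * tau i ^ ord u) * elt u i k))"
        by (simp add: rem_def)
      then have "Bil (remsym \<theta> 0 i) (elt s i) (G i) k = Bil (remsym \<theta> 0 i) (elt s i)
         (\<lambda>k. rem (m - ord s) \<beta> G i k + (\<Sum>u\<in>Tr (m - ord s). of_real (\<beta> u * tau i ^ ord u) * elt u i k)) k"
        by simp
      also have "\<dots> = Q s i k + (\<Sum>u\<in>Tr (m - ord s). of_real (\<beta> u * tau i ^ ord u) * Bil (remsym \<theta> 0 i) (elt s i) (elt u i) k)"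
        unfolding Q_def using sQ[OF s] sU[OF s] by (subst Bil_add_right) (auto simp: Bil_sum_right bsum_sum_right)
      finally show "of_real (\<alpha> s * tau i ^ ord s) * Bil (remsym \<theta> 0 i) (elt s i) (G i) k =
        of_real (\<alpha> s * tau i ^ ord s) * (Q s i k + (\<Sum>u\<in>Tr (m - ord s). of_real (\<beta> u * tau i ^ ord u) * Bil (remsym \<theta> 0 i) (elt s i) (elt u i) k))"
        by simp
    qed
    also have "\<dots> = (\<Sum>s\<in>Tr m. of_real (\<alpha> s * tau i ^ ord s) * (Q s i k +
           (\<Sum>u\<in>Tr (m - ord s). of_real (\<beta> u * tau i ^ ord u) * (Z s u i k +
              (\<Sum>n<m - ord s - ord u. of_real ((\<theta> * tau i) ^ n / fact n) * DD n (eps i) (elt s i) (elt u i) k)))))"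
    proof (intro sum.cong refl arg_cong2[where f="(*)"] arg_cong2[where f="(+)"])
      fix s u assume s: "s \<in> Tr m" and u: "u \<in> Tr (m - ord s)"
      let ?n = "m - ord s - ord u"
      have "remsym \<theta> 0 i = (\<lambda>k j. remsym \<theta> ?n i k j + (\<Sum>n<?n. of_real ((\<theta> * tau i) ^ n / fact n) * phase (eps i) k j ^ n))"
        by (simp add: remsym_def fun_eq_iff)
      then have "Bil (remsym \<theta> 0 i) (elt s i) (elt u i) k = Bil (\<lambda>k j. remsym \<theta> ?n i k j +
          (\<Sum>n<?n. of_real ((\<theta> * tau i) ^ n / fact n) * phase (eps i) k j ^ n)) (elt s i) (elt u i) k" by simp
      also have "\<dots> = Z s u i k + (\<Sum>n<?n. of_real ((\<theta> * tau i) ^ n / fact n) * DD n (eps i) (elt s i) (elt u i) k)"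
      proof -
        have "\<And>n. n \<in> {..<?n} \<Longrightarrow> bsum (\<lambda>k j. phase (eps i) k j ^ n) (elt s i) (elt u i)"
          using sD[OF s u] by simp
        note sm = Bil_sum_sym[OF finite_lessThan this] bsum_sum_sym[OF finite_lessThan this]
        show ?thesis
          unfolding Z_def DD_def by (simp only: Bil_add_sym[OF sU[OF s u order.refl] sm(2)] sm(1))
      qed
      finally show "Bil (remsym \<theta> 0 i) (elt s i) (elt u i) k = Z s u i k +
        (\<Sum>n<?n. of_real ((\<theta> * tau i) ^ n / fact n) * DD n (eps i) (elt s i) (elt u i) k)" .
    qed
    finally show ?thesis unfolding prem_def SQ_def SZ_def
      by (simp add: distrib_left sum.distrib sum_distrib_left power_add power_mult_distrib mult_ac)
  qed
  have "OZ m m R"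
    unfolding R_def using OZ_rem(1)[OF Fm G0, of 0 \<theta>] m by simp
  moreover have "OZ m m (\<lambda>i k. \<Sum>s\<in>Tr m. of_real (\<alpha> s) * (of_real (tau i) ^ ord s * Q s i k))"
  proof (intro bigO_sum bigO_scale finite_Tr)
    fix s assume s: "s \<in> Tr m"
    have "OZ (ord s + (m - ord s) + 0) (0 + 0 + (m - ord s)) (Q s)"
      unfolding Q_def by (rule OZ_rem(1)[OF el0[OF s] Gm]) (use s m in \<open>auto simp: Tr_def\<close>)
    from bigO_tau[OF this, of "ord s"] show "OZ m m (\<lambda>i k. of_real (tau i) ^ ord s * Q s i k)"
      using s by (simp add: Tr_def)
  qed
  moreover have "OZ m m (\<lambda>i k. \<Sum>s\<in>Tr m. \<Sum>u\<in>Tr (m - ord s). of_real (\<alpha> s * \<beta> u) * (of_real (tau i) ^ (ord s + ord u) * Z s u i k))"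
  proof (intro bigO_sum bigO_scale finite_Tr)
    fix s u assume s: "s \<in> Tr m" and u: "u \<in> Tr (m - ord s)"
    let ?n = "m - ord s - ord u"
    have "OZ (ord s + ord u + ?n) (?n + 0 + 0) (Z s u)"
      unfolding Z_def by (rule OZ_rem(1)[OF el0[OF s] el[OF u]]) (use s u m in \<open>auto simp: Tr_def\<close>)
    from bigO_tau[OF this, of "ord s + ord u"] show "OZ m m (\<lambda>i k. of_real (tau i) ^ (ord s + ord u) * Z s u i k)"
      using s u by (simp add: Tr_def)
  qed
  moreover have "OZ m m (prem m \<theta> \<alpha> \<beta> F G) = OZ m m (\<lambda>i k. R i k + SQ i k + SZ i k)"
    by (rule bigO_cong) (simp add: dec fun_eq_iff)
  ultimately show ?thesis
    unfolding SQ_def SZ_def by (simp only: bigO_add)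
qed

lemma jet_mono: "jet m \<alpha> F \<Longrightarrow> m' \<le> m \<Longrightarrow> jet m' \<alpha> F"
  by (simp add: jet_def)

text \<open>The factor \<open>tau * E\<close> in front raises the order by one at no cost in
  regularity. This is why order five is reached with the losses of order four.\<close>

lemma rem_Mop: "rem (Suc m) (tree_mul \<theta> \<alpha> \<beta>) (Mop \<theta> F G) i k = of_real (tau i) ^ 1 * (E (eps i) k * prem m \<theta> \<alpha> \<beta> F G i k)"
  unfolding rem_def Mop_def prem_def
  by (subst sum_Tr_Suc) (simp_all add: sum_distrib_left right_diff_distrib mult_ac)

lemma good_Mop:
  assumes F: "jet 4 \<alpha> F" and G: "jet 4 \<beta> G"
  shows "good (tree_mul \<theta> \<alpha> \<beta>) (Mop \<theta> F G)"
proof -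
  have p: "OZ m m (prem m \<theta> \<alpha> \<beta> F G)" if "m \<le> 4" for m
    using that F G by (intro prem_OZ) (auto intro: jet_mono)
  have "OZ m m (rem m (tree_mul \<theta> \<alpha> \<beta>) (Mop \<theta> F G))" if m: "m \<le> 4" for m
  proof (cases m)
    case 0
    have "OZ 0 (1 + 0) (\<lambda>i k. of_real (tau i) ^ 1 * (E (eps i) k * prem 0 \<theta> \<alpha> \<beta> F G i k))"
      by (intro bigO_tau OZ_E p) simp
    then show ?thesis using 0 OZ_weaken[of 0 1 _ 0 0]
      by (simp add: prem_def Mop_def[abs_def])
  next
    case (Suc l)
    have "OZ l (1 + l) (\<lambda>i k. of_real (tau i) ^ 1 * (E (eps i) k * prem l \<theta> \<alpha> \<beta> F G i k))"
      by (intro bigO_tau OZ_E p) (use Suc m in simp)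
    then have "OZ l (1 + l) (rem m (tree_mul \<theta> \<alpha> \<beta>) (Mop \<theta> F G))"
      unfolding Suc rem_Mop[abs_def] .
    then show ?thesis by (rule OZ_weaken) (use Suc in auto)
  qed
  \<comment> \<open>At order five the outer \<open>E\<close> is not spent on staying in
    \<open>zz 4\<close> but on returning to the \<open>r\<close> norm with the gain in
    \<open>\<epsilon>\<close>.\<close>
  moreover have "OR (1 + 4) (\<lambda>i k. of_real (tau i) ^ 1 * (E (eps i) k * prem 4 \<theta> \<alpha> \<beta> F G i k))"
    by (intro bigO_tau OR_E p) simp
  then have "OR 5 (rem 5 (tree_mul \<theta> \<alpha> \<beta>) (Mop \<theta> F G))"
    using rem_Mop[of 4 \<theta> \<alpha> \<beta> F G, abs_def] by simp
  ultimately show ?thesis by (simp add: good_def jet_def)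
qed

end

subsection \<open>The exact solution and a numerical stage\<close>

text \<open>Obtained by comparing powers of \<open>t\<close> in \<open>v' = - E C(v, v)\<close>: the
  expansion of the symbol contributes \<open>1 / fact n\<close>, and integration in time divides by
  the order of the tree.\<close>

primrec exact_coeff :: "tree \<Rightarrow> real" where
  "exact_coeff V = 1"
| "exact_coeff (N n s t) = - (exact_coeff s * exact_coeff t / (fact n * real (Suc (n + ord s + ord t))))"

lemma ord_eq_0 [simp]: "ord t = 0 \<longleftrightarrow> t = V"
  by (cases t) auto

lemma ord_pos [simp]: "0 < ord t \<longleftrightarrow> t \<noteq> V"
  by (cases t) auto

definition tree_mul_sym :: "real \<Rightarrow> (tree \<Rightarrow> real) \<Rightarrow> (tree \<Rightarrow> real) \<Rightarrow> tree \<Rightarrow> real" where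
  "tree_mul_sym \<theta> \<alpha> \<beta> t = (tree_mul \<theta> \<alpha> \<beta> t + tree_mul \<theta> \<beta> \<alpha> t) / 2"

lemma tree_mul_sym_simps:
  "tree_mul_sym \<theta> \<alpha> \<beta> V = 0"
  "tree_mul_sym \<theta> \<alpha> \<beta> (N n s t) = \<theta> ^ n / fact n * (\<alpha> s * \<beta> t + \<beta> s * \<alpha> t) / 2"
  by (simp_all add: tree_mul_sym_def field_simps)

definition stage_coeff :: "real \<Rightarrow> real \<Rightarrow> (tree \<Rightarrow> real) \<Rightarrow> tree \<Rightarrow> real" where
  "stage_coeff \<theta> c \<alpha> = (let p = tree_mul_sym \<theta> \<alpha> \<alpha>; q = tree_mul_sym \<theta> \<alpha> p; u = tree_mul_sym \<theta> p p; v = tree_mul_sym \<theta> \<alpha> q in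
     (\<lambda>t. \<alpha> t - c * p t + c ^ 2 * q t - (1/3) * c ^ 3 * u t - (2/3) * c ^ 3 * v t
        + (1/2) * c ^ 4 * tree_mul_sym \<theta> p q t + (1/6) * c ^ 4 * tree_mul_sym \<theta> \<alpha> u t + (1/3) * c ^ 4 * tree_mul_sym \<theta> \<alpha> v t))"

text \<open>The polynomial of \<open>Psi1\<close> for an arbitrary product \<open>M\<close>, so that
  the same formula serves for the scheme itself, for its interaction picture and for rescaled
  products.\<close>

definition taylor_flow :: "(seq \<Rightarrow> seq \<Rightarrow> seq) \<Rightarrow> complex \<Rightarrow> seq \<Rightarrow> seq" where
  "taylor_flow M h w = (let p = M w w; q = M w p; u = M p p; v = M w q in
     (\<lambda>k. w k - h * p k + h ^ 2 * q k - (1/3) * h ^ 3 * u k - (2/3) * h ^ 3 * v k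
        + (1/2) * h ^ 4 * M p q k + (1/6) * h ^ 4 * M w u k + (1/3) * h ^ 4 * M w v k))"

context gbbm begin

definition MM :: "real \<Rightarrow> real \<Rightarrow> real \<Rightarrow> seq \<Rightarrow> seq \<Rightarrow> seq" where
  "MM \<epsilon> \<tau> \<theta> f g k = of_real \<tau> * (E \<epsilon> k * CC \<epsilon> (\<theta> * \<tau>) f g k)"

end

context gbbm_family begin

definition Phi :: "real \<Rightarrow> real \<Rightarrow> ('i \<Rightarrow> seq) \<Rightarrow> 'i \<Rightarrow> seq" where
  "Phi \<theta> c F i = taylor_flow (MM (eps i) (tau i) \<theta>) (of_real c) (F i)"

end

context gbbm_expansion begin

lemma Mop_commute: "Mop \<theta> F G = Mop \<theta> G F"
  unfolding Mop_def CC_def by (intro ext) (simp add: Bil_commute[OF arg_cong[OF phase_commute]] phase_commute Bil_commute)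

text \<open>Every product is symmetrised, because the coefficients of the exact solution are symmetric
  while an ordered tree and its mirror image denote the same term.\<close>

lemma good_Ms:
  assumes F: "good \<alpha> F" and G: "good \<beta> G"
  shows "good (tree_mul_sym \<theta> \<alpha> \<beta>) (Mop \<theta> F G)"
proof -
  have "good (\<lambda>t. (1/2) * (tree_mul \<theta> \<alpha> \<beta> t + tree_mul \<theta> \<beta> \<alpha> t)) (\<lambda>i k. of_real (1/2) * (Mop \<theta> F G i k + Mop \<theta> G F i k))"
    by (intro good_scale good_add good_Mop) (use F G in \<open>auto simp: good_def\<close>)
  moreover have "(\<lambda>i k. of_real (1/2) * (Mop \<theta> F G i k + Mop \<theta> G F i k)) = Mop \<theta> F G"
    by (simp add: fun_eq_iff Mop_commute[of \<theta> G F])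
  moreover have "(\<lambda>t. (1/2) * (tree_mul \<theta> \<alpha> \<beta> t + tree_mul \<theta> \<beta> \<alpha> t)) = tree_mul_sym \<theta> \<alpha> \<beta>"
    by (simp add: fun_eq_iff tree_mul_sym_def)
  ultimately show ?thesis by simp
qed

lemma good_Phi:
  assumes "good \<alpha> F" shows "good (stage_coeff \<theta> c \<alpha>) (Phi \<theta> c F)"
proof -
  define p where "p = tree_mul_sym \<theta> \<alpha> \<alpha>" define p' where "p' = Mop \<theta> F F"
  define q where "q = tree_mul_sym \<theta> \<alpha> p" define q' where "q' = Mop \<theta> F p'"
  define u where "u = tree_mul_sym \<theta> p p" define u' where "u' = Mop \<theta> p' p'"
  define v where "v = tree_mul_sym \<theta> \<alpha> q" define v' where "v' = Mop \<theta> F q'"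
  have p: "good p p'" unfolding p_def p'_def by (intro good_Ms assms)
  have q: "good q q'" unfolding q_def q'_def by (intro good_Ms assms p)
  have u: "good u u'" unfolding u_def u'_def by (intro good_Ms p)
  have v: "good v v'" unfolding v_def v'_def by (intro good_Ms assms q)
  have "good (\<lambda>t. \<alpha> t - c * p t + c ^ 2 * q t - ((1/3) * c ^ 3) * u t - ((2/3) * c ^ 3) * v t
        + ((1/2) * c ^ 4) * tree_mul_sym \<theta> p q t + ((1/6) * c ^ 4) * tree_mul_sym \<theta> \<alpha> u t + ((1/3) * c ^ 4) * tree_mul_sym \<theta> \<alpha> v t)
     (\<lambda>i k. F i k - of_real c * p' i k + of_real (c ^ 2) * q' i k - of_real ((1/3) * c ^ 3) * u' i k - of_real ((2/3) * c ^ 3) * v' i k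
        + of_real ((1/2) * c ^ 4) * Mop \<theta> p' q' i k + of_real ((1/6) * c ^ 4) * Mop \<theta> F u' i k + of_real ((1/3) * c ^ 4) * Mop \<theta> F v' i k)"
    by (intro good_add good_diff good_scale good_Ms assms p q u v)
  moreover have "(\<lambda>i k. F i k - of_real c * p' i k + of_real (c ^ 2) * q' i k - of_real ((1/3) * c ^ 3) * u' i k - of_real ((2/3) * c ^ 3) * v' i k
        + of_real ((1/2) * c ^ 4) * Mop \<theta> p' q' i k + of_real ((1/6) * c ^ 4) * Mop \<theta> F u' i k + of_real ((1/3) * c ^ 4) * Mop \<theta> F v' i k)
     = Phi \<theta> c F"
    unfolding Phi_def[abs_def] taylor_flow_def Let_def p'_def q'_def u'_def v'_def
    by (simp add: Mop_def[abs_def] MM_def[abs_def] fun_eq_iff)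
  moreover have "(\<lambda>t. \<alpha> t - c * p t + c ^ 2 * q t - ((1/3) * c ^ 3) * u t - ((2/3) * c ^ 3) * v t
        + ((1/2) * c ^ 4) * tree_mul_sym \<theta> p q t + ((1/6) * c ^ 4) * tree_mul_sym \<theta> \<alpha> u t + ((1/3) * c ^ 4) * tree_mul_sym \<theta> \<alpha> v t) = stage_coeff \<theta> c \<alpha>"
    unfolding stage_coeff_def Let_def p_def q_def u_def v_def by simp
  ultimately show ?thesis by simp
qed

lemma elt_cong: "eps j = eps i \<Longrightarrow> v0 j = v0 i \<Longrightarrow> elt t j = elt t i"
  by (induction t) auto

text \<open>By \<open>closed\<close> the family contains each path also as observed at every earlier
  time. A bound in powers of \<open>tau\<close> for the family is thus a bound at all intermediate
  times, as needed for integrating the equation.\<close>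

context
  fixes v :: "'a \<Rightarrow> real \<Rightarrow> seq"
  assumes init: "\<And>i. i \<in> I \<Longrightarrow> v i 0 = v0 i"
    and deriv: "\<And>i s k. i \<in> I \<Longrightarrow> 0 \<le> s \<Longrightarrow> s \<le> tau i \<Longrightarrow>
      ((\<lambda>s. v i s k) has_vector_derivative - (E (eps i) k * CC (eps i) s (v i s) (v i s) k)) (at s within {0..tau i})"
    and closed: "\<And>i s. i \<in> I \<Longrightarrow> 0 < s \<Longrightarrow> s \<le> tau i \<Longrightarrow> \<exists>j\<in>I. eps j = eps i \<and> tau j = s \<and> v j = v i"
    and bounded: "OZ 0 0 (\<lambda>i. v i (tau i))"
begin

abbreviation (input) X :: "'a \<Rightarrow> seq" where "X \<equiv> \<lambda>i. v i (tau i)"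

text \<open>As a function of time the remainder vanishes at 0, and its derivative at
  \<open>s\<close> is \<open>- E * prem\<close> for the member of the family observed at
  \<open>s\<close>. There \<open>\<theta> = 1\<close>, because the symbol is taken at the full time
  \<open>s\<close>. The mean value theorem then yields one more power of the step size.\<close>

lemma exact_step:
  assumes b: "\<And>j. j \<in> I \<Longrightarrow> hbd a (\<lambda>k. E (eps j) k * prem m 1 exact_coeff exact_coeff X X j k) (C * h (eps j) * tau j ^ m)"
    and C: "0 \<le> C" "\<And>\<epsilon>. 0 \<le> h \<epsilon>" and i: "i \<in> I"
  shows "hbd a (rem (Suc m) exact_coeff X i) (C * h (eps i) * tau i ^ Suc m)"
proof -
  define g where "g s k = v i s k - (\<Sum>t\<in>Tr (Suc m). of_real (exact_coeff t * s ^ ord t) * elt t i k)" for s k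
  define g' where "g' s k = - (E (eps i) k * CC (eps i) s (v i s) (v i s) k)
     - (\<Sum>t\<in>Tr (Suc m). of_real (exact_coeff t * (real (ord t) * s ^ (ord t - 1))) * elt t i k)" for s k
  have "((\<lambda>s. g s k) has_vector_derivative g' s k) (at s within {0..tau i})" if "0 \<le> s" "s \<le> tau i" for s k
    unfolding g_def g'_def
  proof (intro has_vector_derivative_diff has_vector_derivative_sum has_vector_derivative_mult_left
      has_vector_derivative_of_real deriv i that)
    fix t :: tree
    show "((\<lambda>s. exact_coeff t * s ^ ord t) has_field_derivative exact_coeff t * (real (ord t) * s ^ (ord t - 1))) (at s within {0..tau i})"
      by (auto intro!: derivative_eq_intros)
  qed
  moreover have "hbd a (g' s) (C * h (eps i) * tau i ^ m)" if s: "0 < s" "s \<le> tau i" for s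
  proof -
    from closed[OF i s] obtain j where j: "j \<in> I" "eps j = eps i" "tau j = s" "v j = v i" by blast
    have el: "elt t j = elt t i" for t
      by (rule elt_cong) (use j init[OF i] init[OF j(1)] in auto)
    have eq: "g' s = (\<lambda>k. (-1) * (E (eps j) k * prem m 1 exact_coeff exact_coeff X X j k))"
    proof
      fix k
      have "(\<Sum>t\<in>Tr (Suc m). of_real (exact_coeff t * (real (ord t) * s ^ (ord t - 1))) * elt t i k)
        = (\<Sum>x\<in>Tr m. \<Sum>u\<in>Tr (m - ord x). \<Sum>n<m - ord x - ord u.
            of_real (exact_coeff (N n x u) * (real (Suc (n + ord x + ord u)) * s ^ (n + ord x + ord u))) * elt (N n x u) i k)"
        by (subst sum_Tr_Suc) auto
      also have "\<dots> = - (E (eps i) k * (\<Sum>x\<in>Tr m. \<Sum>u\<in>Tr (m - ord x). \<Sum>n<m - ord x - ord u.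
            of_real (1 / fact n * exact_coeff x * exact_coeff u * s ^ (n + ord x + ord u)) * DD n (eps i) (elt x i) (elt u i) k))"
        unfolding sum_distrib_left sum_negf[symmetric]
      proof (intro sum.cong refl)
        fix x u n
        \<comment> \<open>Differentiating the power of \<open>s\<close> brings down the order of the
          tree, which cancels the denominator in \<open>exact_coeff\<close>.\<close>
        have "exact_coeff (N n x u) * (real (Suc (n + ord x + ord u)) * s ^ (n + ord x + ord u)) = - (1 / fact n * exact_coeff x * exact_coeff u * s ^ (n + ord x + ord u))"
          by (simp add: field_simps del: of_nat_Suc)
        then show "complex_of_real (exact_coeff (N n x u) * (real (Suc (n + ord x + ord u)) * s ^ (n + ord x + ord u))) * elt (N n x u) i k
          = - (E (eps i) k * (of_real (1 / fact n * exact_coeff x * exact_coeff u * s ^ (n + ord x + ord u)) * DD n (eps i) (elt x i) (elt u i) k))"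
          by (simp only: of_real_minus elt.simps) simp
      qed
      finally show "g' s k = (-1) * (E (eps j) k * prem m 1 exact_coeff exact_coeff X X j k)"
        unfolding g'_def prem_def using j el by (simp add: right_diff_distrib)
    qed
    have "hbd a (g' s) (cmod (-1) * (C * h (eps j) * tau j ^ m))"
      unfolding eq by (rule hbd_scale[OF b[OF j(1)]])
    then have "hbd a (g' s) (C * h (eps i) * s ^ m)" using j by simp
    moreover have "C * h (eps i) * s ^ m \<le> C * h (eps i) * tau i ^ m"
      using s C by (intro mult_left_mono power_mono) auto
    ultimately show ?thesis by (rule hbd_mono)
  qed
  ultimately have "hbd a (\<lambda>k. g (tau i) k - g 0 k) (tau i * (C * h (eps i) * tau i ^ m))"
    by (intro hbd_mvt tau i) auto
  moreover have "g 0 k = 0" for k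
  proof -
    \<comment> \<open>Since \<open>0 ^ 0 = 1\<close>, only the tree \<open>V\<close> remains at time
      0.\<close>
    have "(\<Sum>t\<in>Tr (Suc m). of_real (exact_coeff t * 0 ^ ord t) * elt t i k) = (\<Sum>t\<in>{V}. of_real (exact_coeff t * 0 ^ ord t) * elt t i k)"
      by (rule sum.mono_neutral_right[OF finite_Tr]) (auto simp: Tr_def)
    then show ?thesis by (simp add: g_def init[OF i])
  qed
  moreover have "g (tau i) k = rem (Suc m) exact_coeff X i k" for k by (simp add: g_def rem_def)
  ultimately show ?thesis by (simp add: mult_ac)
qed

text \<open>Bootstrapping: the equation determines the solution only implicitly, so its expansion of
  order \<open>m\<close> is inserted into the right-hand side to obtain that of order
  \<open>m + 1\<close>, beginning with mere boundedness.\<close>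

lemma good_exact: "good exact_coeff X"
proof -
  have p: "OZ m m (\<lambda>j k. E (eps j) k * prem m 1 exact_coeff exact_coeff X X j k)" if "jet m exact_coeff X" "m \<le> 4" for m
    by (intro OZ_E prem_OZ that)
  have "jet m exact_coeff X" if "m \<le> 4" for m
    using that
  proof (induction m)
    case 0
    then show ?case using bounded by (simp add: jet_def)
  next
    case (Suc m)
    then have jm: "jet m exact_coeff X" by simp
    obtain C where C: "0 \<le> C" "\<And>j. j \<in> I \<Longrightarrow> hbd (zz m) (\<lambda>k. E (eps j) k * prem m 1 exact_coeff exact_coeff X X j k) (C * tau j ^ m)"
      by (rule OZ_obtain[OF p[OF jm]]) (use Suc in auto)
    have "hbd (zz m) (rem (Suc m) exact_coeff X i) (C * tau i ^ Suc m)" if "i \<in> I" for i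
      using exact_step[of "zz m" m C "\<lambda>_. 1", OF _ C(1) _ that] C(2) by simp
    then have "OZ m (Suc m) (rem (Suc m) exact_coeff X)" unfolding OZ_iff by blast
    then have "OZ (Suc m) (Suc m) (rem (Suc m) exact_coeff X)" by (rule OZ_weaken) auto
    then show ?case using jm by (auto simp: jet_def le_Suc_eq)
  qed
  then have j4: "jet 4 exact_coeff X" by simp
  have "OR 4 (\<lambda>j k. E (eps j) k * prem 4 1 exact_coeff exact_coeff X X j k)"
    by (intro OR_E prem_OZ j4) simp
  then obtain C where *: "\<And>j. j \<in> I \<Longrightarrow> hbd r (\<lambda>k. E (eps j) k * prem 4 1 exact_coeff exact_coeff X X j k) (C * eps j powr (1 - \<sigma>) * tau j ^ 4)"
    unfolding bigO_def by blast
  then have C: "hbd r (\<lambda>k. E (eps j) k * prem 4 1 exact_coeff exact_coeff X X j k) (\<bar>C\<bar> * eps j powr (1 - \<sigma>) * tau j ^ 4)" if "j \<in> I" for j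
    using tau(1)[OF that] by (intro hbd_mono[OF *[OF that]] mult_right_mono) auto
  have "hbd r (rem (Suc 4) exact_coeff X i) (\<bar>C\<bar> * eps i powr (1 - \<sigma>) * tau i ^ Suc 4)" if "i \<in> I" for i
    by (rule exact_step[OF C]) (use that in auto)
  then have "OR (Suc 4) (rem (Suc 4) exact_coeff X)" unfolding bigO_def by blast
  then show ?thesis using j4 by (simp add: good_def)
qed

end

end

subsection \<open>Order conditions\<close>

lemma tree_mul_sym_num:
  "tree_mul_sym \<theta> \<alpha> \<beta> V = 0"
  "tree_mul_sym \<theta> \<alpha> \<beta> (N 0 s t) = (\<alpha> s * \<beta> t + \<beta> s * \<alpha> t) / 2"
  "tree_mul_sym \<theta> \<alpha> \<beta> (N (Suc 0) s t) = \<theta> * (\<alpha> s * \<beta> t + \<beta> s * \<alpha> t) / 2"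
  "tree_mul_sym \<theta> \<alpha> \<beta> (N 2 s t) = \<theta> ^ 2 * (\<alpha> s * \<beta> t + \<beta> s * \<alpha> t) / 4"
  "tree_mul_sym \<theta> \<alpha> \<beta> (N 3 s t) = \<theta> ^ 3 * (\<alpha> s * \<beta> t + \<beta> s * \<alpha> t) / 12"
  by (simp_all add: tree_mul_sym_simps fact_numeral)

text \<open>For trees of order at most four, comparing the orders of the subtrees suffices for a normal form
  with respect to swapping subtrees.\<close>

primrec normal_form :: "tree \<Rightarrow> tree" where
  "normal_form V = V"
| "normal_form (N n s t) = (if ord s \<le> ord t then N n (normal_form s) (normal_form t) else N n (normal_form t) (normal_form s))"

definition tree_sym :: "(tree \<Rightarrow> real) \<Rightarrow> bool" where "tree_sym \<alpha> \<longleftrightarrow> (\<forall>t. \<alpha> (normal_form t) = \<alpha> t)"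

lemma ord_normal_form [simp]: "ord (normal_form t) = ord t"
  by (induction t) auto

lemma tree_sym_mul: "tree_sym \<alpha> \<Longrightarrow> tree_sym \<beta> \<Longrightarrow> tree_sym (tree_mul_sym \<theta> \<alpha> \<beta>)"
  unfolding tree_sym_def
proof
  fix t assume "\<forall>t. \<alpha> (normal_form t) = \<alpha> t" "\<forall>t. \<beta> (normal_form t) = \<beta> t"
  then show "tree_mul_sym \<theta> \<alpha> \<beta> (normal_form t) = tree_mul_sym \<theta> \<alpha> \<beta> t"
    by (cases t) (simp_all add: tree_mul_sym_simps algebra_simps)
qed

lemma tree_sym_stage:
  assumes a: "tree_sym \<alpha>" shows "tree_sym (stage_coeff \<theta> c \<alpha>)"
proof -
  have p: "tree_sym (tree_mul_sym \<theta> \<alpha> \<alpha>)" by (intro tree_sym_mul a)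
  have q: "tree_sym (tree_mul_sym \<theta> \<alpha> (tree_mul_sym \<theta> \<alpha> \<alpha>))" by (intro tree_sym_mul a p)
  have "tree_sym (tree_mul_sym \<theta> (tree_mul_sym \<theta> \<alpha> \<alpha>) (tree_mul_sym \<theta> \<alpha> \<alpha>))" "tree_sym (tree_mul_sym \<theta> \<alpha> (tree_mul_sym \<theta> \<alpha> (tree_mul_sym \<theta> \<alpha> \<alpha>)))"
    "tree_sym (tree_mul_sym \<theta> (tree_mul_sym \<theta> \<alpha> \<alpha>) (tree_mul_sym \<theta> \<alpha> (tree_mul_sym \<theta> \<alpha> \<alpha>)))"
    "tree_sym (tree_mul_sym \<theta> \<alpha> (tree_mul_sym \<theta> (tree_mul_sym \<theta> \<alpha> \<alpha>) (tree_mul_sym \<theta> \<alpha> \<alpha>)))"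
    "tree_sym (tree_mul_sym \<theta> \<alpha> (tree_mul_sym \<theta> \<alpha> (tree_mul_sym \<theta> \<alpha> (tree_mul_sym \<theta> \<alpha> \<alpha>))))"
    by (intro tree_sym_mul a p q)+
  with a p q show ?thesis unfolding stage_coeff_def Let_def tree_sym_def by simp
qed

lemma tree_sym_delta: "tree_sym (\<lambda>t. if t = V then 1 else 0)"
  unfolding tree_sym_def
proof
  fix t show "(if normal_form t = V then 1 else (0::real)) = (if t = V then 1 else 0)" by (cases t) auto
qed

lemma tree_sym_exact: "tree_sym exact_coeff"
proof -
  have "exact_coeff (normal_form t) = exact_coeff t" for t by (induction t) (auto simp: add_ac)
  then show ?thesis by (simp add: tree_sym_def)
qed

text \<open>The normal forms by increasing order: 1, 1, 2, 5 and 12 trees of the orders 0 to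
  4.\<close>

definition normal_trees :: "tree list" where
  "normal_trees = [V,
    N 0 V V,
    N 0 V (N 0 V V),
    N (Suc 0) V V,
    N 0 V (N 0 V (N 0 V V)),
    N 0 V (N (Suc 0) V V),
    N 0 (N 0 V V) (N 0 V V),
    N (Suc 0) V (N 0 V V),
    N 2 V V,
    N 0 V (N 0 V (N 0 V (N 0 V V))),
    N 0 V (N 0 V (N (Suc 0) V V)),
    N 0 V (N 0 (N 0 V V) (N 0 V V)),
    N 0 V (N (Suc 0) V (N 0 V V)),
    N 0 V (N 2 V V),
    N 0 (N 0 V V) (N 0 V (N 0 V V)),
    N 0 (N 0 V V) (N (Suc 0) V V),
    N (Suc 0) V (N 0 V (N 0 V V)),
    N (Suc 0) V (N (Suc 0) V V),
    N (Suc 0) (N 0 V V) (N 0 V V),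
    N 2 V (N 0 V V),
    N 3 V V]"

lemma normal_form_1: "ord t = Suc 0 \<Longrightarrow> normal_form t \<in> {N 0 V V}"
proof (cases t)
  case (N n s u)
  assume "ord t = Suc 0"
  then have "(n, ord s, ord u) \<in> {(0, 0, 0)}"
    unfolding N ord.simps insert_iff prod.inject empty_iff by presburger
  then show ?thesis unfolding N insert_iff prod.inject empty_iff
    by (elim disjE conjE FalseE) (auto)
qed simp

lemma normal_form_2: "ord t = 2 \<Longrightarrow> normal_form t \<in> {N 0 V (N 0 V V), N (Suc 0) V V}"
proof (cases t)
  case (N n s u)
  assume "ord t = 2"
  then have "(n, ord s, ord u) \<in> {(0, 0, 1), (0, 1, 0), (1, 0, 0)}"
    unfolding N ord.simps insert_iff prod.inject empty_iff by presburger
  then show ?thesis unfolding N insert_iff prod.inject empty_iff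
    by (elim disjE conjE FalseE) (auto dest!: normal_form_1)
qed simp

lemma normal_form_3: "ord t = 3 \<Longrightarrow> normal_form t \<in> {N 0 V (N 0 V (N 0 V V)), N 0 V (N (Suc 0) V V), N 0 (N 0 V V) (N 0 V V), N (Suc 0) V (N 0 V V), N 2 V V}"
proof (cases t)
  case (N n s u)
  assume "ord t = 3"
  then have "(n, ord s, ord u) \<in> {(0, 0, 2), (0, 1, 1), (0, 2, 0), (1, 0, 1), (1, 1, 0), (2, 0, 0)}"
    unfolding N ord.simps insert_iff prod.inject empty_iff by presburger
  then show ?thesis unfolding N insert_iff prod.inject empty_iff
    by (elim disjE conjE FalseE) (auto dest!: normal_form_1 dest!: normal_form_2)
qed simp

lemma normal_form_4: "ord t = 4 \<Longrightarrow> normal_form t \<in> {N 0 V (N 0 V (N 0 V (N 0 V V))), N 0 V (N 0 V (N (Suc 0) V V)), N 0 V (N 0 (N 0 V V) (N 0 V V)), N 0 V (N (Suc 0) V (N 0 V V)), N 0 V (N 2 V V), N 0 (N 0 V V) (N 0 V (N 0 V V)), N 0 (N 0 V V) (N (Suc 0) V V), N (Suc 0) V (N 0 V (N 0 V V)), N (Suc 0) V (N (Suc 0) V V), N (Suc 0) (N 0 V V) (N 0 V V), N 2 V (N 0 V V), N 3 V V}"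
proof (cases t)
  case (N n s u)
  assume "ord t = 4"
  then have "(n, ord s, ord u) \<in> {(0, 0, 3), (0, 1, 2), (0, 2, 1), (0, 3, 0), (1, 0, 2), (1, 1, 1), (1, 2, 0), (2, 0, 1), (2, 1, 0), (3, 0, 0)}"
    unfolding N ord.simps insert_iff prod.inject empty_iff by presburger
  then show ?thesis unfolding N insert_iff prod.inject empty_iff
    by (elim disjE conjE FalseE) (auto dest!: normal_form_1 dest!: normal_form_2 dest!: normal_form_3)
qed simp

text \<open>The step size fractions are polynomials in \<open>z = \<sigma>1\<close>, a root of \<open>6 z\<^sup>3 - 12 z\<^sup>2 + 6 z - 1\<close>, so that the
  coefficients after each stage can be reduced to quadratic polynomials in \<open>z\<close>.\<close>

definition table :: "(tree \<Rightarrow> real) \<Rightarrow> real list \<Rightarrow> bool" where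
  "table \<alpha> vs \<longleftrightarrow> map \<alpha> normal_trees = vs"

lemma table_0: "table (\<lambda>t. if t = V then 1 else 0) [1, 0, 0, 0, 0, 0, 0, 0, 0, 0, 0, 0, 0, 0, 0, 0, 0, 0, 0, 0, 0]"
  by (simp add: table_def normal_trees_def)

definition values_1 :: "real \<Rightarrow> real list" where
  "values_1 z = [1, - z, (z ^ 2) / 2, - (z ^ 2) / 2, (- 12 * z ^ 2 + 6 * z - 1) / 36, (12 * z ^ 2 - 6 * z + 1) / 24, (- 12 * z ^ 2 + 6 * z - 1) / 18, (12 * z ^ 2 - 6 * z + 1) / 24, (- 12 * z ^ 2 + 6 * z - 1) / 48, (18 * z ^ 2 - 11 * z + 2) / 144, (- 18 * z ^ 2 + 11 * z - 2) / 72, (18 * z ^ 2 - 11 * z + 2) / 72, (- 18 * z ^ 2 + 11 * z - 2) / 72, (18 * z ^ 2 - 11 * z + 2) / 96, (18 * z ^ 2 - 11 * z + 2) / 48, (- 18 * z ^ 2 + 11 * z - 2) / 36, (- 18 * z ^ 2 + 11 * z - 2) / 72, (18 * z ^ 2 - 11 * z + 2) / 48, (- 18 * z ^ 2 + 11 * z - 2) / 36, (18 * z ^ 2 - 11 * z + 2) / 96, (- 18 * z ^ 2 + 11 * z - 2) / 288]"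

definition values_2 :: "real \<Rightarrow> real list" where
  "values_2 z = [1, z - 1, (z ^ 2 - 2 * z + 1) / 2, (- (z ^ 2) + 2 * z - 1) / 2, (- 6 * z ^ 2 + 12 * z - 5) / 36, (- 2 * z + 1) / 8, (- 6 * z ^ 2 + 12 * z - 5) / 18, (12 * z ^ 2 - 18 * z + 7) / 24, (- 12 * z ^ 2 + 18 * z - 7) / 48, (6 * z ^ 2 - 11 * z + 4) / 144, (- 12 * z ^ 2 + 11 * z - 3) / 72, (6 * z ^ 2 - 11 * z + 4) / 72, (6 * z ^ 2 + 5 * z - 3) / 72, (- 6 * z ^ 2 - 3 * z + 2) / 96, (6 * z ^ 2 - 11 * z + 4) / 48, (- 3 * z ^ 2 + 8 * z - 3) / 36, (- 12 * z ^ 2 + 17 * z - 6) / 72, (6 * z ^ 2 - 11 * z + 4) / 48, (- 12 * z ^ 2 + 17 * z - 6) / 36, (18 * z ^ 2 - 23 * z + 8) / 96, (- 18 * z ^ 2 + 23 * z - 8) / 288]"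

text \<open>No \<open>z\<close> is left: these are the coefficients of the exact solution, as
  \<open>table_exact\<close> confirms.\<close>

definition values_3 :: "real list" where
  "values_3 = [1, - (1), (1) / 2, (- (1)) / 2, (- (1)) / 6, (1) / 6, (- (1)) / 3, (1) / 3, (- (1)) / 6, (1) / 24, (- (1)) / 24, (1) / 12, (- (1)) / 12, (1) / 24, (1) / 8, (- (1)) / 8, (- (1)) / 8, (1) / 8, (- (1)) / 4, (1) / 8, (- (1)) / 24]"

context
  fixes z :: real
  assumes z: "6 * z ^ 3 - 12 * z ^ 2 + 6 * z - 1 = 0"
begin

text \<open>The second equation carries a further factor \<open>w\<close>, so that the reduction
  also applies inside longer products nested to the right.\<close>

lemma reduce_cubic: "z * (z * z) = 2 * (z * z) - z + 1 / 6" "z * (z * (z * w)) = (2 * (z * z) - z + 1 / 6) * w"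
proof -
  show "z * (z * z) = 2 * (z * z) - z + 1 / 6" using z by (simp add: power2_eq_square power3_eq_cube algebra_simps)
  then show "z * (z * (z * w)) = (2 * (z * z) - z + 1 / 6) * w" by (metis mult.assoc)
qed

lemmas stage_simps = reduce_cubic algebra_simps add_divide_distrib diff_divide_distrib
  power2_eq_square power3_eq_cube power4_eq_xxxx
lemmas stage_defs = table_def normal_trees_def list.map list.inject stage_coeff_def Let_def tree_mul_sym_num

lemma table_1:
  assumes a: "table \<alpha> [1, 0, 0, 0, 0, 0, 0, 0, 0, 0, 0, 0, 0, 0, 0, 0, 0, 0, 0, 0, 0]"
  shows "table (stage_coeff (z / 2) z \<alpha>) (values_1 z)"
  unfolding stage_defs values_1_def
  by (intro conjI refl; simp add: a[unfolded stage_defs] stage_simps)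

lemma table_2:
  assumes a: "table \<alpha> (values_1 z)"
  shows "table (stage_coeff (1 / 2) (1 - 2 * z) \<alpha>) (values_2 z)"
  unfolding stage_defs values_1_def values_2_def
  by (intro conjI refl; simp add: a[unfolded stage_defs values_1_def] stage_simps)

lemma table_3:
  assumes a: "table \<alpha> (values_2 z)"
  shows "table (stage_coeff (1 - z / 2) z \<alpha>) values_3"
  unfolding stage_defs values_2_def values_3_def
  by (intro conjI refl; simp add: a[unfolded stage_defs values_2_def] stage_simps)

end

lemma table_exact: "table exact_coeff values_3"
  by (simp add: table_def normal_trees_def values_3_def fact_numeral)

lemma order_conditions:
  assumes z: "6 * z ^ 3 - 12 * z ^ 2 + 6 * z - 1 = (0::real)" and t: "ord t \<le> 4"
  shows "stage_coeff (1 - z / 2) z (stage_coeff (1 / 2) (1 - 2 * z) (stage_coeff (z / 2) z (\<lambda>t. if t = V then 1 else 0))) t = exact_coeff t"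
    (is "?\<alpha> t = _")
proof -
  from t have "ord t = 0 \<or> ord t = 1 \<or> ord t = 2 \<or> ord t = 3 \<or> ord t = 4" by linarith
  then have c: "normal_form t \<in> set normal_trees"
    unfolding normal_trees_def by (elim disjE) (auto dest!: normal_form_1 normal_form_2 normal_form_3 normal_form_4)
  have "map ?\<alpha> normal_trees = map exact_coeff normal_trees"
    using table_3[OF z table_2[OF z table_1[OF z table_0]]] table_exact unfolding table_def by simp
  with c have "?\<alpha> (normal_form t) = exact_coeff (normal_form t)" by (simp add: map_eq_conv)
  moreover have "tree_sym ?\<alpha>" by (intro tree_sym_stage tree_sym_delta)
  ultimately show ?thesis using tree_sym_exact by (simp add: tree_sym_def)
qed

text \<open>Index types for \<open>local_error\<close> (\<open>\<epsilon>\<close>, path, step size)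
  and for \<open>stability\<close> (\<open>\<epsilon>\<close>, step size, two data, bound for their
  difference).\<close>

type_synonym path_index = "real \<times> (real \<Rightarrow> seq) \<times> real"

type_synonym stability_index = "real \<times> real \<times> seq \<times> seq \<times> real"

subsection \<open>Local error, stability, convergence\<close>

text \<open>With \<open>x = root 3 2\<close> and \<open>y = 2 - x\<close>, multiplication of the
  cubic by \<open>y ^ 3\<close> turns it into \<open>x ^ 3 - 2\<close>.\<close>

lemma sigma_cubic: "6 * \<sigma>1 ^ 3 - 12 * \<sigma>1 ^ 2 + 6 * \<sigma>1 - 1 = 0" and sigma2_eq: "\<sigma>2 = 1 - 2 * \<sigma>1"
proof -
  define x where "x = root 3 2"
  have x3: "x ^ 3 = 2" by (simp add: x_def)
  have "x < 2"
  proof (rule ccontr)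
    assume "\<not> x < 2"
    then have "2 ^ 3 \<le> x ^ 3" by (intro power_mono) auto
    then show False using x3 by simp
  qed
  then have d: "2 - x \<noteq> 0" by simp
  have s: "\<sigma>1 = 1 / (2 - x)" by (simp add: \<sigma>1_def x_def)
  define y where "y = 2 - x"
  have y: "y \<noteq> 0" "\<sigma>1 * y = 1" using d by (simp_all add: s y_def)
  have "y ^ 3 * (6 * \<sigma>1 ^ 3 - 12 * \<sigma>1 ^ 2 + 6 * \<sigma>1 - 1)
      = 6 * (\<sigma>1 * y) ^ 3 - 12 * (\<sigma>1 * y) ^ 2 * y + 6 * (\<sigma>1 * y) * y ^ 2 - y ^ 3"
    by (simp add: power2_eq_square power3_eq_cube algebra_simps)
  also have "\<dots> = 6 - 12 * y + 6 * y ^ 2 - y ^ 3" by (simp add: y)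
  also have "\<dots> = x ^ 3 - 2" by (simp add: y_def power2_eq_square power3_eq_cube algebra_simps)
  finally show "6 * \<sigma>1 ^ 3 - 12 * \<sigma>1 ^ 2 + 6 * \<sigma>1 - 1 = 0" using y x3 by simp
  show "\<sigma>2 = 1 - 2 * \<sigma>1" using d by (simp add: \<sigma>2_def \<sigma>1_def x_def[symmetric] field_simps)
qed

context gbbm begin

text \<open>One step of the scheme in the interaction picture; the first arguments are the partial sums of
  \<open>d1\<close>, \<open>d2\<close>, \<open>d3\<close>, and \<open>c1 = 0\<close> makes the first nonlinear flow trivial.\<close>

definition split_step :: "real \<Rightarrow> real \<Rightarrow> seq \<Rightarrow> seq" where
  "split_step \<epsilon> \<tau> f = taylor_flow (MM \<epsilon> \<tau> (1 - \<sigma>1 / 2)) (of_real \<sigma>1) (taylor_flow (MM \<epsilon> \<tau> (1 / 2)) (of_real (1 - 2 * \<sigma>1))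
     (taylor_flow (MM \<epsilon> \<tau> (\<sigma>1 / 2)) (of_real \<sigma>1) f))"

end

lemma (in gbbm_family) Phi_split_step:
  "Phi (1 - \<sigma>1 / 2) \<sigma>1 (Phi (1 / 2) (1 - 2 * \<sigma>1) (Phi (\<sigma>1 / 2) \<sigma>1 F)) = (\<lambda>i. split_step (eps i) (tau i) (F i))"
  by (simp add: fun_eq_iff Phi_def split_step_def)

lemma (in gbbm_expansion) good_agree:
  assumes F: "good \<alpha> F" and G: "good \<beta> G" and eq: "\<And>t. ord t \<le> 4 \<Longrightarrow> \<alpha> t = \<beta> t"
  shows "OZ 2 2 (\<lambda>i k. F i k - G i k)" and "OR 5 (\<lambda>i k. F i k - G i k)"
proof -
  have *: "(\<lambda>i k. F i k - G i k) = (\<lambda>i k. rem m \<alpha> F i k - rem m \<beta> G i k)" if "m \<le> 5" for m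
  proof (intro ext)
    fix i k
    have "(\<Sum>t\<in>Tr m. of_real (\<alpha> t * tau i ^ ord t) * elt t i k) = (\<Sum>t\<in>Tr m. of_real (\<beta> t * tau i ^ ord t) * elt t i k)"
      using that by (intro sum.cong) (auto simp: Tr_def eq)
    then show "F i k - G i k = rem m \<alpha> F i k - rem m \<beta> G i k" by (simp add: rem_def)
  qed
  show "OZ 2 2 (\<lambda>i k. F i k - G i k)"
    unfolding *[of 2, simplified] using F G by (intro bigO_diff) (auto simp: good_def jet_def)
  show "OR 5 (\<lambda>i k. F i k - G i k)"
    unfolding *[of 5, simplified] using F G by (intro bigO_diff) (auto simp: good_def)
qed

context gbbm begin

definition twisted_solution :: "real \<Rightarrow> real \<Rightarrow> real \<Rightarrow> (real \<Rightarrow> seq) \<Rightarrow> bool" where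
  "twisted_solution M \<epsilon> T v \<longleftrightarrow> (\<forall>s\<in>{0..T}. hbd (zz 0) (v s) M \<and>
     (\<forall>k. ((\<lambda>s. v s k) has_vector_derivative - (E \<epsilon> k * CC \<epsilon> s (v s) (v s) k)) (at s within {0..T})))"

definition coeff_solution :: "real \<Rightarrow> real \<Rightarrow> real \<Rightarrow> (real \<Rightarrow> seq) \<Rightarrow> bool" where
  "coeff_solution M \<epsilon> T U \<longleftrightarrow> (\<forall>t\<in>{0..T}. hbd (zz 0) (U t) M \<and>
     (\<forall>k. ((\<lambda>t. U t k) has_vector_derivative
        - (A \<epsilon> k * U t k) - E \<epsilon> k * CC \<epsilon> 0 (U t) (U t) k) (at t within {0..T})))"

text \<open>All \<open>\<epsilon>\<close>, all steps and all solutions with bound \<open>M\<close>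
  form one family, so the constants hidden in \<open>good\<close> depend on \<open>M\<close> and the
  fixed data only. Equal coefficients up to order four reduce the local error to a difference of
  remainders.\<close>

lemma local_error:
  shows "\<exists>C\<ge>0. \<forall>\<epsilon> \<tau> v. 0 < \<epsilon> \<longrightarrow> \<epsilon> \<le> 1 \<longrightarrow> 0 < \<tau> \<longrightarrow> \<tau> \<le> 1 \<longrightarrow>
     twisted_solution M \<epsilon> \<tau> v \<longrightarrow>
     hbd (zz 2) (\<lambda>k. v \<tau> k - split_step \<epsilon> \<tau> (v 0) k) (C * \<tau> ^ 2) \<and>
     hbd r (\<lambda>k. v \<tau> k - split_step \<epsilon> \<tau> (v 0) k) (C * \<epsilon> powr (1 - \<sigma>) * \<tau> ^ 5)"
proof -
  define I :: "path_index set" where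
    "I = {(\<epsilon>, v, \<tau>). 0 < \<epsilon> \<and> \<epsilon> \<le> 1 \<and> 0 < \<tau> \<and> \<tau> \<le> 1 \<and> twisted_solution M \<epsilon> \<tau> v}"
  define eps :: "path_index \<Rightarrow> real" where "eps = fst"
  define w :: "path_index \<Rightarrow> real \<Rightarrow> seq" where "w = fst \<circ> snd"
  define tau :: "path_index \<Rightarrow> real" where "tau = snd \<circ> snd"
  note defs = I_def eps_def w_def tau_def twisted_solution_def
  interpret gbbm_family P lam \<sigma> r I eps tau
    by unfold_locales (auto simp: defs)
  have b0: "OZ 0 0 (\<lambda>i. w i 0)" and b1: "OZ 0 0 (\<lambda>i. w i (tau i))"
    unfolding OZ_iff by (intro exI[of _ M]; auto simp: defs)+
  interpret gbbm_expansion P lam \<sigma> r I eps tau "\<lambda>i. w i 0"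
    by unfold_locales (rule b0)
  have X: "good exact_coeff (\<lambda>i. w i (tau i))"
  proof (rule good_exact)
    fix i s k assume "i \<in> I" "0 \<le> s" "s \<le> tau i"
    then show "((\<lambda>s. w i s k) has_vector_derivative - (E (eps i) k * CC (eps i) s (w i s) (w i s) k)) (at s within {0..tau i})"
      by (auto simp: defs)
  next
    fix i s assume i: "i \<in> I" and s: "0 < s" "s \<le> tau i"
    show "\<exists>j\<in>I. eps j = eps i \<and> tau j = s \<and> w j = w i"
    proof (intro bexI conjI)
      \<comment> \<open>The same path, restricted to \<open>{0..s}\<close>, is again a member of the
        family.\<close>
      have "((\<lambda>s. w i s k) has_vector_derivative - (E (eps i) k * CC (eps i) x (w i x) (w i x) k)) (at x within {0..s})"
        if "x \<in> {0..s}" for x k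
        by (rule has_vector_derivative_within_subset[of _ _ _ "{0..tau i}"])
           (use i s that in \<open>auto simp: defs\<close>)
      then show "(eps i, w i, s) \<in> I"
        using i s by (auto simp: defs)
    qed (auto simp: defs)
  qed (use b1 in auto)
  have Y: "good (stage_coeff (1 - \<sigma>1 / 2) \<sigma>1 (stage_coeff (1 / 2) (1 - 2 * \<sigma>1) (stage_coeff (\<sigma>1 / 2) \<sigma>1 (\<lambda>t. if t = V then 1 else 0))))
     (\<lambda>i. split_step (eps i) (tau i) (w i 0))"
    unfolding Phi_split_step[symmetric] by (intro good_Phi good_v0)
  note ag = good_agree[OF X Y order_conditions[OF sigma_cubic, symmetric]]
  obtain C1 where C1: "0 \<le> C1" "\<And>i. i \<in> I \<Longrightarrow> hbd (zz 2) (\<lambda>k. w i (tau i) k - split_step (eps i) (tau i) (w i 0) k) (C1 * tau i ^ 2)"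
    by (rule OZ_obtain[OF ag(1)]) auto
  obtain C2 where C2: "\<And>i. i \<in> I \<Longrightarrow> hbd r (\<lambda>k. w i (tau i) k - split_step (eps i) (tau i) (w i 0) k) (C2 * eps i powr (1 - \<sigma>) * tau i ^ 5)"
    using ag(2) unfolding bigO_def by blast
  let ?C = "C1 + \<bar>C2\<bar>"
  show ?thesis
  proof (intro exI[of _ ?C] conjI allI impI)
    fix \<epsilon> \<tau> v
    assume a: "0 < \<epsilon>" "\<epsilon> \<le> 1" "0 < \<tau>" "\<tau> \<le> 1" "twisted_solution M \<epsilon> \<tau> v"
    then have i: "(\<epsilon>, v, \<tau>) \<in> I" by (simp add: I_def)
    show "hbd (zz 2) (\<lambda>k. v \<tau> k - split_step \<epsilon> \<tau> (v 0) k) (?C * \<tau> ^ 2)"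
      using C1(2)[OF i] a by (auto simp: eps_def w_def tau_def intro: hbd_mono mult_right_mono)
    show "hbd r (\<lambda>k. v \<tau> k - split_step \<epsilon> \<tau> (v 0) k) (?C * \<epsilon> powr (1 - \<sigma>) * \<tau> ^ 5)"
      using C2[OF i] a C1(1) by (auto simp: eps_def w_def tau_def intro!: mult_right_mono elim!: hbd_mono)
  qed (use C1 in simp)
qed

text \<open>The surplus \<open>2 * lam\<close> outweighs \<open>2 * \<sigma>\<close>. Hence
  \<open>zz 2\<close> is an algebra whose elements act by multiplication on the weaker spaces
  between 0 and \<open>zz 2\<close>, in particular on the one with exponent
  \<open>r\<close>.\<close>

lemma rho: "1 \<le> zz 2" "r + 1 \<le> zz 2" "zz 2 \<le> zz 0"
proof -
  have "1 \<le> real lam" using lam by simp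
  then show "1 \<le> zz 2" "r + 1 \<le> zz 2" "zz 2 \<le> zz 0" using r \<sigma> by (simp_all add: zz_def)
qed

lemma CC_bound:
  assumes f: "hbd a f X" and g: "hbd b g Y" and e: "0 < \<epsilon>"
    and c: "c \<le> a" "c \<le> b" "1 \<le> a + b" "1 \<le> a + b - c"
  shows "bsum (\<lambda>k j. exp (of_real t * phase \<epsilon> k j)) f g" and "hbd c (CC \<epsilon> t f g) (bilc c * X * Y)"
proof -
  have m: "cmod (exp (of_real t * phase \<epsilon> k j)) \<le> (1/2) * (jb j powr 0 + jb (k - j) powr 0)" for k j
    by (simp add: norm_exp_eq_Re)
  note bb = bil_bound[OF f g m, of c]
  show "bsum (\<lambda>k j. exp (of_real t * phase \<epsilon> k j)) f g" using bb(1) c by simp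
  have "hbd c (CC \<epsilon> t f g) (bilc c * (1/2) * X * Y)" unfolding CC_def using bb(2) c by simp
  then show "hbd c (CC \<epsilon> t f g) (bilc c * X * Y)"
    by (rule hbd_mono) (simp add: mult_right_mono hbd_nonneg[OF f] hbd_nonneg[OF g])
qed

end

section \<open>Lipschitz estimates for one step of the scheme\<close>

locale gbbm_stability = gbbm_family +
  fixes b :: real and d :: "'a \<Rightarrow> real"
  assumes b: "0 \<le> b" "b \<le> zz 2"
begin

text \<open>Sizes are controlled in the algebra \<open>zz 2\<close>, differences in a possibly
  weaker norm \<open>b\<close> and relative to \<open>d\<close>. The power \<open>p\<close> is 1 for
  increments of a stage, where the identity has been split off; this is what produces the factor
  \<open>1 + K * \<tau>\<close> in the end.\<close>

definition lip_bd :: "real \<Rightarrow> nat \<Rightarrow> ('a \<Rightarrow> seq) \<Rightarrow> ('a \<Rightarrow> seq) \<Rightarrow> bool" where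
  "lip_bd K p F G \<longleftrightarrow> 0 \<le> K \<and> (\<forall>i\<in>I. hbd (zz 2) (F i) K \<and> hbd (zz 2) (G i) K \<and>
     hbd b (\<lambda>k. F i k - G i k) (K * d i * tau i ^ p))"

definition lip_pair :: "nat \<Rightarrow> ('a \<Rightarrow> seq) \<Rightarrow> ('a \<Rightarrow> seq) \<Rightarrow> bool" where
  "lip_pair p F G \<longleftrightarrow> (\<exists>K. lip_bd K p F G)"

lemma lip_bdD:
  assumes "lip_bd K p F G"
  shows "0 \<le> K" "i \<in> I \<Longrightarrow> hbd (zz 2) (F i) K" "i \<in> I \<Longrightarrow> hbd (zz 2) (G i) K"
    "i \<in> I \<Longrightarrow> hbd b (\<lambda>k. F i k - G i k) (K * d i * tau i ^ p)"
  using assms by (auto simp: lip_bd_def)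

lemma lip_pair_add: assumes "lip_pair p F G" "lip_pair p F' G'" shows "lip_pair p (\<lambda>i k. F i k + F' i k) (\<lambda>i k. G i k + G' i k)"
proof -
  from assms obtain K K' where KK: "lip_bd K p F G" "lip_bd K' p F' G'" unfolding lip_pair_def by blast
  note K = lip_bdD[OF KK(1)] and K' = lip_bdD[OF KK(2)]
  show ?thesis unfolding lip_pair_def lip_bd_def
    using hbd_add[OF K(2) K'(2)] hbd_add[OF K(3) K'(3)] hbd_add[OF K(4) K'(4)] K(1) K'(1)
    by (intro exI[of _ "K + K'"]) (simp add: algebra_simps)
qed

lemma lip_pair_scale: assumes "lip_pair p F G" shows "lip_pair p (\<lambda>i k. c * F i k) (\<lambda>i k. c * G i k)"
proof -
  from assms obtain K where "lip_bd K p F G" unfolding lip_pair_def by blast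
  note K = lip_bdD[OF this]
  show ?thesis unfolding lip_pair_def lip_bd_def
    using hbd_scale[OF K(2), of _ c] hbd_scale[OF K(3), of _ c] hbd_scale[OF K(4), of _ c] K(1)
    by (intro exI[of _ "cmod c * K"]) (simp add: algebra_simps)
qed

lemma lip_pair_diff: "lip_pair p F G \<Longrightarrow> lip_pair p F' G' \<Longrightarrow> lip_pair p (\<lambda>i k. F i k - F' i k) (\<lambda>i k. G i k - G' i k)"
  using lip_pair_add[of p F G "\<lambda>i k. (-1) * F' i k" "\<lambda>i k. (-1) * G' i k"] lip_pair_scale[of p F' G' "-1"] by simp

lemma lip_pair_weaken: assumes "lip_pair (Suc 0) F G" shows "lip_pair 0 F G"
proof -
  from assms obtain K where "lip_bd K (Suc 0) F G" unfolding lip_pair_def by blast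
  note K = lip_bdD[OF this, simplified]
  have "hbd b (\<lambda>k. F i k - G i k) (K * d i)" if i: "i \<in> I" for i
  proof -
    \<comment> \<open>The sign of \<open>d\<close> is not prescribed, but a bound in
      \<open>hbd\<close> forces it to be nonnegative.\<close>
    have "0 \<le> K * d i" using hbd_nonneg[OF K(4)[OF i]] tau(1)[OF i] by (simp add: zero_le_mult_iff)
    then show ?thesis using tau(2)[OF i] tau(1)[OF i]
      by (intro hbd_mono[OF K(4)[OF i]]) (auto intro: mult_left_le)
  qed
  then show ?thesis unfolding lip_pair_def lip_bd_def using K by auto
qed

text \<open>The difference of two products is split as
  \<open>C (F - G, F') + C (G, F' - G')\<close>; in each term the factor without a difference is
  measured in \<open>zz 2\<close>.\<close>

lemma lip_pair_Mop: assumes "lip_pair 0 F G" "lip_pair 0 F' G'" shows "lip_pair (Suc 0) (Mop \<theta> F F') (Mop \<theta> G G')"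
proof -
  from assms obtain K K' where KK: "lip_bd K 0 F G" "lip_bd K' 0 F' G'" unfolding lip_pair_def by blast
  note K = lip_bdD[OF KK(1), simplified] and K' = lip_bdD[OF KK(2), simplified]
  have M: "hbd c (\<lambda>k. of_real (tau i) * (E (eps i) k * h k)) (C * tau i)" if "i \<in> I" "hbd c h C" for i c h C
  proof -
    have "hbd c (\<lambda>k. E (eps i) k * h k) C" by (intro hbd_mult_le1 that E_le1 eps)
    from hbd_scale[OF this, of "of_real (tau i)"] show ?thesis using tau(1)[OF that(1)] by (simp add: mult.commute)
  qed
  have M1: "hbd c (\<lambda>k. of_real (tau i) * (E (eps i) k * h k)) C" if "i \<in> I" "hbd c h C" for i c h C
    using tau(2)[OF that(1)] hbd_nonneg[OF that(2)] by (intro hbd_mono[OF M[OF that]]) (simp add: mult_left_le)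
  \<comment> \<open>\<open>bilc (zz 2)\<close> bounds the sizes, and each of the two difference
    terms contributes one \<open>bilc b\<close>.\<close>
  let ?K = "(bilc (zz 2) + 2 * bilc b) * (K * K')"
  have KK: "bilc (zz 2) * K * K' \<le> ?K" using K(1) K'(1) by (simp add: algebra_simps mult_nonneg_nonneg)
  show ?thesis unfolding lip_pair_def lip_bd_def
  proof (intro exI[of _ ?K] conjI ballI)
    show "0 \<le> ?K" using K(1) K'(1) by simp
    fix i assume i: "i \<in> I"
    have z: "1 \<le> zz 2 + zz 2" using rho by simp
    have "hbd (zz 2) (CC (eps i) (\<theta> * tau i) (F i) (F' i)) ?K" "hbd (zz 2) (CC (eps i) (\<theta> * tau i) (G i) (G' i)) ?K"
      using hbd_mono[OF CC_bound(2)[OF K(2)[OF i] K'(2)[OF i] eps(1)[OF i], of "zz 2"] KK]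
        hbd_mono[OF CC_bound(2)[OF K(3)[OF i] K'(3)[OF i] eps(1)[OF i], of "zz 2"] KK] rho z by simp_all
    then show "hbd (zz 2) (Mop \<theta> F F' i) ?K" "hbd (zz 2) (Mop \<theta> G G' i) ?K"
      unfolding Mop_def[abs_def] by (intro M1 i; simp)+
    have 1: "hbd b (CC (eps i) (\<theta> * tau i) (\<lambda>k. F i k - G i k) (F' i)) (bilc b * (K * d i) * K')"
      and s1: "bsum (\<lambda>k j. exp (of_real (\<theta> * tau i) * phase (eps i) k j)) (\<lambda>k. F i k - G i k) (F' i)"
      using CC_bound[OF K(4)[OF i] K'(2)[OF i] eps(1)[OF i], of b] b rho by (auto simp del: of_real_mult)
    have 2: "hbd b (CC (eps i) (\<theta> * tau i) (G i) (\<lambda>k. F' i k - G' i k)) (bilc b * K * (K' * d i))"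
      and s2: "bsum (\<lambda>k j. exp (of_real (\<theta> * tau i) * phase (eps i) k j)) (G i) (\<lambda>k. F' i k - G' i k)"
      using CC_bound[OF K(3)[OF i] K'(4)[OF i] eps(1)[OF i], of b] b rho by (auto simp del: of_real_mult)
    have s3: "bsum (\<lambda>k j. exp (of_real (\<theta> * tau i) * phase (eps i) k j)) (G i) (F' i)"
      and s4: "bsum (\<lambda>k j. exp (of_real (\<theta> * tau i) * phase (eps i) k j)) (G i) (G' i)"
      using CC_bound(1)[OF K(3)[OF i] K'(2)[OF i] eps(1)[OF i], of "zz 2"]
        CC_bound(1)[OF K(3)[OF i] K'(3)[OF i] eps(1)[OF i], of "zz 2"] rho z by (auto simp del: of_real_mult)
    have "CC (eps i) (\<theta> * tau i) (F i) (F' i) k - CC (eps i) (\<theta> * tau i) (G i) (G' i) k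
       = CC (eps i) (\<theta> * tau i) (\<lambda>k. F i k - G i k) (F' i) k + CC (eps i) (\<theta> * tau i) (G i) (\<lambda>k. F' i k - G' i k) k" for k
      unfolding CC_def using Bil_add_left[OF s1 s3, of k] Bil_add_right[OF s2 s4, of k] by simp
    then have eq: "(\<lambda>k. Mop \<theta> F F' i k - Mop \<theta> G G' i k) = (\<lambda>k. of_real (tau i) * (E (eps i) k *
        (CC (eps i) (\<theta> * tau i) (\<lambda>k. F i k - G i k) (F' i) k + CC (eps i) (\<theta> * tau i) (G i) (\<lambda>k. F' i k - G' i k) k)))"
      by (simp add: Mop_def fun_eq_iff algebra_simps)
    have "hbd b (\<lambda>k. Mop \<theta> F F' i k - Mop \<theta> G G' i k) ((bilc b * (K * d i) * K' + bilc b * K * (K' * d i)) * tau i)"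
      unfolding eq by (intro M i hbd_add 1 2)
    moreover have "(bilc b * (K * d i) * K' + bilc b * K * (K' * d i)) * tau i \<le> ?K * d i * tau i ^ Suc 0"
    proof -
      have "0 \<le> (bilc (zz 2) * K') * (K * d i)" using K'(1) by (intro mult_nonneg_nonneg hbd_nonneg[OF K(4)[OF i]]) auto
      then have "bilc b * (K * d i) * K' + bilc b * K * (K' * d i) \<le> ?K * d i" by (simp add: algebra_simps)
      then show ?thesis using tau(1)[OF i] by (simp add: mult_right_mono)
    qed
    ultimately show "hbd b (\<lambda>k. Mop \<theta> F F' i k - Mop \<theta> G G' i k) (?K * d i * tau i ^ Suc 0)"
      by (rule hbd_mono)
  qed
qed

lemma lip_pair_Phi:
  assumes "lip_pair 0 F G"
  shows "lip_pair (Suc 0) (\<lambda>i k. Phi \<theta> c F i k - F i k) (\<lambda>i k. Phi \<theta> c G i k - G i k)" and "lip_pair 0 (Phi \<theta> c F) (Phi \<theta> c G)"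
proof -
  define p where "p F = Mop \<theta> F F" for F
  define q where "q F = Mop \<theta> F (p F)" for F
  define u where "u F = Mop \<theta> (p F) (p F)" for F
  define v where "v F = Mop \<theta> F (q F)" for F
  define h where "h = complex_of_real c"
  have p: "lip_pair (Suc 0) (p F) (p G)" unfolding p_def by (intro lip_pair_Mop assms)
  have q: "lip_pair (Suc 0) (q F) (q G)" unfolding q_def by (intro lip_pair_Mop lip_pair_weaken[OF p] assms)
  have u: "lip_pair (Suc 0) (u F) (u G)" unfolding u_def by (intro lip_pair_Mop lip_pair_weaken[OF p] assms)
  have v: "lip_pair (Suc 0) (v F) (v G)" unfolding v_def by (intro lip_pair_Mop lip_pair_weaken[OF q] assms)
  define X where "X F = (\<lambda>i k. (- h) * p F i k + h ^ 2 * q F i k - (1/3 * h ^ 3) * u F i k - (2/3 * h ^ 3) * v F i k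
        + (1/2 * h ^ 4) * Mop \<theta> (p F) (q F) i k + (1/6 * h ^ 4) * Mop \<theta> F (u F) i k + (1/3 * h ^ 4) * Mop \<theta> F (v F) i k)" for F
  have X: "lip_pair (Suc 0) (X F) (X G)"
    unfolding X_def by (intro lip_pair_add lip_pair_diff lip_pair_scale lip_pair_Mop p q u v assms lip_pair_weaken[OF p] lip_pair_weaken[OF q] lip_pair_weaken[OF u] lip_pair_weaken[OF v])
  have Phi: "Phi \<theta> c F i k = X F i k + F i k" for F i k
    unfolding Phi_def taylor_flow_def Let_def X_def p_def q_def u_def v_def h_def
    by (simp add: Mop_def[abs_def] MM_def[abs_def] fun_eq_iff)
  show "lip_pair (Suc 0) (\<lambda>i k. Phi \<theta> c F i k - F i k) (\<lambda>i k. Phi \<theta> c G i k - G i k)"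
    using X by (simp add: Phi)
  show "lip_pair 0 (Phi \<theta> c F) (Phi \<theta> c G)"
    using lip_pair_add[OF lip_pair_weaken[OF X] assms] by (simp add: Phi[abs_def])
qed

text \<open>The increments of the three stages telescope, and each of them carries one power of the
  step size.\<close>

lemma lip_pair_SS:
  assumes "lip_pair 0 F G"
  shows "lip_pair (Suc 0) (\<lambda>i k. split_step (eps i) (tau i) (F i) k - F i k) (\<lambda>i k. split_step (eps i) (tau i) (G i) k - G i k)"
proof -
  define F1 where "F1 F = Phi (\<sigma>1 / 2) \<sigma>1 F" for F
  define F2 where "F2 F = Phi (1 / 2) (1 - 2 * \<sigma>1) (F1 F)" for F
  have 1: "lip_pair 0 (F1 F) (F1 G)" unfolding F1_def by (intro lip_pair_Phi assms)
  have 2: "lip_pair 0 (F2 F) (F2 G)" unfolding F2_def by (intro lip_pair_Phi 1)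
  have "lip_pair (Suc 0)
     (\<lambda>i k. (Phi (1 - \<sigma>1 / 2) \<sigma>1 (F2 F) i k - F2 F i k) + ((F2 F i k - F1 F i k) + (F1 F i k - F i k)))
     (\<lambda>i k. (Phi (1 - \<sigma>1 / 2) \<sigma>1 (F2 G) i k - F2 G i k) + ((F2 G i k - F1 G i k) + (F1 G i k - G i k)))"
    by (intro lip_pair_add lip_pair_Phi(1)[OF 2] lip_pair_Phi(1)[OF 1, of "1 / 2" "1 - 2 * \<sigma>1", folded F2_def] lip_pair_Phi(1)[OF assms, of "\<sigma>1 / 2" \<sigma>1, folded F1_def])
  moreover have "(\<lambda>i k. (Phi (1 - \<sigma>1 / 2) \<sigma>1 (F2 F) i k - F2 F i k) + ((F2 F i k - F1 F i k) + (F1 F i k - F i k)))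
     = (\<lambda>i k. split_step (eps i) (tau i) (F i) k - F i k)" for F
    using Phi_split_step[of F] by (simp add: F1_def F2_def fun_eq_iff)
  ultimately show ?thesis by simp
qed

end

context gbbm begin

definition lipschitz_step :: "real \<Rightarrow> real \<Rightarrow> real \<Rightarrow> bool" where
  "lipschitz_step b R K \<longleftrightarrow> (\<forall>\<epsilon> \<tau> f g d. 0 < \<epsilon> \<longrightarrow> \<epsilon> \<le> 1 \<longrightarrow> 0 < \<tau> \<longrightarrow> \<tau> \<le> 1 \<longrightarrow>
     hbd (zz 2) f R \<longrightarrow> hbd (zz 2) g R \<longrightarrow> hbd b (\<lambda>k. f k - g k) d \<longrightarrow>
     hbd b (\<lambda>k. split_step \<epsilon> \<tau> f k - split_step \<epsilon> \<tau> g k) ((1 + K * \<tau>) * d))"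

lemma stability:
  assumes b: "0 \<le> b" "b \<le> zz 2"
  shows "\<exists>K\<ge>0. lipschitz_step b R K"
proof -
  define I :: "stability_index set" where
    "I = {(\<epsilon>, \<tau>, f, g, d). 0 < \<epsilon> \<and> \<epsilon> \<le> 1 \<and> 0 < \<tau> \<and> \<tau> \<le> 1 \<and>
      hbd (zz 2) f R \<and> hbd (zz 2) g R \<and> hbd b (\<lambda>k. f k - g k) d}"
  define eps :: "stability_index \<Rightarrow> real" where "eps = fst"
  define tau :: "stability_index \<Rightarrow> real" where "tau = fst \<circ> snd"
  define F :: "stability_index \<Rightarrow> seq" where "F = fst \<circ> snd \<circ> snd"
  define G :: "stability_index \<Rightarrow> seq" where "G = fst \<circ> snd \<circ> snd \<circ> snd"
  define d :: "stability_index \<Rightarrow> real" where "d = snd \<circ> snd \<circ> snd \<circ> snd"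
  note defs = I_def eps_def tau_def F_def G_def d_def
  interpret gbbm_stability P lam \<sigma> r I eps tau b d
    by unfold_locales (use b in \<open>auto simp: defs\<close>)
  have "lip_pair 0 F G"
    unfolding lip_pair_def lip_bd_def
  \<comment> \<open>A single constant has to bound the sizes, hence \<open>R\<close>, and the ratio
    of the initial difference to \<open>d\<close>, hence 1.\<close>
  proof (intro exI[of _ "max 1 R"] conjI ballI)
    fix i assume i: "i \<in> I"
    then show "hbd (zz 2) (F i) (max 1 R)" "hbd (zz 2) (G i) (max 1 R)"
      by (auto simp: defs intro: hbd_mono)
    have "hbd b (\<lambda>k. F i k - G i k) (d i)" using i by (auto simp: defs)
    then show "hbd b (\<lambda>k. F i k - G i k) (max 1 R * d i * tau i ^ 0)"
      using hbd_nonneg[of b "\<lambda>k. F i k - G i k" "d i"]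
        mult_right_mono[of 1 "max 1 R" "d i"] by (auto intro: hbd_mono)
  qed simp
  from lip_pair_SS[OF this] obtain K where K: "0 \<le> K" "\<And>i. i \<in> I \<Longrightarrow>
    hbd b (\<lambda>k. (split_step (eps i) (tau i) (F i) k - F i k) - (split_step (eps i) (tau i) (G i) k - G i k)) (K * d i * tau i)"
    unfolding lip_pair_def lip_bd_def by auto
  show ?thesis unfolding lipschitz_step_def
  proof (intro exI[of _ K] conjI allI impI)
    fix \<epsilon> \<tau> e :: real and f g :: "seq"
    assume a: "0 < \<epsilon>" "\<epsilon> \<le> 1" "0 < \<tau>" "\<tau> \<le> 1" "hbd (zz 2) f R" "hbd (zz 2) g R" "hbd b (\<lambda>k. f k - g k) e"
    then have i: "(\<epsilon>, \<tau>, f, g, e) \<in> I" by (simp add: I_def)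
    have "hbd b (\<lambda>k. (split_step \<epsilon> \<tau> f k - f k) - (split_step \<epsilon> \<tau> g k - g k)) (K * e * \<tau>)"
      using K(2)[OF i] by (simp add: eps_def tau_def F_def G_def d_def)
    from hbd_add[OF this a(7)] show "hbd b (\<lambda>k. split_step \<epsilon> \<tau> f k - split_step \<epsilon> \<tau> g k) ((1 + K * \<tau>) * e)"
      by (simp add: algebra_simps)
  qed (use K in simp)
qed

text \<open>\<open>exp (t * phase)\<close> cancels the free evolutions of the two input modes and
  leaves that of the output mode.\<close>

lemma CC_twist:
  "CC \<epsilon> t (\<lambda>k. exp (of_real t * A \<epsilon> k) * f k) (\<lambda>k. exp (of_real t * A \<epsilon> k) * g k) k
     = exp (of_real t * A \<epsilon> k) * CC \<epsilon> 0 f g k"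
proof -
  have "exp (of_real t * phase \<epsilon> k j) * (exp (of_real t * A \<epsilon> j) * f j) * (exp (of_real t * A \<epsilon> (k - j)) * g (k - j))
    = exp (of_real t * A \<epsilon> k) * (f j * g (k - j))" for j
  proof -
    have "exp (of_real t * phase \<epsilon> k j) * exp (of_real t * A \<epsilon> j) * exp (of_real t * A \<epsilon> (k - j)) = exp (of_real t * A \<epsilon> k)"
      by (simp add: exp_add[symmetric] phase_def algebra_simps)
    moreover have "exp (of_real t * phase \<epsilon> k j) * (exp (of_real t * A \<epsilon> j) * f j) * (exp (of_real t * A \<epsilon> (k - j)) * g (k - j))
      = (exp (of_real t * phase \<epsilon> k j) * exp (of_real t * A \<epsilon> j) * exp (of_real t * A \<epsilon> (k - j))) * (f j * g (k - j))"
      by (simp only: mult_ac)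
    ultimately show ?thesis by simp
  qed
  then show ?thesis unfolding CC_def Bil_def by (simp only: infsum_cmult_right') simp
qed

text \<open>First order convergence in \<open>zz 2\<close> keeps the numerical solution in a ball of that space, in which
  the scheme is stable in the \<open>r\<close> norm as well.\<close>

lemma global_error:
  assumes T: "0 < T"
  shows "\<exists>K>0. \<exists>\<tau>0>0. \<forall>\<epsilon> U \<tau> n Y. 0 < \<epsilon> \<longrightarrow> \<epsilon> \<le> 1 \<longrightarrow>
    coeff_solution M \<epsilon> T U \<longrightarrow> 0 < \<tau> \<longrightarrow> \<tau> \<le> \<tau>0 \<longrightarrow> real n * \<tau> \<le> T \<longrightarrow> Y 0 = U 0 \<longrightarrow>
    (\<forall>m. Y (Suc m) = (\<lambda>k. exp (- of_real \<tau> * A \<epsilon> k) * split_step \<epsilon> \<tau> (Y m) k)) \<longrightarrow>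
    hbd r (\<lambda>k. U (real n * \<tau>) k - Y n k) (\<epsilon> powr (1 - \<sigma>) * \<tau> ^ 4 * K)"
proof -
  obtain C where C: "0 \<le> C" and loc: "\<And>\<epsilon> \<tau> v. 0 < \<epsilon> \<Longrightarrow> \<epsilon> \<le> 1 \<Longrightarrow> 0 < \<tau> \<Longrightarrow> \<tau> \<le> 1 \<Longrightarrow>
     twisted_solution M \<epsilon> \<tau> v \<Longrightarrow>
     hbd (zz 2) (\<lambda>k. v \<tau> k - split_step \<epsilon> \<tau> (v 0) k) (C * \<tau> ^ 2) \<and>
     hbd r (\<lambda>k. v \<tau> k - split_step \<epsilon> \<tau> (v 0) k) (C * \<epsilon> powr (1 - \<sigma>) * \<tau> ^ 5)"
    using local_error[of M] by blast
  obtain K1 where "0 \<le> K1" "lipschitz_step (zz 2) (M + 1) K1"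
    using stability[of "zz 2" "M + 1"] rho(1) by auto
  note K1 = this(1) this(2)[unfolded lipschitz_step_def, rule_format]
  obtain K2 where "0 \<le> K2" "lipschitz_step r (M + 1) K2"
    using stability[of r "M + 1"] rho(2) r by auto
  note K2 = this(1) this(2)[unfolded lipschitz_step_def, rule_format]
  \<comment> \<open>\<open>X1\<close> is the constant of first order convergence in
    \<open>zz 2\<close>, and \<open>\<tau>0\<close> ensures \<open>X1 * \<tau> \<le> 1\<close>, so
    that the numerical solution stays within \<open>M + 1\<close>. The final constant is
    \<open>X2 + 1\<close>, where the 1 makes it positive.\<close>
  define X1 where "X1 = C * T * exp (K1 * T)"
  define \<tau>0 where "\<tau>0 = min 1 (1 / (X1 + 1))"
  define X2 where "X2 = C * T * exp (K2 * T)"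
  have X: "0 \<le> X1" "0 \<le> X2" using C T by (simp_all add: X1_def X2_def)
  have \<tau>0: "0 < \<tau>0" using X by (simp add: \<tau>0_def)
  have "hbd r (\<lambda>k. U (real n * \<tau>) k - Y n k) (\<epsilon> powr (1 - \<sigma>) * \<tau> ^ 4 * (X2 + 1))"
    if e: "0 < \<epsilon>" "\<epsilon> \<le> 1" and sol: "coeff_solution M \<epsilon> T U"
      and t: "0 < \<tau>" "\<tau> \<le> \<tau>0" "real n * \<tau> \<le> T" and Y0: "Y 0 = U 0"
      and Y: "\<forall>m. Y (Suc m) = (\<lambda>k. exp (- of_real \<tau> * A \<epsilon> k) * split_step \<epsilon> \<tau> (Y m) k)"
    for \<epsilon> U \<tau> n Y
  proof -
    have bd: "\<forall>t\<in>{0..T}. hbd (zz 0) (U t) M"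
      and ode: "\<forall>t\<in>{0..T}. \<forall>k. ((\<lambda>t. U t k) has_vector_derivative
        - (A \<epsilon> k * U t k) - E \<epsilon> k * CC \<epsilon> 0 (U t) (U t) k) (at t within {0..T})"
      using sol by (auto simp: coeff_solution_def)
    have t1: "\<tau> \<le> 1" "X1 * \<tau> \<le> 1"
    proof -
      show "\<tau> \<le> 1" using t by (simp add: \<tau>0_def)
      have "X1 * \<tau> \<le> X1 * (1 / (X1 + 1))" using t X by (intro mult_left_mono) (auto simp: \<tau>0_def)
      also have "\<dots> \<le> 1" using X by simp
      finally show "X1 * \<tau> \<le> 1" .
    qed
    \<comment> \<open>The induction step of the discrete Gronwall inequality, with \<open>L\<close>
      as the local error: \<open>m\<close> errors, each amplified by at most
      \<open>exp (K * m * \<tau>)\<close>.\<close>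
    have step: "(1 + K * \<tau>) * (L * real m * exp (K * (real m * \<tau>))) + L \<le> L * real (Suc m) * exp (K * (real (Suc m) * \<tau>))"
      if "0 \<le> K" "0 \<le> L" for K L m
    proof -
      have "(1 + K * \<tau>) * (L * real m * exp (K * (real m * \<tau>))) \<le> exp (K * \<tau>) * (L * real m * exp (K * (real m * \<tau>)))"
        using that by (intro mult_right_mono exp_ge_add_one_self) auto
      also have "\<dots> = L * real m * exp (K * (real (Suc m) * \<tau>))" by (simp add: exp_add[symmetric] algebra_simps)
      finally have 1: "(1 + K * \<tau>) * (L * real m * exp (K * (real m * \<tau>))) \<le> L * real m * exp (K * (real (Suc m) * \<tau>))" .
      have "L * 1 \<le> L * exp (K * (real (Suc m) * \<tau>))" using that t by (intro mult_left_mono) auto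
      with 1 show ?thesis by (simp add: algebra_simps)
    qed
    have tm: "real m * \<tau> \<in> {0..T}" if "m \<le> n" for m
      using t that by (auto intro: order_trans[OF mult_right_mono[of "real m" "real n"]])
    have T_bound: "real m * \<tau> * exp (K * (real m * \<tau>)) \<le> T * exp (K * T)" if "m \<le> n" "0 \<le> K" for m K
      using tm[OF that(1)] that T by (intro mult_mono) (auto intro!: mult_left_mono)
    \<comment> \<open>Both estimates run in one induction, since the bound in \<open>zz 2\<close> at
      \<open>m\<close> provides the ball in which the next step is Lipschitz in either norm.\<close>
    have main: "hbd (zz 2) (\<lambda>k. U (real m * \<tau>) k - Y m k) (C * \<tau> ^ 2 * real m * exp (K1 * (real m * \<tau>))) \<and>
      hbd r (\<lambda>k. U (real m * \<tau>) k - Y m k) (C * \<epsilon> powr (1 - \<sigma>) * \<tau> ^ 5 * real m * exp (K2 * (real m * \<tau>)))"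
      if "m \<le> n" for m
      using that
    proof (induction m)
      case 0
      then show ?case by (simp add: Y0)
    next
      case (Suc m)
      let ?t = "real m * \<tau>"
      have IH1: "hbd (zz 2) (\<lambda>k. U ?t k - Y m k) (C * \<tau> ^ 2 * real m * exp (K1 * ?t))"
        and IH2: "hbd r (\<lambda>k. U ?t k - Y m k) (C * \<epsilon> powr (1 - \<sigma>) * \<tau> ^ 5 * real m * exp (K2 * ?t))"
        using Suc by auto
      have tm1: "?t \<in> {0..T}" "?t + \<tau> \<in> {0..T}" using tm[of m] tm[of "Suc m"] Suc.prems by (auto simp: algebra_simps)
      have U2: "hbd (zz 2) (U ?t) M" using bd tm1 rho by (auto intro: hbd_weaken)
      have "C * \<tau> ^ 2 * real m * exp (K1 * ?t) = C * \<tau> * (?t * exp (K1 * ?t))" by (simp add: power2_eq_square)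
      also have "\<dots> \<le> C * \<tau> * (T * exp (K1 * T))"
        using C t K1 Suc.prems by (intro mult_left_mono T_bound) auto
      also have "\<dots> = X1 * \<tau>" by (simp add: X1_def)
      also have "\<dots> \<le> 1" by (rule t1)
      finally have small: "C * \<tau> ^ 2 * real m * exp (K1 * ?t) \<le> 1" .
      have Y2: "hbd (zz 2) (Y m) (M + 1)"
        using hbd_diff[OF U2 hbd_mono[OF IH1 small]] by simp
      have U3: "hbd (zz 2) (U ?t) (M + 1)" using hbd_mono[OF U2, of "M + 1"] by simp
      \<comment> \<open>The interaction picture is restarted at every step, so that
        \<open>local_error\<close> applies with initial value \<open>U ?t\<close>.\<close>
      define v where "v s k = exp (of_real s * A \<epsilon> k) * U (?t + s) k" for s k
      have v0: "v 0 = U ?t" by (simp add: v_def fun_eq_iff)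
      have in_T: "?t + s \<in> {0..T}" if "s \<in> {0..\<tau>}" for s using that tm1 by auto
      have vb: "hbd (zz 0) (v s) M" if s: "s \<in> {0..\<tau>}" for s
      proof -
        have "hbd (zz 0) (U (?t + s)) M" using bd in_T[OF s] by blast
        then show "hbd (zz 0) (v s) M" unfolding v_def[abs_def] by (rule hbd_mult_le1) simp
      qed
      have vd: "((\<lambda>s. v s k) has_vector_derivative - (E \<epsilon> k * CC \<epsilon> s (v s) (v s) k)) (at s within {0..\<tau>})"
        if s: "s \<in> {0..\<tau>}" for s k
      proof -
        let ?D = "- (A \<epsilon> k * U (?t + s) k) - E \<epsilon> k * CC \<epsilon> 0 (U (?t + s)) (U (?t + s)) k"
        have "((\<lambda>t. U t k) has_vector_derivative ?D) (at (?t + s) within (\<lambda>s. ?t + s) ` {0..\<tau>})"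
          by (rule has_vector_derivative_within_subset[of _ _ _ "{0..T}"]) (use ode in_T s in \<open>auto simp del: image_add_atLeastAtMost\<close>)
        then have "(((\<lambda>t. U t k) \<circ> (\<lambda>s. ?t + s)) has_vector_derivative 1 *\<^sub>R ?D) (at s within {0..\<tau>})"
          by (intro vector_diff_chain_within) (auto intro!: derivative_eq_intros)
        then have 1: "((\<lambda>s. U (?t + s) k) has_vector_derivative ?D) (at s within {0..\<tau>})" by (simp add: o_def)
        have "((\<lambda>z. exp (z * A \<epsilon> k)) has_field_derivative exp (of_real s * A \<epsilon> k) * A \<epsilon> k) (at (of_real s))"
          by (auto intro!: derivative_eq_intros)
        then have 2: "((\<lambda>s. exp (of_real s * A \<epsilon> k)) has_vector_derivative exp (of_real s * A \<epsilon> k) * A \<epsilon> k) (at s within {0..\<tau>})"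
          by (rule has_vector_derivative_real_field)
        have "((\<lambda>s. v s k) has_vector_derivative
            exp (of_real s * A \<epsilon> k) * ?D + (exp (of_real s * A \<epsilon> k) * A \<epsilon> k) * U (?t + s) k) (at s within {0..\<tau>})"
          unfolding v_def by (rule has_vector_derivative_mult[OF 2 1])
        moreover have "exp (of_real s * A \<epsilon> k) * ?D + (exp (of_real s * A \<epsilon> k) * A \<epsilon> k) * U (?t + s) k
          = - (E \<epsilon> k * CC \<epsilon> s (v s) (v s) k)"
          unfolding v_def[abs_def] CC_twist by (simp add: algebra_simps)
        ultimately show "((\<lambda>s. v s k) has_vector_derivative - (E \<epsilon> k * CC \<epsilon> s (v s) (v s) k)) (at s within {0..\<tau>})"
          by simp
      qed
      have "twisted_solution M \<epsilon> \<tau> v" using vb vd by (simp add: twisted_solution_def)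
      note lo = loc[OF e t(1) t1(1) this, unfolded v0]
      \<comment> \<open>The new error is the propagated old error plus the local error, and the
        unimodular factor in front leaves all norms unchanged.\<close>
      have eq: "(\<lambda>k. U (real (Suc m) * \<tau>) k - Y (Suc m) k) = (\<lambda>k. exp (of_real (- \<tau>) * A \<epsilon> k) *
         ((split_step \<epsilon> \<tau> (U ?t) k - split_step \<epsilon> \<tau> (Y m) k) + (v \<tau> k - split_step \<epsilon> \<tau> (U ?t) k)))"
      proof
        fix k
        have "exp (- (of_real \<tau> * A \<epsilon> k)) * v \<tau> k = U (real (Suc m) * \<tau>) k"
          by (simp add: v_def mult.assoc[symmetric] exp_add[symmetric] algebra_simps)
        then show "U (real (Suc m) * \<tau>) k - Y (Suc m) k = exp (of_real (- \<tau>) * A \<epsilon> k) *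
         ((split_step \<epsilon> \<tau> (U ?t) k - split_step \<epsilon> \<tau> (Y m) k) + (v \<tau> k - split_step \<epsilon> \<tau> (U ?t) k))"
          using Y by (simp add: algebra_simps)
      qed
      have "hbd (zz 2) (\<lambda>k. U (real (Suc m) * \<tau>) k - Y (Suc m) k)
         ((1 + K1 * \<tau>) * (C * \<tau> ^ 2 * real m * exp (K1 * ?t)) + C * \<tau> ^ 2)"
        unfolding eq by (intro hbd_mult_le1 hbd_add K1(2) e t t1 U3 Y2 IH1 conjunct1[OF lo]) (simp only: norm_exp_A order_refl)
      moreover have "hbd r (\<lambda>k. U (real (Suc m) * \<tau>) k - Y (Suc m) k)
         ((1 + K2 * \<tau>) * (C * \<epsilon> powr (1 - \<sigma>) * \<tau> ^ 5 * real m * exp (K2 * ?t)) + C * \<epsilon> powr (1 - \<sigma>) * \<tau> ^ 5)"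
        unfolding eq by (intro hbd_mult_le1 hbd_add K2(2) e t t1 U3 Y2 IH2 conjunct2[OF lo]) (simp only: norm_exp_A order_refl)
      ultimately show ?case
        using step[OF K1(1), of "C * \<tau> ^ 2" m] step[OF K2(1), of "C * \<epsilon> powr (1 - \<sigma>) * \<tau> ^ 5" m] C t
        by (auto intro: hbd_mono)
    qed
    have "C * \<epsilon> powr (1 - \<sigma>) * \<tau> ^ 5 * real n * exp (K2 * (real n * \<tau>))
      = C * \<epsilon> powr (1 - \<sigma>) * \<tau> ^ 4 * (real n * \<tau> * exp (K2 * (real n * \<tau>)))"
      by (simp add: eval_nat_numeral)
    also have "\<dots> \<le> C * \<epsilon> powr (1 - \<sigma>) * \<tau> ^ 4 * (T * exp (K2 * T))"
      using C t K2 by (intro mult_left_mono T_bound) auto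
    also have "\<dots> = \<epsilon> powr (1 - \<sigma>) * \<tau> ^ 4 * X2" by (simp add: X2_def)
    also have "\<dots> \<le> \<epsilon> powr (1 - \<sigma>) * \<tau> ^ 4 * (X2 + 1)" using t by (intro mult_left_mono) auto
    finally show ?thesis using main[of n] by (auto intro: hbd_mono)
  qed
  then show ?thesis using \<tau>0 X by (intro exI[of _ "X2 + 1"] exI[of _ \<tau>0]) auto
qed

end

section \<open>Integration over the torus\<close>

abbreviation torus :: "real measure" where "torus \<equiv> lebesgue_on {-pi..pi}"

lemma space_torus [simp]: "space torus = {-pi..pi}" by simp

lemma finite_measure_torus: "finite_measure torus"
  by (intro finite_measure_lebesgue_on) simp

lemma continuous_torus_measurable: "continuous_on UNIV f \<Longrightarrow> f \<in> borel_measurable torus" for f :: "real \<Rightarrow> complex"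
  by (rule continuous_imp_measurable_on_sets_lebesgue[OF continuous_on_subset]) auto

lemma integrable_mult_bounded:
  fixes g h :: "real \<Rightarrow> complex"
  assumes g: "integrable torus g" and h: "h \<in> borel_measurable torus" "\<And>x. x \<in> {-pi..pi} \<Longrightarrow> cmod (h x) \<le> B"
  shows "integrable torus (\<lambda>x. g x * h x)"
proof (rule Bochner_Integration.integrable_bound)
  show "integrable torus (\<lambda>x. B * norm (g x))" using g by simp
  show "(\<lambda>x. g x * h x) \<in> borel_measurable torus" using g h by (intro borel_measurable_times) auto
  show "AE x in torus. norm (g x * h x) \<le> norm (B * norm (g x))"
  proof (rule AE_I2)
    fix x assume "x \<in> space torus"
    then have "cmod (h x) \<le> B" using h by simp
    then have "cmod (h x) * cmod (g x) \<le> B * cmod (g x)" by (rule mult_right_mono) simp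
    then show "norm (g x * h x) \<le> norm (B * norm (g x))"
      by (simp add: norm_mult mult.commute)
  qed
qed

lemma fcoeff_altdef:
  "(LINT x|torus. f x * exp (\<i> * of_int k * of_real x)) = 2 * of_real pi * fcoeff f (- k)"
proof -
  have "2 * of_real pi * (1 / (2 * of_real pi)) = (1::complex)" by simp
  then show ?thesis
    by (simp only: fcoeff_def of_int_minus mult_minus_left mult_minus_right minus_minus mult.assoc[symmetric] mult_1_left)
qed

lemma exp_int_integral:
  "(LINT x|torus. exp (\<i> * of_int m * of_real x)) = (if m = 0 then 2 * of_real pi else 0)"
proof (cases "m = 0")
  case True
  then show ?thesis by (simp add: measure_restrict_space scaleR_conv_of_real)
next
  case False
  define F where "F x = exp (\<i> * of_int m * of_real x) / (\<i> * of_int m)" for x :: real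
  have c: "continuous_on {-pi..pi} (\<lambda>x. exp (\<i> * of_int m * complex_of_real x))"
    by (intro continuous_intros)
  have "(LINT x|torus. exp (\<i> * of_int m * of_real x)) = integral {-pi..pi} (\<lambda>x. exp (\<i> * of_int m * of_real x))"
    by (rule lebesgue_integral_eq_integral[OF continuous_imp_integrable_real[OF c]]) simp
  also have "\<dots> = F pi - F (-pi)"
  proof (rule integral_unique[OF fundamental_theorem_of_calculus])
    fix x :: real
    have "((\<lambda>z. exp (\<i> * of_int m * z) / (\<i> * of_int m)) has_field_derivative exp (\<i> * of_int m * of_real x)) (at (of_real x))"
      using False by (auto intro!: derivative_eq_intros)
    then show "(F has_vector_derivative exp (\<i> * of_int m * of_real x)) (at x within {-pi..pi})"
      unfolding F_def by (rule has_vector_derivative_real_field)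
  qed simp
  also have "\<dots> = 0"
  proof -
    have "exp (\<i> * of_int m * of_real pi) = exp (\<i> * of_int m * of_real (-pi) + of_int (2 * m) * of_real pi * \<i>)"
      by (simp add: algebra_simps)
    also have "\<dots> = exp (\<i> * of_int m * of_real (-pi))"
    proof -
      have "exp (complex_of_real (2 * of_int m * pi) * \<i>) = 1" using exp_integer_2pi[of "of_int m"] by simp
      then show ?thesis unfolding exp_add by simp
    qed
    finally show ?thesis by (simp add: F_def)
  qed
  finally show ?thesis using False by simp
qed

subsection \<open>Uniqueness of Fourier coefficients\<close>

inductive trig :: "(real \<Rightarrow> complex) \<Rightarrow> bool" where
  trig_exp: "trig (\<lambda>x. c * exp (\<i> * of_int k * of_real x))"
| trig_add: "trig f \<Longrightarrow> trig g \<Longrightarrow> trig (\<lambda>x. f x + g x)"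

lemma trig_mult: "trig f \<Longrightarrow> trig g \<Longrightarrow> trig (\<lambda>x. f x * g x)"
proof (induction rule: trig.induct)
  case (trig_exp c k)
  from trig_exp show ?case
  proof (induction rule: trig.induct)
    case (trig_exp d l)
    have "(\<lambda>x. (c * exp (\<i> * of_int k * complex_of_real x)) * (d * exp (\<i> * of_int l * of_real x)))
       = (\<lambda>x. (c * d) * exp (\<i> * of_int (k + l) * of_real x))"
      by (simp add: exp_add[symmetric] algebra_simps fun_eq_iff)
    then show ?case using trig.trig_exp[of "c * d" "k + l"] by simp
  next
    case (trig_add f g)
    then show ?case using trig.trig_add by (simp add: distrib_left)
  qed
next
  case (trig_add f1 f2)
  then show ?case using trig.trig_add by (simp add: distrib_right)
qed

lemma trig_const: "trig (\<lambda>x. c)"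
  using trig_exp[of c 0] by simp

text \<open>Trigonometric polynomials form an algebra, so only the real linear functionals of
  \<open>cis x\<close>, which are combinations of sine and cosine, need a computation.\<close>

lemma trig_real_polynomial: "real_polynomial_function q \<Longrightarrow> trig (\<lambda>x. of_real (q (cis x)))"
proof (induction rule: real_polynomial_function.induct)
  case (linear q)
  interpret bounded_linear q by fact
  have "complex_of_real (q (cis x)) = (of_real (q 1 / 2) * exp (\<i> * of_int 1 * of_real x) + of_real (q 1 / 2) * exp (\<i> * of_int (-1) * of_real x))
     + ((- \<i> * of_real (q \<i> / 2)) * exp (\<i> * of_int 1 * of_real x) + (\<i> * of_real (q \<i> / 2)) * exp (\<i> * of_int (-1) * of_real x))" for x
  proof -
    have "cis x = cos x *\<^sub>R 1 + sin x *\<^sub>R \<i>" by (simp add: complex_eq_iff)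
    then have "q (cis x) = cos x * q 1 + sin x * q \<i>" by (simp only: add scale) simp
    moreover have "exp (\<i> * of_int 1 * of_real x) = of_real (cos x) + \<i> * of_real (sin x)"
      by (simp add: exp_Euler cos_of_real sin_of_real)
    moreover have "exp (\<i> * of_int (-1) * of_real x) = of_real (cos x) - \<i> * of_real (sin x)"
      using exp_Euler[of "of_real (-x)"] by (simp add: cos_of_real sin_of_real)
    ultimately show ?thesis by (simp only:) (simp add: algebra_simps add_divide_distrib diff_divide_distrib)
  qed
  then show ?case by (simp only:) (intro trig_add trig_exp)
next
  case (const c)
  then show ?case by (rule trig_const)
next
  case (add f g)
  then show ?case using trig_add by simp
next
  case (mult f g)
  then show ?case using trig_mult by simp
qed

text \<open>Stone-Weierstrass on the unit circle. The function is carried there by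
  \<open>Arg\<close>, which jumps at -1. Continuity of the transported function is read off from
  preimages: those of closed sets are images of compact sets under \<open>cis\<close>.\<close>

lemma trig_approx:
  fixes h :: "real \<Rightarrow> complex"
  assumes h: "continuous_on {-pi..pi} h" "h (-pi) = h pi" and e: "0 < e"
  shows "\<exists>p. trig p \<and> (\<forall>x\<in>{-pi..pi}. cmod (h x - p x) < e)"
proof -
  define H where "H z = h (Arg z)" for z
  have Hcis: "H (cis x) = h x" if "x \<in> {-pi..pi}" for x
  proof (cases "x = -pi")
    case True
    \<comment> \<open>\<open>Arg\<close> takes the value \<open>pi\<close> at -1, so the equality of
      \<open>h\<close> at both end points is needed here.\<close>
    have "Arg (cis x) = pi" using True by (intro cis_Arg_unique) (auto simp: complex_eq_iff)
    then show ?thesis using True h by (simp add: H_def)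
  next
    case False
    then have "Arg (cis x) = x" using that by (intro cis_Arg_unique) auto
    then show ?thesis by (simp add: H_def)
  qed
  have "continuous_on (sphere 0 1) H"
    unfolding continuous_on_closed_vimage[OF closed_sphere]
  proof (intro allI impI)
    fix B :: "complex set" assume B: "closed B"
    have "H -` B \<inter> sphere 0 1 = cis ` (h -` B \<inter> {-pi..pi})"
    proof (intro set_eqI iffI)
      fix z assume z: "z \<in> H -` B \<inter> sphere 0 1"
      then have "z = cis (Arg z)" by (subst cis_Arg) (auto simp: sgn_div_norm)
      moreover have "Arg z \<in> {-pi..pi}" using Arg_bounded[of z] by simp
      ultimately show "z \<in> cis ` (h -` B \<inter> {-pi..pi})" using z by (auto simp: H_def)
    next
      fix z assume "z \<in> cis ` (h -` B \<inter> {-pi..pi})"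
      then show "z \<in> H -` B \<inter> sphere 0 1" using Hcis by auto
    qed
    moreover have "compact (h -` B \<inter> {-pi..pi})"
      using h(1) B unfolding continuous_on_closed_vimage[OF closed_atLeastAtMost]
      by (metis compact_Icc compact_Int_closed inf_commute inf_left_idem Int_assoc)
    ultimately show "closed (H -` B \<inter> sphere 0 1)"
      by (simp add: compact_continuous_image compact_imp_closed continuous_on_cis)
  qed
  from Stone_Weierstrass_polynomial_function[OF compact_sphere this e] obtain g where
    g: "polynomial_function g" "\<And>z. z \<in> sphere 0 1 \<Longrightarrow> norm (H z - g z) < e" by blast
  have "real_polynomial_function (Re \<circ> g)" "real_polynomial_function (Im \<circ> g)"
    using g(1) bounded_linear_Re bounded_linear_Im by (auto simp: polynomial_function_def)
  from trig_real_polynomial[OF this(1)] trig_real_polynomial[OF this(2)]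
  have "trig (\<lambda>x. of_real (Re (g (cis x))) + \<i> * of_real (Im (g (cis x))))"
    by (intro trig_add trig_mult trig_const) (simp_all add: o_def)
  then have "trig (\<lambda>x. g (cis x))" by (simp add: complex_eq[symmetric])
  moreover have "cmod (h x - g (cis x)) < e" if "x \<in> {-pi..pi}" for x
    using g(2)[of "cis x"] Hcis[OF that] by simp
  ultimately show ?thesis by blast
qed

lemma trig_continuous: "trig p \<Longrightarrow> continuous_on UNIV p"
  by (induction rule: trig.induct) (auto intro!: continuous_intros)

lemma fcoeff_zero_trig:
  assumes g: "integrable torus g" "\<And>k. fcoeff g k = 0" and p: "trig p"
  shows "integrable torus (\<lambda>x. g x * p x) \<and> (LINT x|torus. g x * p x) = 0"
  using p
proof (induction rule: trig.induct)
  case (trig_exp c k)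
  have i: "integrable torus (\<lambda>x. g x * exp (\<i> * of_int k * of_real x))"
    by (rule integrable_mult_bounded[OF g(1), of _ 1])
       (auto intro!: continuous_torus_measurable continuous_intros simp: norm_exp_eq_Re)
  have "(\<lambda>x. g x * (c * exp (\<i> * of_int k * complex_of_real x))) = (\<lambda>x. c * (g x * exp (\<i> * of_int k * of_real x)))"
    by (simp add: mult_ac)
  then show ?case using i fcoeff_altdef[of g k] g(2) by simp
next
  case (trig_add f h)
  then show ?case by (simp add: distrib_left)
qed

lemma fcoeff_zero_continuous:
  fixes h :: "real \<Rightarrow> complex"
  assumes g: "integrable torus g" "\<And>k. fcoeff g k = 0"
    and h: "continuous_on {-pi..pi} h" "h (-pi) = h pi"
  shows "(LINT x|torus. g x * h x) = 0"
proof -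
  have hm: "h \<in> borel_measurable torus"
    by (intro continuous_imp_measurable_on_sets_lebesgue h) simp
  have "compact (h ` {-pi..pi})" by (intro compact_continuous_image h) simp
  then have "\<exists>B. \<forall>x\<in>{-pi..pi}. cmod (h x) \<le> B"
    by (auto dest!: compact_imp_bounded simp: bounded_iff)
  then obtain B where B: "\<And>x. x \<in> {-pi..pi} \<Longrightarrow> cmod (h x) \<le> B" by blast
  have gh: "integrable torus (\<lambda>x. g x * h x)" by (rule integrable_mult_bounded[OF g(1) hm B])
  define N where "N = (LINT x|torus. cmod (g x))"
  have N: "0 \<le> N" unfolding N_def by simp
  have "cmod (LINT x|torus. g x * h x) \<le> e" if e: "0 < e" for e
  proof -
    \<comment> \<open>The summand 1 covers the case \<open>N = 0\<close>.\<close>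
    obtain p where p: "trig p" "\<And>x. x \<in> {-pi..pi} \<Longrightarrow> cmod (h x - p x) < e / (N + 1)"
      using trig_approx[OF h, of "e / (N + 1)"] e N by auto
    note gp = fcoeff_zero_trig[OF g p(1)]
    have "cmod (LINT x|torus. g x * h x) = cmod (LINT x|torus. g x * h x - g x * p x)"
      using gp gh by simp
    also have "\<dots> \<le> (LINT x|torus. cmod (g x * h x - g x * p x))"
      using gp gh by (intro integral_norm_bound) 
    also have "\<dots> \<le> (LINT x|torus. (e / (N + 1)) * cmod (g x))"
    proof (rule integral_mono)
      fix x assume "x \<in> space torus"
      then have "cmod (h x - p x) \<le> e / (N + 1)" using p(2)[of x] by simp
      then have "cmod (h x - p x) * cmod (g x) \<le> e / (N + 1) * cmod (g x)" by (rule mult_right_mono) simp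
      then show "cmod (g x * h x - g x * p x) \<le> e / (N + 1) * cmod (g x)"
        by (simp add: right_diff_distrib[symmetric] norm_mult mult.commute)
    qed (use gp gh g in auto)
    also have "\<dots> = e / (N + 1) * N" by (simp add: N_def)
    also have "\<dots> \<le> e" using e N by (simp add: field_simps)
    finally show ?thesis .
  qed
  then have "cmod (LINT x|torus. g x * h x) \<le> 0" by (rule field_le_epsilon[of _ 0, simplified])
  then show ?thesis by simp
qed

text \<open>Testing with \<open>cnj (sgn g)\<close>, which is an almost everywhere limit of continuous functions.\<close>

lemma fcoeff_zero_AE:
  assumes g: "integrable torus g" "\<And>k. fcoeff g k = 0"
  shows "AE x in torus. g x = 0"
proof -
  define s where "s x = cnj (sgn (g x))" for x
  have gs: "g x * s x = of_real (cmod (g x))" for x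
  proof (cases "g x = 0")
    case False
    have "g x * cnj (g x) = of_real (cmod (g x)) * of_real (cmod (g x))"
      by (simp add: complex_norm_square[symmetric] power2_eq_square)
    then show ?thesis using False by (simp add: s_def sgn_div_norm scaleR_conv_of_real field_simps)
  qed (simp add: s_def)
  have s1: "cmod (s x) \<le> 1" for x by (simp add: s_def norm_sgn)
  have "s \<in> borel_measurable torus"
  proof -
    have "(\<lambda>x. g x /\<^sub>R cmod (g x)) \<in> borel_measurable torus" using g(1) by measurable
    then show ?thesis unfolding s_def sgn_div_norm
      by (rule borel_measurable_continuous_on[rotated]) (intro continuous_intros)
  qed
  then have "s measurable_on {-pi..pi}"
    by (subst measurable_on_iff_borel_measurable) auto
  then obtain N c where N: "negligible N" and c: "\<And>n. continuous_on UNIV (c n)"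
    and lim: "\<And>x. x \<notin> N \<Longrightarrow> (\<lambda>n. c n x) \<longlonglongrightarrow> (if x \<in> {-pi..pi} then s x else 0)"
    unfolding measurable_on_def by blast
  \<comment> \<open>The denominator truncates \<open>c n\<close> to modulus at most 1, which gives
    the dominating function \<open>cmod (g x)\<close>. The factor
    \<open>min 1 (real n * (pi - \<bar>x\<bar>))\<close> vanishes at both end points, which makes
    \<open>h n\<close> periodic, and tends to 1 in between.\<close>
  define h where "h n x = of_real (min 1 (real n * (pi - \<bar>x\<bar>)) / max 1 (cmod (c n x))) * c n x" for n :: nat and x :: real
  have hc: "continuous_on S (h n)" for S n
    unfolding h_def by (intro continuous_intros continuous_on_subset[OF c]) (auto simp: max_def)
  have hb: "cmod (h n x) \<le> 1" if "x \<in> {-pi..pi}" for n x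
  proof -
    have "0 \<le> min 1 (real n * (pi - \<bar>x\<bar>))" "min 1 (real n * (pi - \<bar>x\<bar>)) \<le> 1" using that by auto
    moreover have "cmod (c n x) / max 1 (cmod (c n x)) \<le> 1" "0 \<le> cmod (c n x) / max 1 (cmod (c n x))"
      by (auto simp: divide_le_eq_1 max_def)
    ultimately have "min 1 (real n * (pi - \<bar>x\<bar>)) * (cmod (c n x) / max 1 (cmod (c n x))) \<le> 1"
      by (intro mult_le_one) auto
    moreover have "cmod (h n x) = min 1 (real n * (pi - \<bar>x\<bar>)) * (cmod (c n x) / max 1 (cmod (c n x)))"
    proof -
      have "0 \<le> min 1 (real n * (pi - \<bar>x\<bar>)) / max 1 (cmod (c n x))" using that by (intro divide_nonneg_pos) auto
      then show ?thesis unfolding h_def norm_mult norm_of_real by (simp only: abs_of_nonneg times_divide_eq_left times_divide_eq_right)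
    qed
    ultimately show ?thesis by simp
  qed
  have hl: "(\<lambda>n. h n x) \<longlonglongrightarrow> s x" if x: "x \<notin> N" "x \<in> {-pi<..<pi}" for x
  proof -
    have "x \<in> {-pi..pi}" using x(2) by simp
    then have cl: "(\<lambda>n. c n x) \<longlonglongrightarrow> s x" using lim[OF x(1)] by (simp only: if_True)
    have "filterlim (\<lambda>n. real n * (pi - \<bar>x\<bar>)) at_top sequentially"
      using x by (intro filterlim_at_top_mult_tendsto_pos[OF tendsto_const _ filterlim_real_sequentially]) auto
    then have "eventually (\<lambda>n. 1 \<le> real n * (pi - \<bar>x\<bar>)) sequentially" by (simp add: filterlim_at_top)
    then have "eventually (\<lambda>n. min 1 (real n * (pi - \<bar>x\<bar>)) = 1) sequentially" by eventually_elim simp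
    then have "(\<lambda>n. min 1 (real n * (pi - \<bar>x\<bar>))) \<longlonglongrightarrow> 1" by (rule tendsto_eventually)
    moreover have "(\<lambda>n. max 1 (cmod (c n x))) \<longlonglongrightarrow> max 1 (cmod (s x))"
      by (intro tendsto_intros cl)
    moreover have "max 1 (cmod (s x)) = 1" using s1 by simp
    ultimately have "(\<lambda>n. of_real (min 1 (real n * (pi - \<bar>x\<bar>)) / max 1 (cmod (c n x))) * c n x) \<longlonglongrightarrow> of_real (1 / 1) * s x"
      by (intro tendsto_intros cl) auto
    then show ?thesis by (simp add: h_def)
  qed
  have "negligible (N \<union> {-pi, pi})" using N by simp
  then have "N \<union> {-pi, pi} \<in> null_sets lebesgue" by (simp add: negligible_iff_null_sets)
  then have *: "AE x in lebesgue. x \<notin> N \<union> {-pi, pi}" by (rule AE_not_in)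
  have "AE x in lebesgue. x \<in> {-pi..pi} \<longrightarrow> (\<lambda>n. g x * h n x) \<longlonglongrightarrow> g x * s x"
    by (rule eventually_mono[OF *]) (auto intro!: tendsto_mult hl)
  then have AE: "AE x in torus. (\<lambda>n. g x * h n x) \<longlonglongrightarrow> g x * s x"
    by (subst AE_restrict_space_iff) auto
  have "(\<lambda>n. LINT x|torus. g x * h n x) \<longlonglongrightarrow> (LINT x|torus. g x * s x)"
  proof (rule integral_dominated_convergence[where w="\<lambda>x. cmod (g x)"])
    show "(\<lambda>x. g x * s x) \<in> borel_measurable torus" using g(1) \<open>s \<in> borel_measurable torus\<close> by (intro borel_measurable_times) auto
    show "(\<lambda>x. g x * h n x) \<in> borel_measurable torus" for n
      using g(1) continuous_torus_measurable[OF hc[of UNIV n]] by (intro borel_measurable_times) auto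
    show "AE x in torus. norm (g x * h n x) \<le> cmod (g x)" for n
      by (rule AE_I2) (use hb in \<open>auto simp: norm_mult intro!: mult_left_le\<close>)
  qed (use g AE in auto)
  moreover have "(LINT x|torus. g x * h n x) = 0" for n
    by (rule fcoeff_zero_continuous[OF g hc]) (simp add: h_def)
  ultimately have "(LINT x|torus. g x * s x) = 0" by (simp add: LIMSEQ_const_iff)
  then have "(LINT x|torus. cmod (g x)) = 0" unfolding gs integral_complex_of_real by simp
  then have "AE x in torus. cmod (g x) = 0"
    by (subst (asm) integral_nonneg_eq_0_iff_AE) (use g in auto)
  then show ?thesis by simp
qed

subsection \<open>Functions with absolutely convergent Fourier series\<close>

definition ser :: "seq \<Rightarrow> real \<Rightarrow> complex" where
  "ser a x = (\<Sum>\<^sub>\<infinity>k. a k * exp (\<i> * of_int k * of_real x))"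

abbreviation asum :: "seq \<Rightarrow> bool" where "asum a \<equiv> a summable_on UNIV"

abbreviation conv :: "seq \<Rightarrow> seq \<Rightarrow> seq" where
  "conv \<equiv> Bil (\<lambda>_ _. 1)"

lemma fmult_ser: "fmult m f = ser (\<lambda>k. m k * fcoeff f k)"
  by (simp add: fmult_def ser_def fun_eq_iff)

lemma norm_exp_ik [simp]: "cmod (exp (\<i> * of_int k * of_real x)) = 1"
  by (simp add: norm_exp_eq_Re)

lemma asum_abs: "asum a \<longleftrightarrow> (\<lambda>k. cmod (a k)) summable_on UNIV"
  by (rule summable_on_iff_abs_summable_on_complex)

lemma asum_dom: "asum a \<Longrightarrow> (\<And>k. cmod (b k) \<le> cmod (a k)) \<Longrightarrow> asum b"
  unfolding asum_abs by (rule summable_on_comparison_test) auto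

lemma asum_exp: "asum a \<Longrightarrow> asum (\<lambda>k. a k * exp (\<i> * of_int k * of_real x))"
  by (erule asum_dom) (simp add: norm_mult)

lemma ser_bound: "asum a \<Longrightarrow> cmod (ser a x) \<le> (\<Sum>\<^sub>\<infinity>k. cmod (a k))"
  unfolding ser_def asum_abs
  using norm_infsum_bound[of "\<lambda>k. a k * exp (\<i> * of_int k * of_real x)" UNIV] by (simp add: norm_mult)

lemma ser_add: "asum a \<Longrightarrow> asum b \<Longrightarrow> ser (\<lambda>k. a k + b k) x = ser a x + ser b x"
  unfolding ser_def distrib_right by (intro infsum_add asum_exp)

lemma ser_scale: "ser (\<lambda>k. c * a k) x = c * ser a x"
  unfolding ser_def mult.assoc by (rule infsum_cmult_right')

lemma ser_diff: "asum a \<Longrightarrow> asum b \<Longrightarrow> ser (\<lambda>k. a k - b k) x = ser a x - ser b x"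
  using ser_add[of a "\<lambda>k. (-1) * b k" x] ser_scale[of "-1" b x] summable_on_cmult_right[of b UNIV "-1"] by simp

text \<open>Enumerating the integers turns the sum into a series over \<open>nat\<close>, to which
  termwise integration applies.\<close>

lemma ser_suminf:
  assumes a: "asum a"
  shows "summable (\<lambda>n. cmod (a (int_decode n)))"
    and "(\<lambda>n. a (int_decode n) * exp (\<i> * of_int (int_decode n) * of_real x)) sums ser a x"
proof -
  have bij: "bij_betw int_decode UNIV UNIV" using bij_int_decode by simp
  show "summable (\<lambda>n. cmod (a (int_decode n)))"
    using a summable_on_reindex_bij_betw[OF bij, of "\<lambda>k. cmod (a k)"]
    by (intro summable_on_imp_summable) (simp add: asum_abs)
  have "((\<lambda>k. a k * exp (\<i> * of_int k * of_real x)) has_sum ser a x) UNIV"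
    unfolding ser_def using asum_exp[OF a] by (rule has_sum_infsum)
  then show "(\<lambda>n. a (int_decode n) * exp (\<i> * of_int (int_decode n) * of_real x)) sums ser a x"
    using has_sum_reindex_bij_betw[OF bij, of "\<lambda>k. a k * exp (\<i> * of_int k * of_real x)" "ser a x"]
    by (intro has_sum_imp_sums) simp
qed

lemma ser_integral:
  assumes a: "asum a"
  shows "integrable torus (\<lambda>x. ser a x * exp (- (\<i> * of_int k * of_real x)))" (is "integrable torus ?g")
    and "(LINT x|torus. ser a x * exp (- (\<i> * of_int k * of_real x))) = 2 * of_real pi * a k"
proof -
  interpret finite_measure torus by (rule finite_measure_torus)
  define f where "f n x = a (int_decode n) * exp (\<i> * of_int (int_decode n - k) * of_real x)" for n and x :: real
  have f_eq: "f n x = a (int_decode n) * exp (\<i> * of_int (int_decode n) * of_real x) * exp (- (\<i> * of_int k * of_real x))" for n x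
    by (simp add: f_def exp_diff exp_minus algebra_simps divide_inverse)
  have sums: "(\<lambda>n. f n x) sums (ser a x * exp (- (\<i> * of_int k * of_real x)))" for x
    unfolding f_eq by (rule sums_mult2[OF ser_suminf(2)[OF a]])
  have g: "?g = (\<lambda>x. \<Sum>n. f n x)" using sums_unique[OF sums] by simp
  have nf: "cmod (f n x) = cmod (a (int_decode n))" for n x
    by (simp only: f_def norm_mult norm_exp_ik mult_1_right)
  have i: "integrable torus (f n)" for n
    by (rule continuous_imp_integrable_real) (auto simp: f_def intro!: continuous_intros)
  have s1: "AE x in torus. summable (\<lambda>n. norm (f n x))"
    using ser_suminf(1)[OF a] by (simp add: nf)
  have s2: "summable (\<lambda>n. LINT x|torus. norm (f n x))"
    using summable_mult[OF ser_suminf(1)[OF a], of "measure torus (space torus)"] by (simp add: nf)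
  show "integrable torus ?g" unfolding g by (rule integrable_suminf[OF i s1 s2])
  have If: "(LINT x|torus. f n x) = (if n = int_encode k then 2 * of_real pi * a k else 0)" for n
  proof -
    have "(LINT x|torus. f n x) = a (int_decode n) * (LINT x|torus. exp (\<i> * of_int (int_decode n - k) * of_real x))"
      unfolding f_def by (rule integral_mult_right_zero)
    also have "\<dots> = (if n = int_encode k then 2 * of_real pi * a k else 0)"
      unfolding exp_int_integral by (auto simp: mult.commute)
    finally show ?thesis .
  qed
  have "(LINT x|torus. ?g x) = (\<Sum>n. LINT x|torus. f n x)"
    unfolding g by (rule integral_suminf[OF i s1 s2])
  also have "\<dots> = 2 * of_real pi * a k"
    unfolding If using sums_single[of "int_encode k" "\<lambda>_. 2 * of_real pi * a k"] by (simp add: sums_iff)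
  finally show "(LINT x|torus. ?g x) = 2 * of_real pi * a k" .
qed

lemma fcoeff_ser: "asum a \<Longrightarrow> fcoeff (ser a) = a"
  by (simp add: fun_eq_iff fcoeff_def ser_integral)

lemma ser_L2: assumes a: "asum a" shows "ser a \<in> L2_torus"
proof -
  interpret finite_measure torus by (rule finite_measure_torus)
  have m: "ser a \<in> borel_measurable torus"
    using ser_integral(1)[OF a, of 0] by simp
  moreover have "integrable torus (\<lambda>x. (cmod (ser a x))\<^sup>2)"
  proof (rule integrable_const_bound)
    show "AE x in torus. norm ((cmod (ser a x))\<^sup>2) \<le> (\<Sum>\<^sub>\<infinity>k. cmod (a k))\<^sup>2"
      using ser_bound[OF a] by (intro AE_I2) (simp add: power_mono)
  qed (use m in measurable)
  ultimately show ?thesis by (simp add: L2_torus_def)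
qed

text \<open>The Cauchy product: all pairs of terms are absolutely summable, and they are regrouped
  according to the total frequency \<open>k\<close>.\<close>

lemma asum_conv_ser_mult:
  assumes a: "asum a" and b: "asum b"
  shows "asum (conv a b)" and "ser a x * ser b x = ser (conv a b) x"
proof -
  have *: "asum (\<lambda>k. conv a b k * exp (\<i> * of_int k * of_real x)) \<and> ser a x * ser b x = ser (conv a b) x" for x
  proof -
    define A where "A k = a k * exp (\<i> * of_int k * of_real x)" for k
    define B where "B k = b k * exp (\<i> * of_int k * of_real x)" for k
    have A: "(\<lambda>k. cmod (A k)) summable_on UNIV" and B: "(\<lambda>k. cmod (B k)) summable_on UNIV"
      using asum_exp[OF a, of x] asum_exp[OF b, of x] by (simp_all add: A_def[abs_def] B_def[abs_def] asum_abs)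
    have "(\<lambda>z. norm (case z of (j, l) \<Rightarrow> A j * B l)) summable_on (UNIV \<times> UNIV)"
      unfolding Infinite_Sum.abs_summable_on_Sigma_iff
    proof (intro conjI ballI)
      show "(\<lambda>l. norm (case (j, l) of (j, l) \<Rightarrow> A j * B l)) summable_on UNIV" for j
        using summable_on_cmult_right[OF B, of "cmod (A j)"] by (simp add: norm_mult)
      show "(\<lambda>j. norm (\<Sum>\<^sub>\<infinity>l. norm (case (j, l) of (j, l) \<Rightarrow> A j * B l))) summable_on UNIV"
        using summable_on_cmult_left[OF A, of "\<Sum>\<^sub>\<infinity>l. cmod (B l)"]
        by (simp add: norm_mult infsum_cmult_right' infsum_nonneg)
    qed
    then have s: "(\<lambda>(j, l). A j * B l) summable_on (UNIV \<times> UNIV)" by (rule abs_summable_summable)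
    have bij: "bij_betw (\<lambda>(k, j). (j, k - j)) (UNIV \<times> UNIV) (UNIV \<times> (UNIV :: int set))"
      by (rule bij_betwI[of _ _ _ "\<lambda>(j, l). (j + l, j)"]) auto
    have eq: "(\<lambda>z. (\<lambda>(j, l). A j * B l) ((\<lambda>(k, j). (j, k - j)) z)) = (\<lambda>(k, j). A j * B (k - j))"
      by (auto simp: fun_eq_iff)
    have s': "(\<lambda>(k, j). A j * B (k - j)) summable_on (UNIV \<times> UNIV)"
      using s summable_on_reindex_bij_betw[OF bij, of "\<lambda>(j, l). A j * B l"] unfolding eq by simp
    have inner: "(\<Sum>\<^sub>\<infinity>j. A j * B (k - j)) = conv a b k * exp (\<i> * of_int k * of_real x)" for k
    proof -
      have "A j * B (k - j) = exp (\<i> * of_int k * of_real x) * (1 * a j * b (k - j))" for j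
      proof -
        have "exp (\<i> * of_int j * of_real x) * exp (\<i> * of_int (k - j) * of_real x) = exp (\<i> * of_int k * of_real x)"
          by (simp add: exp_add[symmetric] algebra_simps)
        then show ?thesis by (simp add: A_def B_def mult_ac)
      qed
      then show ?thesis by (simp only: infsum_cmult_right' Bil_def mult.commute)
    qed
    have "ser a x * ser b x = (\<Sum>\<^sub>\<infinity>j. A j * (\<Sum>\<^sub>\<infinity>l. B l))"
      unfolding infsum_cmult_left' by (simp add: ser_def A_def[abs_def] B_def[abs_def])
    also have "\<dots> = (\<Sum>\<^sub>\<infinity>j. \<Sum>\<^sub>\<infinity>l. A j * B l)" by (simp only: infsum_cmult_right')
    also have "\<dots> = (\<Sum>\<^sub>\<infinity>(j, l)\<in>UNIV \<times> UNIV. A j * B l)" by (rule infsum_Sigma'_banach[OF s])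
    also have "\<dots> = (\<Sum>\<^sub>\<infinity>(k, j)\<in>UNIV \<times> UNIV. A j * B (k - j))"
      using infsum_reindex_bij_betw[OF bij, of "\<lambda>(j, l). A j * B l"] unfolding eq by simp
    also have "\<dots> = (\<Sum>\<^sub>\<infinity>k. \<Sum>\<^sub>\<infinity>j. A j * B (k - j))" by (rule infsum_Sigma'_banach[OF s', symmetric])
    also have "\<dots> = ser (conv a b) x" unfolding inner ser_def ..
    finally show ?thesis using summable_on_Sigma_banach[OF s'] unfolding inner by simp
  qed
  \<comment> \<open>At \<open>x = 0\<close> all exponentials are 1, so the coefficients themselves
    are seen to be summable.\<close>
  from *[of 0] show "asum (conv a b)" by simp
  from *[of x] show "ser a x * ser b x = ser (conv a b) x" by simp
qed

lemma L2_measurable: "f \<in> L2_torus \<Longrightarrow> f \<in> borel_measurable torus" by (simp add: L2_torus_def)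

lemma L2_integrable: assumes f: "f \<in> L2_torus" shows "integrable torus f"
proof (rule Bochner_Integration.integrable_bound)
  interpret finite_measure torus by (rule finite_measure_torus)
  show "integrable torus (\<lambda>x. 1 + (cmod (f x))\<^sup>2)" using f by (simp add: L2_torus_def)
  show "AE x in torus. norm (f x) \<le> norm (1 + (cmod (f x))\<^sup>2)"
  proof (rule AE_I2)
    fix x
    have "0 \<le> (cmod (f x) - 1)\<^sup>2" "0 \<le> cmod (f x)" by simp_all
    then have "cmod (f x) \<le> 1 + (cmod (f x))\<^sup>2" unfolding power2_diff power_one mult_1_right by linarith
    then show "norm (f x) \<le> norm (1 + (cmod (f x))\<^sup>2)" by simp
  qed
qed (use f in \<open>simp add: L2_torus_def\<close>)

lemma L2_scale: "f \<in> L2_torus \<Longrightarrow> (\<lambda>x. c * f x) \<in> L2_torus"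
  by (auto simp: L2_torus_def norm_mult power_mult_distrib)

lemma L2_add: assumes f: "f \<in> L2_torus" and g: "g \<in> L2_torus" shows "(\<lambda>x. f x + g x) \<in> L2_torus"
proof -
  have m: "(\<lambda>x. f x + g x) \<in> borel_measurable torus" using f g by (intro borel_measurable_add L2_measurable)
  have "integrable torus (\<lambda>x. (cmod (f x + g x))\<^sup>2)"
  proof (rule Bochner_Integration.integrable_bound)
    show "integrable torus (\<lambda>x. 2 * (cmod (f x))\<^sup>2 + 2 * (cmod (g x))\<^sup>2)" using f g by (simp add: L2_torus_def)
    show "AE x in torus. norm ((cmod (f x + g x))\<^sup>2) \<le> norm (2 * (cmod (f x))\<^sup>2 + 2 * (cmod (g x))\<^sup>2)"
    proof (rule AE_I2)
      fix x
      have "(cmod (f x + g x))\<^sup>2 \<le> (cmod (f x) + cmod (g x))\<^sup>2" by (intro power_mono norm_triangle_ineq) auto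
      also have "\<dots> \<le> 2 * (cmod (f x))\<^sup>2 + 2 * (cmod (g x))\<^sup>2"
        using zero_le_power2[of "cmod (f x) - cmod (g x)"] by (simp add: power2_eq_square algebra_simps)
      finally show "norm ((cmod (f x + g x))\<^sup>2) \<le> norm (2 * (cmod (f x))\<^sup>2 + 2 * (cmod (g x))\<^sup>2)" by simp
    qed
  qed (use m in measurable)
  with m show ?thesis by (simp add: L2_torus_def)
qed

lemma L2_diff: "f \<in> L2_torus \<Longrightarrow> g \<in> L2_torus \<Longrightarrow> (\<lambda>x. f x - g x) \<in> L2_torus"
  using L2_add[of f "\<lambda>x. (-1) * g x"] L2_scale[of g "-1"] by simp

lemma integrable_exp:
  assumes "integrable torus f" shows "integrable torus (\<lambda>x. f x * exp (- (\<i> * of_int k * of_real x)))"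
  by (rule integrable_mult_bounded[OF assms, of _ 1])
     (auto intro!: continuous_torus_measurable continuous_intros simp: norm_exp_eq_Re)

lemma fcoeff_add: "integrable torus f \<Longrightarrow> integrable torus g \<Longrightarrow> fcoeff (\<lambda>x. f x + g x) k = fcoeff f k + fcoeff g k"
  using integrable_exp[of f k] integrable_exp[of g k] by (simp add: fcoeff_def distrib_right distrib_left)

lemma fcoeff_scale: "fcoeff (\<lambda>x. c * f x) k = c * fcoeff f k"
  by (simp add: fcoeff_def mult.assoc)

lemma fcoeff_diff: "integrable torus f \<Longrightarrow> integrable torus g \<Longrightarrow> fcoeff (\<lambda>x. f x - g x) k = fcoeff f k - fcoeff g k"
  using integrable_exp[of f k] integrable_exp[of g k] by (simp add: fcoeff_def left_diff_distrib right_diff_distrib)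

lemma AE_ser:
  assumes f: "f \<in> L2_torus" and a: "asum (fcoeff f)"
  shows "AE x in torus. f x = ser (fcoeff f) x"
proof -
  note i1 = L2_integrable[OF f] and i2 = L2_integrable[OF ser_L2[OF a]]
  have "AE x in torus. f x - ser (fcoeff f) x = 0"
    by (rule fcoeff_zero_AE) (use i1 i2 in \<open>simp_all add: fcoeff_diff fcoeff_ser[OF a]\<close>)
  then show ?thesis by simp
qed

text \<open>The solution agrees with its Fourier series almost everywhere only. The uniqueness
  theorem enters here, to replace it by the series under the integral.\<close>

lemma fcoeff_square:
  assumes f: "f \<in> L2_torus" and a: "asum (fcoeff f)"
  shows "fcoeff (\<lambda>x. (f x)\<^sup>2) = conv (fcoeff f) (fcoeff f)"
proof
  fix k
  let ?s = "ser (fcoeff f)"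
  have "(LINT x|torus. (f x)\<^sup>2 * exp (- (\<i> * of_int k * of_real x)))
      = (LINT x|torus. ?s x * ?s x * exp (- (\<i> * of_int k * of_real x)))"
  proof (rule integral_cong_AE)
    have e: "(\<lambda>x. exp (- (\<i> * of_int k * complex_of_real x))) \<in> borel_measurable torus"
      by (intro continuous_torus_measurable continuous_intros)
    show "(\<lambda>x. (f x)\<^sup>2 * exp (- (\<i> * of_int k * complex_of_real x))) \<in> borel_measurable torus"
      using L2_measurable[OF f] e by (intro borel_measurable_times borel_measurable_power)
    show "(\<lambda>x. ?s x * ?s x * exp (- (\<i> * of_int k * complex_of_real x))) \<in> borel_measurable torus"
      using L2_measurable[OF ser_L2[OF a]] e by (intro borel_measurable_times)
    show "AE x in torus. (f x)\<^sup>2 * exp (- (\<i> * of_int k * complex_of_real x)) = ?s x * ?s x * exp (- (\<i> * of_int k * complex_of_real x))"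
      using AE_ser[OF f a] by eventually_elim (simp add: power2_eq_square)
  qed
  then have "fcoeff (\<lambda>x. (f x)\<^sup>2) k = fcoeff (\<lambda>x. ?s x * ?s x) k"
    by (simp only: fcoeff_def)
  also have "\<dots> = conv (fcoeff f) (fcoeff f) k"
    using asum_conv_ser_mult[OF a a] by (simp add: fcoeff_ser)
  finally show "fcoeff (\<lambda>x. (f x)\<^sup>2) k = conv (fcoeff f) (fcoeff f) k" .
qed

lemma hbd_asum: assumes h: "hbd a f C" and a: "1 \<le> a" shows "asum f"
  unfolding asum_abs
proof (rule nonneg_bdd_above_summable_on)
  show "bdd_above (sum (\<lambda>k. cmod (f k)) ` {J. J \<subseteq> UNIV \<and> finite J})"
  proof (rule bdd_aboveI2)
    fix J :: "int set" assume "J \<in> {J. J \<subseteq> UNIV \<and> finite J}"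
    then have J: "finite J" by simp
    have "hbd 1 f C" by (rule hbd_weaken[OF h a])
    then have b: "L2_set (\<lambda>k. jb k * cmod (f k)) K \<le> C" if "finite K" for K
      using hbdD[OF _ that, of 1 f C] by simp
    have "(\<Sum>k\<in>J. cmod (f k)) = (\<Sum>k\<in>J. (jb k * cmod (f k)) / jb k)" by simp
    also have "\<dots> \<le> sqrt zeta2 * C" by (rule weighted_l1_bound[OF _ b J]) auto
    finally show "(\<Sum>k\<in>J. cmod (f k)) \<le> sqrt zeta2 * C" .
  qed
qed simp

lemma jb_square: "(jb k powr s * x)\<^sup>2 = (1 + \<bar>of_int k\<bar>) powr (2 * s) * x\<^sup>2"
  by (simp add: power_mult_distrib jb_def powr_power mult.commute)

lemma Hs_hbd: assumes f: "f \<in> Hs s" shows "hbd s (fcoeff f) (Hs_norm s f)"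
  unfolding hbd_def L2_set_def Hs_norm_def jb_square
  using f by (auto intro!: real_sqrt_le_mono finite_sum_le_infsum simp: Hs_def)

lemma hbd_summable:
  assumes "hbd s a C"
  shows "(\<lambda>k. (1 + \<bar>of_int k\<bar>) powr (2 * s) * (cmod (a k))\<^sup>2) summable_on UNIV"
    and "(\<Sum>\<^sub>\<infinity>k. (1 + \<bar>of_int k\<bar>) powr (2 * s) * (cmod (a k))\<^sup>2) \<le> C\<^sup>2"
proof -
  have b: "(\<Sum>k\<in>K. (1 + \<bar>of_int k\<bar>) powr (2 * s) * (cmod (a k))\<^sup>2) \<le> C\<^sup>2" if "finite K" for K
    using hbdD[OF assms that] hbd_nonneg[OF assms] unfolding L2_set_def jb_square
    by (simp add: sqrt_le_D)
  show s: "(\<lambda>k. (1 + \<bar>of_int k\<bar>) powr (2 * s) * (cmod (a k))\<^sup>2) summable_on UNIV"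
    by (rule nonneg_bdd_above_summable_on) (auto intro!: bdd_aboveI2 b)
  show "(\<Sum>\<^sub>\<infinity>k. (1 + \<bar>of_int k\<bar>) powr (2 * s) * (cmod (a k))\<^sup>2) \<le> C\<^sup>2"
    by (rule infsum_le_finite_sums[OF s]) (rule b)
qed

lemma hbd_Hs:
  assumes "f \<in> L2_torus" "hbd s (fcoeff f) C"
  shows "f \<in> Hs s" "Hs_norm s f \<le> C"
  using assms(1) hbd_summable[OF assms(2)] hbd_nonneg[OF assms(2)]
  by (auto simp: Hs_def Hs_norm_def real_le_lsqrt intro: real_le_lsqrt infsum_nonneg)

text \<open>The hypothesis supplies summability, without which \<open>Hs_norm\<close> could be the
  default value 0.\<close>

lemma fcoeff_le_Hs_norm:
  assumes "hbd 0 (fcoeff f) C" shows "cmod (fcoeff f k) \<le> Hs_norm 0 f"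
proof -
  have "(\<Sum>k\<in>{k}. (1 + \<bar>of_int k\<bar>) powr (2 * 0) * (cmod (fcoeff f k))\<^sup>2)
     \<le> (\<Sum>\<^sub>\<infinity>k. (1 + \<bar>of_int k\<bar>) powr (2 * 0) * (cmod (fcoeff f k))\<^sup>2)"
    by (intro finite_sum_le_infsum hbd_summable[OF assms]) auto
  then have "(cmod (fcoeff f k))\<^sup>2 \<le> (\<Sum>\<^sub>\<infinity>k. (1 + \<bar>of_int k\<bar>) powr (2 * 0) * (cmod (fcoeff f k))\<^sup>2)"
    unfolding jb_def[symmetric] by simp
  then show ?thesis unfolding Hs_norm_def by (rule real_le_rsqrt)
qed

subsection \<open>From functions to coefficients\<close>

text \<open>Every term with \<open>h ^ n\<close> contains exactly \<open>n\<close> products, so a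
  scalar can be moved from \<open>h\<close> into \<open>M\<close>.\<close>

lemma taylor_flow_scale:
  assumes l: "\<And>c f g. M (\<lambda>k. c * f k) g = (\<lambda>k. c * M f g k)" and r: "\<And>c f g. M f (\<lambda>k. c * g k) = (\<lambda>k. c * M f g k)"
  shows "taylor_flow M (h * z) f = taylor_flow (\<lambda>f g k. z * M f g k) h f"
  unfolding taylor_flow_def Let_def l r by (simp add: fun_eq_iff power_mult_distrib algebra_simps eval_nat_numeral)

text \<open>If a multiplier intertwines two products, it intertwines all polynomials formed with
  them. This moves linear flows past nonlinear ones.\<close>

lemma taylor_flow_twist:
  assumes "\<And>f g. M0 (\<lambda>k. m k * f k) (\<lambda>k. m k * g k) = (\<lambda>k. m k * M f g k)"
  shows "taylor_flow M0 h (\<lambda>k. m k * f k) = (\<lambda>k. m k * taylor_flow M h f k)"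
  unfolding taylor_flow_def Let_def assms by (simp add: fun_eq_iff algebra_simps)

context gbbm begin

lemma zz0: "zz 0 = r + 1 + 4 * real lam - 2 * \<sigma>"
  by (simp add: zz_def)

lemma zz0_ge: "1 + real lam \<le> zz 0" "1 \<le> zz 0"
proof -
  have "1 \<le> real lam" using lam by simp
  then show "1 + real lam \<le> zz 0" "1 \<le> zz 0" using r \<sigma> by (simp_all add: zz_def)
qed

lemma CC0: "CC \<epsilon> 0 = conv" by (simp add: CC_def)

lemma L_eps_P_ser: "L_eps_P P \<epsilon> f = ser (\<lambda>k. A \<epsilon> k * fcoeff f k)"
  by (simp add: L_eps_P_def fmult_ser A_def)

lemma L_eps_ser: "of_real \<epsilon> * L_eps \<epsilon> f x = ser (\<lambda>k. E \<epsilon> k * fcoeff f k) x"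
  unfolding L_eps_def fmult_ser ser_scale[symmetric] by (simp add: E_def mult.assoc)

lemma Psi2_ser: "Psi2 P \<epsilon> t f = ser (\<lambda>k. exp (of_real (- t) * A \<epsilon> k) * fcoeff f k)"
  by (simp add: Psi2_def exp_L_eps_P_def fmult_ser A_def)

text \<open>A single coefficient is bounded by the norm in which \<open>gBBM_solution\<close> takes
  its limit, so the difference quotients converge for each frequency. Regularity
  \<open>1 + lam\<close> leaves weight one after the application of \<open>A\<close>; hence the
  series in \<open>L_eps_P\<close> converges absolutely and its coefficients can be read
  off.\<close>

lemma fcoeff_ode:
  assumes e: "0 < \<epsilon>" "\<epsilon> \<le> 1" and u: "in_C_Hs T (zz 0) u" and sol: "gBBM_solution P \<epsilon> T u"
    and t: "t \<in> {0..T}"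
  shows "((\<lambda>t. fcoeff (u t) k) has_vector_derivative
        - (A \<epsilon> k * fcoeff (u t) k) - E \<epsilon> k * CC \<epsilon> 0 (fcoeff (u t)) (fcoeff (u t)) k) (at t within {0..T})"
proof -
  have uH: "u t \<in> Hs (zz 0)" if "t \<in> {0..T}" for t using u that by (simp add: in_C_Hs_def)
  have uL: "u t \<in> L2_torus" if "t \<in> {0..T}" for t using uH[OF that] by (simp add: Hs_def)
  note hb = Hs_hbd[OF uH]
  define a where "a t = fcoeff (u t)" for t
  have as: "asum (a t)" unfolding a_def by (rule hbd_asum[OF hb[OF t] zz0_ge(2)])
  obtain C where C: "C \<ge> 0" "\<And>k. cmod (A \<epsilon> k) \<le> C * jb k ^ lam" using A_bound e by blast
  have h1: "hbd 1 (\<lambda>k. A \<epsilon> k * a t k) (C * Hs_norm (zz 0) (u t))"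
  proof (rule hbd_dom[OF hb[OF t] C(1)])
    fix k
    have "jb k powr 1 * cmod (A \<epsilon> k * a t k) \<le> jb k powr 1 * ((C * jb k ^ lam) * cmod (a t k))"
      unfolding norm_mult by (intro mult_left_mono mult_right_mono C) auto
    also have "\<dots> = C * (jb k powr (1 + real lam) * cmod (a t k))"
      by (simp add: powr_add powr_realpow)
    also have "\<dots> \<le> C * (jb k powr zz 0 * cmod (a t k))"
      by (intro mult_left_mono mult_right_mono jb_powr_mono zz0_ge C) auto
    finally show "jb k powr 1 * cmod (A \<epsilon> k * a t k) \<le> C * (jb k powr zz 0 * cmod (fcoeff (u t) k))"
      by (simp add: a_def)
  qed
  have "hbd (zz 0) (CC \<epsilon> 0 (a t) (a t)) (bilc (zz 0) * Hs_norm (zz 0) (u t) * Hs_norm (zz 0) (u t))"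
    using CC_bound(2)[OF hb[OF t] hb[OF t] e(1), of "zz 0"] zz0_ge(2) by (simp add: a_def)
  then have "hbd (zz 0) (\<lambda>k. E \<epsilon> k * conv (a t) (a t) k) (bilc (zz 0) * Hs_norm (zz 0) (u t) * Hs_norm (zz 0) (u t))"
    unfolding CC0 by (rule hbd_mult_le1) (intro E_le1 e)
  note h2 = hbd_weaken[OF this zz0_ge(2)]
  note as1 = hbd_asum[OF h1 order_refl] and as2 = hbd_asum[OF h2 order_refl]
  define Q where "Q t' x = (u t' x - u t x) / of_real (t' - t)
     + L_eps_P P \<epsilon> (u t) x + of_real \<epsilon> * L_eps \<epsilon> (\<lambda>y. (u t y)\<^sup>2) x" for t' x
  define D where "D = - (A \<epsilon> k * a t k) - E \<epsilon> k * CC \<epsilon> 0 (a t) (a t) k"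
  have Q_eq: "Q t' = (\<lambda>x. (1 / of_real (t' - t)) * (u t' x - u t x) + ser (\<lambda>k. A \<epsilon> k * a t k) x
       + ser (\<lambda>k. E \<epsilon> k * conv (a t) (a t) k) x)" for t'
    unfolding Q_def L_eps_P_ser L_eps_ser fcoeff_square[OF uL[OF t] as[unfolded a_def]] a_def by simp
  have Qk: "fcoeff (Q t') k = (1 / of_real (t' - t)) * (a t' k - a t k) + A \<epsilon> k * a t k + E \<epsilon> k * conv (a t) (a t) k"
    if t': "t' \<in> {0..T}" for t' k
  proof -
    have i: "integrable torus (u t')" "integrable torus (u t)" "integrable torus (ser (\<lambda>k. A \<epsilon> k * a t k))"
      "integrable torus (ser (\<lambda>k. E \<epsilon> k * conv (a t) (a t) k))"
      by (intro L2_integrable uL t t' ser_L2 as1 as2)+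
    have i2: "integrable torus (\<lambda>x. (1 / of_real (t' - t)) * (u t' x - u t x))" using i by simp
    have "fcoeff (Q t') k = fcoeff (\<lambda>x. (1 / of_real (t' - t)) * (u t' x - u t x)) k
        + fcoeff (ser (\<lambda>k. A \<epsilon> k * a t k)) k + fcoeff (ser (\<lambda>k. E \<epsilon> k * conv (a t) (a t) k)) k"
      unfolding Q_eq using i i2
      by (subst fcoeff_add, simp, simp, subst fcoeff_add, simp, simp, simp)
    also have "\<dots> = (1 / of_real (t' - t)) * (a t' k - a t k) + A \<epsilon> k * a t k + E \<epsilon> k * conv (a t) (a t) k"
      by (simp only: fcoeff_scale fcoeff_diff[OF i(1,2)] fcoeff_ser[OF as1] fcoeff_ser[OF as2]) (simp add: a_def)
    finally show ?thesis .
  qed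
  have Qb: "cmod ((1 / of_real (t' - t)) * (a t' k - a t k) - D) \<le> Hs_norm 0 (Q t')" if t': "t' \<in> {0..T}" for t'
  proof -
    \<comment> \<open>This bound degenerates as \<open>t'\<close> approaches \<open>t\<close>, but
      it serves only as the finiteness condition in \<open>fcoeff_le_Hs_norm\<close>.\<close>
    have "hbd 0 (\<lambda>k. (1 / of_real (t' - t)) * (a t' k - a t k)) (cmod (1 / of_real (t' - t)) * (Hs_norm (zz 0) (u t') + Hs_norm (zz 0) (u t)))"
      unfolding a_def using zz0_ge by (intro hbd_scale hbd_diff hbd_weaken[OF hb] t t') auto
    from hbd_add[OF hbd_add[OF this hbd_weaken[OF h1, of 0]] hbd_weaken[OF h2, of 0]]
    have "hbd 0 (fcoeff (Q t')) (cmod (1 / of_real (t' - t)) * (Hs_norm (zz 0) (u t') + Hs_norm (zz 0) (u t))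
       + C * Hs_norm (zz 0) (u t) + bilc (zz 0) * Hs_norm (zz 0) (u t) * Hs_norm (zz 0) (u t))"
      using Qk[OF t', abs_def] by simp
    from fcoeff_le_Hs_norm[OF this, of k] show ?thesis
      unfolding Qk[OF t'] D_def CC0 by (simp add: algebra_simps)
  qed
  have "((\<lambda>t'. Hs_norm 0 (Q t')) \<longlongrightarrow> 0) (at t within {0..T})"
    using sol t unfolding gBBM_solution_def Q_def by simp
  then have "((\<lambda>t'. (1 / of_real (t' - t)) * (a t' k - a t k) - D) \<longlongrightarrow> 0) (at t within {0..T})"
    by (rule Lim_null_comparison[rotated]) (unfold eventually_at_filter, rule always_eventually, use Qb in blast)
  then have lim: "((\<lambda>t'. norm ((1 / of_real (t' - t)) * (a t' k - a t k) - D)) \<longlongrightarrow> 0) (at t within {0..T})"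
    by (rule tendsto_norm_zero)
  have "((\<lambda>t. a t k) has_vector_derivative D) (at t within {0..T})"
    unfolding has_vector_derivative_def has_derivative_within
  proof (intro conjI)
    show "bounded_linear (\<lambda>x. x *\<^sub>R D)" by (rule bounded_linear_scaleR_left)
    have eq: "norm ((1 / norm (y - t)) *\<^sub>R (a y k - (a t k + (y - t) *\<^sub>R D)))
        = norm ((1 / of_real (y - t)) * (a y k - a t k) - D)" if "y \<noteq> t" for y
    proof -
      have "(1 / of_real (y - t)) * (a y k - a t k) - D = (1 / of_real (y - t)) * (a y k - (a t k + (y - t) *\<^sub>R D))"
        using that by (simp add: scaleR_conv_of_real field_simps)
      then show ?thesis by (simp add: norm_mult norm_divide del: of_real_diff)
    qed
    have "((\<lambda>y. norm ((1 / norm (y - t)) *\<^sub>R (a y k - (a t k + (y - t) *\<^sub>R D)))) \<longlongrightarrow> 0) (at t within {0..T})"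
      by (rule Lim_transform_eventually[OF lim])
         (unfold eventually_at_filter, rule always_eventually, use eq in auto)
    then show "((\<lambda>y. (1 / norm (y - t)) *\<^sub>R (a y k - (a t k + (y - t) *\<^sub>R D))) \<longlongrightarrow> 0) (at t within {0..T})"
      by (rule tendsto_norm_zero_cancel)
  qed
  then show ?thesis by (simp add: a_def D_def)
qed

text \<open>A qualitative version of \<open>zz 2\<close> without constants. It guarantees that all
  Fourier series occurring in a step converge absolutely.\<close>

definition Hr :: "seq \<Rightarrow> bool" where "Hr a \<longleftrightarrow> (\<exists>C. hbd (zz 2) a C)"

definition LL :: "real \<Rightarrow> seq \<Rightarrow> seq \<Rightarrow> seq" where
  "LL \<epsilon> f g k = (\<i> * of_int k / (1 + of_real \<epsilon> * (of_int k)\<^sup>2)) * conv f g k"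

lemma Hr_asum: "Hr a \<Longrightarrow> asum a"
  using hbd_asum rho(1) by (auto simp: Hr_def)

lemma Hr_add: "Hr a \<Longrightarrow> Hr b \<Longrightarrow> Hr (\<lambda>k. a k + b k)"
  unfolding Hr_def using hbd_add by blast

lemma Hr_diff: "Hr a \<Longrightarrow> Hr b \<Longrightarrow> Hr (\<lambda>k. a k - b k)"
  unfolding Hr_def using hbd_diff by blast

lemma Hr_scale: "Hr a \<Longrightarrow> Hr (\<lambda>k. c * a k)"
  unfolding Hr_def using hbd_scale by blast

lemma Hr_twist: "Hr a \<Longrightarrow> Hr (\<lambda>k. exp (of_real t * A \<epsilon> k) * a k)"
  unfolding Hr_def using hbd_mult_le1[of "zz 2" a _ "\<lambda>k. exp (of_real t * A \<epsilon> k)"] by auto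

lemma LL_E: "0 < \<epsilon> \<Longrightarrow> LL \<epsilon> f g = (\<lambda>k. (1 / of_real \<epsilon>) * (E \<epsilon> k * CC \<epsilon> 0 f g k))"
  by (simp add: LL_def E_def CC0 fun_eq_iff)

lemma Hr_LL: assumes e: "0 < \<epsilon>" "\<epsilon> \<le> 1" and a: "Hr a" "Hr b" shows "Hr (LL \<epsilon> a b)"
proof -
  from a obtain C D where h: "hbd (zz 2) a C" "hbd (zz 2) b D" by (auto simp: Hr_def)
  have "hbd (zz 2) (CC \<epsilon> 0 a b) (bilc (zz 2) * C * D)"
    using CC_bound(2)[OF h e(1), of "zz 2"] rho(1) by simp
  then have "hbd (zz 2) (\<lambda>k. E \<epsilon> k * CC \<epsilon> 0 a b k) (bilc (zz 2) * C * D)"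
    by (rule hbd_mult_le1) (rule E_le1[OF e])
  then have "Hr (\<lambda>k. E \<epsilon> k * CC \<epsilon> 0 a b k)" unfolding Hr_def by blast
  then show ?thesis unfolding LL_E[OF e(1)] by (rule Hr_scale)
qed

lemma L_eps_mult:
  assumes "Hr a" "Hr b" shows "L_eps \<epsilon> (\<lambda>x. ser a x * ser b x) = ser (LL \<epsilon> a b)"
proof -
  note as = Hr_asum[OF assms(1)] Hr_asum[OF assms(2)]
  have "(\<lambda>x. ser a x * ser b x) = ser (conv a b)" by (simp add: fun_eq_iff asum_conv_ser_mult[OF as])
  then show ?thesis
    by (simp add: L_eps_def fmult_ser fcoeff_ser asum_conv_ser_mult(1)[OF as] LL_def[abs_def])
qed

lemma Psi1_ser:
  assumes e: "0 < \<epsilon>" "\<epsilon> \<le> 1" and a: "Hr a"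
  shows "Psi1 \<epsilon> t (ser a) = ser (taylor_flow (LL \<epsilon>) (of_real (t * \<epsilon>)) a)" and "Hr (taylor_flow (LL \<epsilon>) (of_real (t * \<epsilon>)) a)"
proof -
  define h where "h = complex_of_real (t * \<epsilon>)"
  define p where "p = LL \<epsilon> a a"
  define q where "q = LL \<epsilon> a p"
  define u where "u = LL \<epsilon> p p"
  define v where "v = LL \<epsilon> a q"
  note HL = Hr_LL[OF e]
  have p: "Hr p" unfolding p_def by (intro HL a)
  have q: "Hr q" unfolding q_def by (intro HL a p)
  have u: "Hr u" unfolding u_def by (intro HL p)
  have v: "Hr v" unfolding v_def by (intro HL a q)
  note L = L_eps_mult[where \<epsilon>=\<epsilon>]
  have T: "taylor_flow (LL \<epsilon>) h a = (\<lambda>k. a k - h * p k + h ^ 2 * q k - ((1/3) * h ^ 3) * u k - ((2/3) * h ^ 3) * v k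
        + ((1/2) * h ^ 4) * LL \<epsilon> p q k + ((1/6) * h ^ 4) * LL \<epsilon> a u k + ((1/3) * h ^ 4) * LL \<epsilon> a v k)"
    by (simp add: taylor_flow_def Let_def p_def q_def u_def v_def)
  show "Hr (taylor_flow (LL \<epsilon>) (of_real (t * \<epsilon>)) a)"
    unfolding h_def[symmetric] T by (intro Hr_add Hr_diff Hr_scale a p q u v HL)
  have "Psi1 \<epsilon> t (ser a) x = ser a x - h * ser p x + h ^ 2 * ser q x - ((1/3) * h ^ 3) * ser u x - ((2/3) * h ^ 3) * ser v x
        + ((1/2) * h ^ 4) * ser (LL \<epsilon> p q) x + ((1/6) * h ^ 4) * ser (LL \<epsilon> a u) x + ((1/3) * h ^ 4) * ser (LL \<epsilon> a v) x" for x
    unfolding Psi1_def Let_def power2_eq_square[of "ser a _"] h_def[symmetric] L[OF a a, folded p_def]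
      power2_eq_square[of "ser p _"] L[OF a p, folded q_def] L[OF p p, folded u_def] L[OF a q, folded v_def]
      L[OF p q] L[OF a u] L[OF a v] ..
  also have "\<dots> x = ser (taylor_flow (LL \<epsilon>) h a) x" for x
    unfolding T
    by (simp only: ser_add ser_diff ser_scale Hr_asum Hr_add Hr_diff Hr_scale a p q u v HL)
  finally show "Psi1 \<epsilon> t (ser a) = ser (taylor_flow (LL \<epsilon>) (of_real (t * \<epsilon>)) a)" by (simp add: fun_eq_iff h_def)
qed

lemma taylor_flow_LL_MM:
  assumes e: "0 < \<epsilon>"
  shows "taylor_flow (LL \<epsilon>) (of_real (c * \<tau> * \<epsilon>)) a = taylor_flow (MM \<epsilon> \<tau> 0) (of_real c) a"
proof -
  have "taylor_flow (LL \<epsilon>) (of_real c * of_real (\<tau> * \<epsilon>)) a = taylor_flow (\<lambda>f g k. of_real (\<tau> * \<epsilon>) * LL \<epsilon> f g k) (of_real c) a"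
    by (rule taylor_flow_scale) (simp_all add: LL_def fun_eq_iff Bil_scale_left Bil_scale_right)
  moreover have "(\<lambda>f g k. of_real (\<tau> * \<epsilon>) * LL \<epsilon> f g k) = MM \<epsilon> \<tau> 0"
    using e by (simp add: LL_E MM_def fun_eq_iff)
  ultimately show ?thesis by (simp add: mult.assoc)
qed

lemma taylor_flow_MM_twist:
  "taylor_flow (MM \<epsilon> \<tau> 0) h (\<lambda>k. exp (of_real (- (\<theta> * \<tau>)) * A \<epsilon> k) * f k)
     = (\<lambda>k. exp (of_real (- (\<theta> * \<tau>)) * A \<epsilon> k) * taylor_flow (MM \<epsilon> \<tau> \<theta>) h f k)"
proof (rule taylor_flow_twist)
  fix f g
  let ?m = "\<lambda>k. exp (of_real (- (\<theta> * \<tau>)) * A \<epsilon> k)"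
  have inv: "exp (of_real (\<theta> * \<tau>) * A \<epsilon> k) * (?m k * f k) = f k" for k f
    by (simp add: mult.assoc[symmetric] exp_add[symmetric])
  have inv': "?m k * (exp (of_real (\<theta> * \<tau>) * A \<epsilon> k) * z) = z" for k z
    by (simp add: mult.assoc[symmetric] exp_add[symmetric])
  have "CC \<epsilon> (\<theta> * \<tau>) f g k = exp (of_real (\<theta> * \<tau>) * A \<epsilon> k) * CC \<epsilon> 0 (\<lambda>k. ?m k * f k) (\<lambda>k. ?m k * g k) k" for k
    using CC_twist[of \<epsilon> "\<theta> * \<tau>" "\<lambda>k. ?m k * f k" "\<lambda>k. ?m k * g k" k] unfolding inv .
  then have "?m k * CC \<epsilon> (\<theta> * \<tau>) f g k = CC \<epsilon> 0 (\<lambda>k. ?m k * f k) (\<lambda>k. ?m k * g k) k" for k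
    by (simp only: inv')
  then show "MM \<epsilon> \<tau> 0 (\<lambda>k. ?m k * f k) (\<lambda>k. ?m k * g k) = (\<lambda>k. ?m k * MM \<epsilon> \<tau> \<theta> f g k)"
    by (simp add: MM_def fun_eq_iff mult.left_commute)
qed

lemma Psi1_0: "Psi1 \<epsilon> 0 w = w"
  by (simp add: Psi1_def)

lemma Psi_step:
  assumes e: "0 < \<epsilon>" "\<epsilon> \<le> 1" and w: "Hr (fcoeff w)"
  shows "Psi P \<epsilon> \<tau> w = ser (\<lambda>k. exp (- of_real \<tau> * A \<epsilon> k) * split_step \<epsilon> \<tau> (fcoeff w) k)"
    and "Hr (\<lambda>k. exp (- of_real \<tau> * A \<epsilon> k) * split_step \<epsilon> \<tau> (fcoeff w) k)"
proof -
  \<comment> \<open>\<open>m \<theta>\<close> is the linear flow accumulated so far;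
    \<open>\<theta>\<close> runs through \<open>\<sigma>1 / 2\<close>, \<open>1 / 2\<close>,
    \<open>1 - \<sigma>1 / 2\<close> and 1.\<close>
  define m where "m \<theta> k = exp (of_real (- (\<theta> * \<tau>)) * A \<epsilon> k)" for \<theta> k
  have m_add: "m \<theta> k * (m \<theta>' k * z) = m (\<theta>' + \<theta>) k * z" for \<theta> \<theta>' k z
  proof -
    have "m \<theta> k * m \<theta>' k = m (\<theta>' + \<theta>) k"
      by (simp add: m_def exp_add[symmetric] algebra_simps)
    then show ?thesis by (simp add: mult.assoc[symmetric])
  qed
  have P2: "Psi2 P \<epsilon> (d * \<tau>) (ser a) = ser (\<lambda>k. m d k * a k)" if "Hr a" for d a
    by (simp add: Psi2_ser m_def fcoeff_ser[OF Hr_asum[OF that]])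
  have tw: "Hr (\<lambda>k. m d k * a k)" if "Hr a" for d a
    unfolding m_def by (rule Hr_twist[OF that])
  have P1: "Psi1 \<epsilon> (c * \<tau>) (ser (\<lambda>k. m \<theta> k * f k)) = ser (\<lambda>k. m \<theta> k * taylor_flow (MM \<epsilon> \<tau> \<theta>) (of_real c) f k)"
    and H1: "Hr (\<lambda>k. m \<theta> k * taylor_flow (MM \<epsilon> \<tau> \<theta>) (of_real c) f k)" if "Hr (\<lambda>k. m \<theta> k * f k)" for c \<theta> f
    using Psi1_ser[OF e that, of "c * \<tau>"] unfolding taylor_flow_LL_MM[OF e(1)] by (simp_all only: m_def taylor_flow_MM_twist)
  define f1 where "f1 = taylor_flow (MM \<epsilon> \<tau> (\<sigma>1 / 2)) (of_real \<sigma>1) (fcoeff w)"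
  define f2 where "f2 = taylor_flow (MM \<epsilon> \<tau> (1 / 2)) (of_real (1 - 2 * \<sigma>1)) f1"
  define f3 where "f3 = taylor_flow (MM \<epsilon> \<tau> (1 - \<sigma>1 / 2)) (of_real \<sigma>1) f2"
  have h1: "Hr (\<lambda>k. m (\<sigma>1 / 2) k * f1 k)" unfolding f1_def by (intro H1 tw w)
  have e2: "(\<lambda>k. m d2 k * (m (\<sigma>1 / 2) k * f1 k)) = (\<lambda>k. m (1 / 2) k * f1 k)"
    unfolding m_add d2_def sigma2_eq by (simp add: field_simps)
  have h2: "Hr (\<lambda>k. m (1 / 2) k * f2 k)" unfolding f2_def by (intro H1) (use tw[OF h1, of d2] in \<open>simp only: e2\<close>)
  have e3: "(\<lambda>k. m d3 k * (m (1 / 2) k * f2 k)) = (\<lambda>k. m (1 - \<sigma>1 / 2) k * f2 k)"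
    unfolding m_add d3_def sigma2_eq by (simp add: field_simps)
  have h3: "Hr (\<lambda>k. m (1 - \<sigma>1 / 2) k * f3 k)" unfolding f3_def by (intro H1) (use tw[OF h2, of d3] in \<open>simp only: e3\<close>)
  have e4: "(\<lambda>k. m d4 k * (m (1 - \<sigma>1 / 2) k * f3 k)) = (\<lambda>k. m 1 k * f3 k)"
    unfolding m_add d4_def by (simp add: field_simps)
  have fin: "(\<lambda>k. exp (- of_real \<tau> * A \<epsilon> k) * split_step \<epsilon> \<tau> (fcoeff w) k) = (\<lambda>k. m 1 k * f3 k)"
    by (simp add: m_def split_step_def f3_def f2_def f1_def)
  show "Hr (\<lambda>k. exp (- of_real \<tau> * A \<epsilon> k) * split_step \<epsilon> \<tau> (fcoeff w) k)"
    using tw[OF h3, of d4] unfolding fin e4 .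
  \<comment> \<open>As \<open>c1 = 0\<close>, the first operation on \<open>w\<close> is a
    multiplier, which sees \<open>fcoeff w\<close> only. This admits the initial value, which equals
    its Fourier series merely almost everywhere.\<close>
  have s1: "Psi2 P \<epsilon> (d1 * \<tau>) (Psi1 \<epsilon> (c1 * \<tau>) w) = ser (\<lambda>k. m (\<sigma>1 / 2) k * fcoeff w k)"
    by (simp add: c1_def Psi1_0 Psi2_ser m_def d1_def)
  have s2: "Psi1 \<epsilon> (c2 * \<tau>) (ser (\<lambda>k. m (\<sigma>1 / 2) k * fcoeff w k)) = ser (\<lambda>k. m (\<sigma>1 / 2) k * f1 k)"
    unfolding f1_def c2_def by (intro P1 tw w)
  have s3: "Psi2 P \<epsilon> (d2 * \<tau>) (ser (\<lambda>k. m (\<sigma>1 / 2) k * f1 k)) = ser (\<lambda>k. m (1 / 2) k * f1 k)"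
    unfolding P2[OF h1] e2 ..
  have s4: "Psi1 \<epsilon> (c3 * \<tau>) (ser (\<lambda>k. m (1 / 2) k * f1 k)) = ser (\<lambda>k. m (1 / 2) k * f2 k)"
    unfolding f2_def c3_def sigma2_eq by (intro P1) (use tw[OF h1, of d2] in \<open>simp only: e2\<close>)
  have s5: "Psi2 P \<epsilon> (d3 * \<tau>) (ser (\<lambda>k. m (1 / 2) k * f2 k)) = ser (\<lambda>k. m (1 - \<sigma>1 / 2) k * f2 k)"
    unfolding P2[OF h2] e3 ..
  have s6: "Psi1 \<epsilon> (c4 * \<tau>) (ser (\<lambda>k. m (1 - \<sigma>1 / 2) k * f2 k)) = ser (\<lambda>k. m (1 - \<sigma>1 / 2) k * f3 k)"
    unfolding f3_def c4_def by (intro P1) (use tw[OF h2, of d3] in \<open>simp only: e3\<close>)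
  have s7: "Psi2 P \<epsilon> (d4 * \<tau>) (ser (\<lambda>k. m (1 - \<sigma>1 / 2) k * f3 k)) = ser (\<lambda>k. m 1 k * f3 k)"
    unfolding P2[OF h3] e4 ..
  show "Psi P \<epsilon> \<tau> w = ser (\<lambda>k. exp (- of_real \<tau> * A \<epsilon> k) * split_step \<epsilon> \<tau> (fcoeff w) k)"
    unfolding fin Psi_def o_def s1 s2 s3 s4 s5 s6 s7 ..
qed

end

text \<open>The supremum in the theorem is an upper bound only if the norms are bounded. The reverse
  triangle inequality makes the norm continuous in time, and \<open>{0..T}\<close> is
  compact.\<close>

lemma Hs_norm_bdd_above:
  assumes u: "in_C_Hs T s u"
  shows "bdd_above ((\<lambda>t. Hs_norm s (u t)) ` {0..T})"
proof -
  have uH: "u t \<in> Hs s" if "t \<in> {0..T}" for t using u that by (simp add: in_C_Hs_def)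
  have tri: "Hs_norm s (u t) \<le> Hs_norm s (u t') + Hs_norm s (\<lambda>x. u t' x - u t x)"
    "Hs_norm s (u t') \<le> Hs_norm s (u t) + Hs_norm s (\<lambda>x. u t' x - u t x)"
    if t: "t \<in> {0..T}" "t' \<in> {0..T}" for t t'
  proof -
    have L: "u t \<in> L2_torus" "u t' \<in> L2_torus" using uH t by (auto simp: Hs_def)
    have c: "fcoeff (\<lambda>x. u t' x - u t x) = (\<lambda>k. fcoeff (u t') k - fcoeff (u t) k)"
      using L by (simp add: fun_eq_iff fcoeff_diff L2_integrable)
    note h = Hs_hbd[OF uH[OF t(1)]] Hs_hbd[OF uH[OF t(2)]]
    have "(\<lambda>x. u t' x - u t x) \<in> Hs s"
      by (rule hbd_Hs[OF L2_diff[OF L(2,1)]]) (unfold c, rule hbd_diff[OF h(2,1)])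
    from Hs_hbd[OF this] have d: "hbd s (\<lambda>k. fcoeff (u t') k - fcoeff (u t) k) (Hs_norm s (\<lambda>x. u t' x - u t x))"
      unfolding c .
    show "Hs_norm s (u t) \<le> Hs_norm s (u t') + Hs_norm s (\<lambda>x. u t' x - u t x)"
      using hbd_Hs(2)[OF L(1)] hbd_diff[OF h(2) d] by simp
    show "Hs_norm s (u t') \<le> Hs_norm s (u t) + Hs_norm s (\<lambda>x. u t' x - u t x)"
      using hbd_Hs(2)[OF L(2)] hbd_add[OF h(1) d] by simp
  qed
  have "continuous_on {0..T} (\<lambda>t. Hs_norm s (u t))"
    unfolding continuous_on_def
  proof
    fix t assume t: "t \<in> {0..T}"
    have "((\<lambda>t'. Hs_norm s (\<lambda>x. u t' x - u t x)) \<longlongrightarrow> 0) (at t within {0..T})"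
      using u t by (simp add: in_C_Hs_def)
    then have "((\<lambda>t'. Hs_norm s (u t') - Hs_norm s (u t)) \<longlongrightarrow> 0) (at t within {0..T})"
    proof (rule Lim_null_comparison[rotated])
      show "\<forall>\<^sub>F t' in at t within {0..T}. norm (Hs_norm s (u t') - Hs_norm s (u t)) \<le> Hs_norm s (\<lambda>x. u t' x - u t x)"
        unfolding eventually_at_filter
        by (rule always_eventually) (use tri[OF t] in \<open>auto simp: abs_le_iff algebra_simps\<close>)
    qed
    then show "((\<lambda>t. Hs_norm s (u t)) \<longlongrightarrow> Hs_norm s (u t)) (at t within {0..T})"
      by (simp add: LIM_zero_iff)
  qed
  then have "compact ((\<lambda>t. Hs_norm s (u t)) ` {0..T})" by (rule compact_continuous_image) simp
  then show ?thesis by (intro bounded_imp_bdd_above compact_imp_bounded)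
qed

context gbbm begin

text \<open>A single predicate for the whole conclusion, so that \<open>K\<close> and
  \<open>\<tau>0\<close> can be chosen as functions of \<open>M\<close> in one step.
  \<open>M\<close> may be any upper bound of the norms; the supremum is inserted at the end.\<close>

definition error_bound :: "real \<Rightarrow> real \<Rightarrow> real \<Rightarrow> real \<Rightarrow> bool" where
  "error_bound T M K \<tau>0 \<longleftrightarrow> 0 < K \<and> 0 < \<tau>0 \<and> (\<forall>\<epsilon> u. 0 < \<epsilon> \<longrightarrow> \<epsilon> \<le> 1 \<longrightarrow> in_C_Hs T (zz 0) u \<longrightarrow> gBBM_solution P \<epsilon> T u \<longrightarrow>
     (\<forall>t\<in>{0..T}. Hs_norm (zz 0) (u t) \<le> M) \<longrightarrow>
     (\<forall>\<tau> n. 0 < \<tau> \<longrightarrow> \<tau> \<le> \<tau>0 \<longrightarrow> real n * \<tau> \<le> T \<longrightarrow>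
       (\<lambda>x. u (real n * \<tau>) x - (Psi P \<epsilon> \<tau> ^^ n) (u 0) x) \<in> Hs r \<and>
       Hs_norm r (\<lambda>x. u (real n * \<tau>) x - (Psi P \<epsilon> \<tau> ^^ n) (u 0) x) \<le> \<epsilon> powr (1 - \<sigma>) * \<tau> ^ 4 * K))"

lemma Psi_error:
  assumes T: "0 < T"
  shows "\<exists>K \<tau>0. error_bound T M K \<tau>0"
proof -
  obtain K \<tau>0 where K: "0 < K" "0 < \<tau>0" and err: "\<And>\<epsilon> U \<tau> n Y. 0 < \<epsilon> \<Longrightarrow> \<epsilon> \<le> 1 \<Longrightarrow>
    coeff_solution M \<epsilon> T U \<Longrightarrow> 0 < \<tau> \<Longrightarrow> \<tau> \<le> \<tau>0 \<Longrightarrow> real n * \<tau> \<le> T \<Longrightarrow> Y 0 = U 0 \<Longrightarrow>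
    (\<forall>m. Y (Suc m) = (\<lambda>k. exp (- of_real \<tau> * A \<epsilon> k) * split_step \<epsilon> \<tau> (Y m) k)) \<Longrightarrow>
    hbd r (\<lambda>k. U (real n * \<tau>) k - Y n k) (\<epsilon> powr (1 - \<sigma>) * \<tau> ^ 4 * K)"
    using global_error[OF T, of M] by blast
  have "(\<lambda>x. u (real n * \<tau>) x - (Psi P \<epsilon> \<tau> ^^ n) (u 0) x) \<in> Hs r \<and>
       Hs_norm r (\<lambda>x. u (real n * \<tau>) x - (Psi P \<epsilon> \<tau> ^^ n) (u 0) x) \<le> \<epsilon> powr (1 - \<sigma>) * \<tau> ^ 4 * K"
    if e: "0 < \<epsilon>" "\<epsilon> \<le> 1" and u: "in_C_Hs T (zz 0) u" and sol: "gBBM_solution P \<epsilon> T u"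
      and M: "\<forall>t\<in>{0..T}. Hs_norm (zz 0) (u t) \<le> M"
      and t: "0 < \<tau>" "\<tau> \<le> \<tau>0" "real n * \<tau> \<le> T" for \<epsilon> u \<tau> n
  proof -
    have uH: "u t \<in> Hs (zz 0)" if "t \<in> {0..T}" for t using u that by (simp add: in_C_Hs_def)
    have hb: "hbd (zz 0) (fcoeff (u t)) M" if "t \<in> {0..T}" for t
      using hbd_mono[OF Hs_hbd[OF uH[OF that]]] M that by blast
    define Y where "Y = rec_nat (fcoeff (u 0)) (\<lambda>_ y k. exp (- of_real \<tau> * A \<epsilon> k) * split_step \<epsilon> \<tau> y k)"
    have Y0: "Y 0 = fcoeff (u 0)" and YS: "Y (Suc m) = (\<lambda>k. exp (- of_real \<tau> * A \<epsilon> k) * split_step \<epsilon> \<tau> (Y m) k)" for m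
      by (simp_all add: Y_def)
    \<comment> \<open>For \<open>m = 0\<close> the iterate is \<open>u 0\<close> and not its Fourier
      series, so the claim is about its coefficients and square integrability.\<close>
    have num: "Hr (Y m) \<and> fcoeff ((Psi P \<epsilon> \<tau> ^^ m) (u 0)) = Y m \<and> (Psi P \<epsilon> \<tau> ^^ m) (u 0) \<in> L2_torus" for m
    proof (induction m)
      case 0
      have "hbd (zz 2) (fcoeff (u 0)) M" using hbd_weaken[OF hb rho(3)] T by simp
      then show ?case using uH[of 0] T by (auto simp: Y0 Hr_def Hs_def)
    next
      case (Suc m)
      then have "Hr (fcoeff ((Psi P \<epsilon> \<tau> ^^ m) (u 0)))" by simp
      from Psi_step[OF e this, of \<tau>] Suc have "(Psi P \<epsilon> \<tau> ^^ Suc m) (u 0) = ser (Y (Suc m))" "Hr (Y (Suc m))"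
        by (simp_all add: YS)
      then show ?case using fcoeff_ser[OF Hr_asum] ser_L2[OF Hr_asum] by simp
    qed
    have tn: "real n * \<tau> \<in> {0..T}" using t by simp
    have uL: "u (real n * \<tau>) \<in> L2_torus" using uH[OF tn] by (simp add: Hs_def)
    have "hbd r (\<lambda>k. fcoeff (u (real n * \<tau>)) k - Y n k) (\<epsilon> powr (1 - \<sigma>) * \<tau> ^ 4 * K)"
      by (rule err[OF e, of "\<lambda>t. fcoeff (u t)"]) (use hb fcoeff_ode[OF e u sol] t Y0 YS in \<open>auto simp: coeff_solution_def\<close>)
    moreover have "fcoeff (\<lambda>x. u (real n * \<tau>) x - (Psi P \<epsilon> \<tau> ^^ n) (u 0) x) = (\<lambda>k. fcoeff (u (real n * \<tau>)) k - Y n k)"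
      using num[of n] uL by (simp add: fun_eq_iff fcoeff_diff L2_integrable)
    ultimately show ?thesis
      using hbd_Hs[OF L2_diff[OF uL]] num[of n] by simp
  qed
  then show ?thesis using K unfolding error_bound_def by blast
qed

end

theorem theorem9:
  fixes P :: "complex poly" and lam :: nat and \<sigma> r T :: real
  assumes "degree P = lam" and "lam \<ge> 1"
    and "\<And>x::real. Re (poly P (\<i> * of_real x)) = 0"
    and "0 \<le> \<sigma>" and "\<sigma> \<le> 1" and "r \<ge> 0"
    and "r + 1 + 4 * real lam - 2 * \<sigma> > 1 / 2"
    and "T > 0"
  shows "\<exists>(K :: real \<Rightarrow> real) (\<tau>0 :: real \<Rightarrow> real).
    (\<forall>M. K M > 0 \<and> \<tau>0 M > 0) \<and>
    (\<forall>(\<epsilon> :: real) (u :: real \<Rightarrow> real \<Rightarrow> complex).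
       0 < \<epsilon> \<and> \<epsilon> \<le> 1 \<and>
       in_C_Hs T (r + 1 + 4 * real lam - 2 * \<sigma>) u \<and> gBBM_solution P \<epsilon> T u \<longrightarrow>
       (let M = (SUP t\<in>{0..T}. Hs_norm (r + 1 + 4 * real lam - 2 * \<sigma>) (u t)) in
        \<forall>(\<tau> :: real) (n :: nat). 0 < \<tau> \<and> \<tau> \<le> \<tau>0 M \<and> real n * \<tau> \<le> T \<longrightarrow>
          (let e = (\<lambda>x. u (real n * \<tau>) x - (Psi P \<epsilon> \<tau> ^^ n) (u 0) x) in
           e \<in> Hs r \<and> Hs_norm r e \<le> \<epsilon> powr (1 - \<sigma>) * \<tau> ^ 4 * K M)))"
proof -
  interpret gbbm P lam \<sigma> r
    by unfold_locales (use assms in auto)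
  have "\<forall>M. \<exists>K \<tau>0. error_bound T M K \<tau>0" using Psi_error[OF \<open>T > 0\<close>] by blast
  then obtain K \<tau>0 where main: "\<And>M. error_bound T M (K M) (\<tau>0 M)" by metis
  have sup: "\<forall>t\<in>{0..T}. Hs_norm (zz 0) (u t) \<le> (SUP t\<in>{0..T}. Hs_norm (zz 0) (u t))" if "in_C_Hs T (zz 0) u" for u
    using cSUP_upper[OF _ Hs_norm_bdd_above[OF that]] by blast
  show ?thesis
    unfolding zz0[symmetric] Let_def
    by (rule exI[of _ K], rule exI[of _ \<tau>0]) (use main[unfolded error_bound_def] sup in blast)
qed

end
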